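(* There is an algorithm which, given a tournament with vertex set $X$, computes its umodular (bijoin) decomposition tree in $O(|X|^2)$ time.
   Context: For a tournament with finite vertex set $X$, let $N^+(x)$, $N^-(x)$ be the out- and in-neighbourhoods. Its standard homogeneous relation is: for $x\in X$, $u,v\in X\setminus\{x\}$, $H(x|uv)$ holds iff $u,v$ both lie in $N^+(x)$ or both lie in $N^-(x)$. A umodule (bijoin) of the tournament is a subset $U\subseteq X$ such that for all $u,u'\in U$ and $x,x'\in X\setminus U$: $H(u|xx')\Leftrightarrow H(u'|xx')$. The complement of a umodule of a tournament is again a umodule. Umodular decomposition tree. Let $\mathcal{B}=\{\{U,X\setminus U\}: U \text{ a umodule},\ \emptyset\neq U\neq X\}$. Two bipartitions $\{A^1,A^2\}$, $\{B^1,B^2\}$ of $X$ overlap if all four intersections $A^i\cap B^j$ are nonempty; a bipartition in $\mathcal{B}$ is strong if it overlaps no other member of $\mathcal{B}$. The umodular decomposition tree is the unique unrooted tree $T$ whose leaves are labelled bijectively by $X$ and whose edges $e$ correspond bijectively to the strong bipartitions of $\mathcal{B}$ (the leaf labels of the two components of $T-e$ being the two parts). For an internal node $N$ of degree $k$, the leaf labels of the components of $T-N$ form a partition $X_1,\dots,X_k$ of $X$; for $I\subseteq\{1,\dots,k\}$, $1\le|I|<k$, let $B_N(I)=\{\bigcup_{i\in I}X_i, X\setminus\bigcup_{i\in I}X_i\}$. Internal nodes are labelled complete, circular or prime, and the neighbouring subtrees of circular nodes are ordered, so that $\mathcal{B}$ consists exactly of: all $B_N(I)$ for $N$ complete; all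 $B_N(I)$ with $I$ an interval of $\{1,\dots,k\}$ for $N$ circular; all $B_N(\{a\})$ for $N$ prime. *)

theory Defs
  imports Main "HOL-Library.Landau_Symbols"
begin

section \<open>Tournaments and umodules\<close>

definition tournament :: "'a set \<Rightarrow> 'a rel \<Rightarrow> bool" where
  "tournament X R \<longleftrightarrow> finite X \<and> R \<subseteq> X \<times> X \<and> asym R \<and> total_on X R"

definition out_nbhd :: "'a rel \<Rightarrow> 'a \<Rightarrow> 'a set" where
  "out_nbhd R x = R `` {x}"

definition in_nbhd :: "'a rel \<Rightarrow> 'a \<Rightarrow> 'a set" where
  "in_nbhd R x = R\<inverse> `` {x}"

definition homogeneous :: "'a rel \<Rightarrow> 'a \<Rightarrow> 'a \<Rightarrow> 'a \<Rightarrow> bool" where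
  "homogeneous R x u v \<longleftrightarrow>
     (u \<in> out_nbhd R x \<and> v \<in> out_nbhd R x) \<or> (u \<in> in_nbhd R x \<and> v \<in> in_nbhd R x)"

definition umodule :: "'a set \<Rightarrow> 'a rel \<Rightarrow> 'a set \<Rightarrow> bool" where
  "umodule X R U \<longleftrightarrow> U \<subseteq> X \<and>
     (\<forall>u\<in>U. \<forall>u'\<in>U. \<forall>x\<in>X - U. \<forall>x'\<in>X - U. homogeneous R u x x' \<longleftrightarrow> homogeneous R u' x x')"

definition umod_bips :: "'a set \<Rightarrow> 'a rel \<Rightarrow> 'a set set set" where
  "umod_bips X R = {{U, X - U} | U. umodule X R U \<and> U \<noteq> {} \<and> U \<noteq> X}"

definition overlap :: "'a set set \<Rightarrow> 'a set set \<Rightarrow> bool" where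
  "overlap P Q \<longleftrightarrow> (\<forall>A\<in>P. \<forall>B\<in>Q. A \<inter> B \<noteq> {})"

definition strong_bips :: "'a set \<Rightarrow> 'a rel \<Rightarrow> 'a set set set" where
  "strong_bips X R = {P \<in> umod_bips X R. \<forall>Q \<in> umod_bips X R - {P}. \<not> overlap P Q}"

section \<open>Unrooted leaf-labelled trees\<close>

datatype node_kind = Complete | Circular | Prime

text \<open>
  The tree is given by adjacency lists.  The order of the list \<open>nbrs T N\<close> is the (cyclic) order of
  the subtrees around \<open>N\<close>; it carries meaning only if \<open>N\<close> is circular.  \<open>leaf_label\<close> matters only on
  leaves and \<open>kind\<close> only on internal nodes.
\<close>

record 'a ltree =
  nodes :: "nat set"
  nbrs :: "nat \<Rightarrow> nat list"
  leaf_label :: "nat \<Rightarrow> 'a"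
  kind :: "nat \<Rightarrow> node_kind"

definition adjacency :: "'a ltree \<Rightarrow> nat rel" where
  "adjacency T = {(u, v). u \<in> nodes T \<and> v \<in> set (nbrs T u)}"

definition degree :: "'a ltree \<Rightarrow> nat \<Rightarrow> nat" where
  "degree T u = length (nbrs T u)"

definition is_tree :: "'a ltree \<Rightarrow> bool" where
  "is_tree T \<longleftrightarrow>
     finite (nodes T) \<and> nodes T \<noteq> {} \<and>
     (\<forall>u\<in>nodes T. distinct (nbrs T u) \<and> set (nbrs T u) \<subseteq> nodes T) \<and>
     sym (adjacency T) \<and> irrefl (adjacency T) \<and>
     (\<forall>u\<in>nodes T. \<forall>v\<in>nodes T. (u, v) \<in> (adjacency T)\<^sup>*) \<and>
     \<not> (\<exists>p. length p \<ge> 3 \<and> distinct p \<and>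
            (\<forall>i<length p. (p ! i, p ! (Suc i mod length p)) \<in> adjacency T))"

text \<open>Degree 0 is included so that the one-node tree has its node as a leaf.\<close>

definition leaves :: "'a ltree \<Rightarrow> nat set" where
  "leaves T = {u \<in> nodes T. degree T u \<le> 1}"

definition internal :: "'a ltree \<Rightarrow> nat set" where
  "internal T = nodes T - leaves T"

definition edges :: "'a ltree \<Rightarrow> nat set set" where
  "edges T = {{u, v} | u v. (u, v) \<in> adjacency T}"

definition labels_of :: "'a ltree \<Rightarrow> nat set \<Rightarrow> 'a set" where
  "labels_of T S = leaf_label T ` (S \<inter> leaves T)"

definition edge_bip :: "'a ltree \<Rightarrow> nat set \<Rightarrow> 'a set set" where
  "edge_bip T e = (\<lambda>u. labels_of T ((adjacency T - {(x, y). {x, y} = e})\<^sup>* `` {u})) ` e"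

definition node_part :: "'a ltree \<Rightarrow> nat \<Rightarrow> nat \<Rightarrow> 'a set" where
  "node_part T N i =
     labels_of T ((adjacency T - {(x, y). x = N \<or> y = N})\<^sup>* `` {nbrs T N ! i})"

definition node_bip :: "'a set \<Rightarrow> 'a ltree \<Rightarrow> nat \<Rightarrow> nat set \<Rightarrow> 'a set set" where
  "node_bip X T N I = {\<Union>i\<in>I. node_part T N i, X - (\<Union>i\<in>I. node_part T N i)}"

fun kind_admits :: "node_kind \<Rightarrow> nat set \<Rightarrow> bool" where
  "kind_admits Complete I \<longleftrightarrow> True"
| "kind_admits Circular I \<longleftrightarrow> (\<exists>a b. I = {a..<b})"
| "kind_admits Prime I \<longleftrightarrow> (\<exists>a. I = {a})"

definition node_bips :: "'a set \<Rightarrow> 'a ltree \<Rightarrow> nat \<Rightarrow> 'a set set set" where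
  "node_bips X T N = {node_bip X T N I | I.
     I \<subseteq> {..<degree T N} \<and> 1 \<le> card I \<and> card I < degree T N \<and> kind_admits (kind T N) I}"

text \<open>
  If \<open>X\<close> has two elements, the tree is a single edge without internal nodes, while there is one
  (strong) bipartition; the description of the family by internal nodes does not apply then.
\<close>

definition umodular_tree :: "'a set \<Rightarrow> 'a rel \<Rightarrow> 'a ltree \<Rightarrow> bool" where
  "umodular_tree X R T \<longleftrightarrow>
     is_tree T \<and>
     bij_betw (leaf_label T) (leaves T) X \<and>
     bij_betw (edge_bip T) (edges T) (strong_bips X R) \<and>
     (card X \<noteq> 2 \<longrightarrow> umod_bips X R = (\<Union>N\<in>internal T. node_bips X T N))"

section \<open>A word RAM\<close>

text \<open>
  Structured programs over finitely many word variables and finitely many arrays of words, both named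
  by strings.  Every constant, operator, variable access, array access and test costs one unit.
  \<open>W\<close> is the word bound: a computation in which some value is not less than \<open>W\<close> has no
  result.  Subtraction is truncated at 0 and division by 0 gives 0.
\<close>

datatype aexp =
    Const nat
  | Var string
  | Get string aexp
  | Add aexp aexp
  | Sub aexp aexp
  | Mul aexp aexp
  | Div aexp aexp

datatype bexp =
    BLess aexp aexp
  | BEq aexp aexp
  | BNot bexp
  | BAnd bexp bexp

datatype com =
    Skip
  | Assign string aexp
  | Put string aexp aexp
  | Seq com com
  | Cond bexp com com
  | While bexp com

record state =
  var :: "string \<Rightarrow> nat"
  arr :: "string \<Rightarrow> nat \<Rightarrow> nat"

fun aval :: "aexp \<Rightarrow> state \<Rightarrow> nat" where
  "aval (Const c) s = c"
| "aval (Var x) s = var s x"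
| "aval (Get a i) s = arr s a (aval i s)"
| "aval (Add p q) s = aval p s + aval q s"
| "aval (Sub p q) s = aval p s - aval q s"
| "aval (Mul p q) s = aval p s * aval q s"
| "aval (Div p q) s = aval p s div aval q s"

fun bval :: "bexp \<Rightarrow> state \<Rightarrow> bool" where
  "bval (BLess p q) s \<longleftrightarrow> aval p s < aval q s"
| "bval (BEq p q) s \<longleftrightarrow> aval p s = aval q s"
| "bval (BNot b) s \<longleftrightarrow> \<not> bval b s"
| "bval (BAnd b c) s \<longleftrightarrow> bval b s \<and> bval c s"

fun subexps :: "aexp \<Rightarrow> aexp set" where
  "subexps (Const c) = {Const c}"
| "subexps (Var x) = {Var x}"
| "subexps (Get a i) = insert (Get a i) (subexps i)"
| "subexps (Add p q) = insert (Add p q) (subexps p \<union> subexps q)"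
| "subexps (Sub p q) = insert (Sub p q) (subexps p \<union> subexps q)"
| "subexps (Mul p q) = insert (Mul p q) (subexps p \<union> subexps q)"
| "subexps (Div p q) = insert (Div p q) (subexps p \<union> subexps q)"

definition afits :: "nat \<Rightarrow> aexp \<Rightarrow> state \<Rightarrow> bool" where
  "afits W e s \<longleftrightarrow> (\<forall>e'\<in>subexps e. aval e' s < W)"

fun bfits :: "nat \<Rightarrow> bexp \<Rightarrow> state \<Rightarrow> bool" where
  "bfits W (BLess p q) s \<longleftrightarrow> afits W p s \<and> afits W q s"
| "bfits W (BEq p q) s \<longleftrightarrow> afits W p s \<and> afits W q s"
| "bfits W (BNot b) s \<longleftrightarrow> bfits W b s"
| "bfits W (BAnd b c) s \<longleftrightarrow> bfits W b s \<and> bfits W c s"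

fun acost :: "aexp \<Rightarrow> nat" where
  "acost (Const c) = 1"
| "acost (Var x) = 1"
| "acost (Get a i) = acost i + 1"
| "acost (Add p q) = acost p + acost q + 1"
| "acost (Sub p q) = acost p + acost q + 1"
| "acost (Mul p q) = acost p + acost q + 1"
| "acost (Div p q) = acost p + acost q + 1"

fun bcost :: "bexp \<Rightarrow> nat" where
  "bcost (BLess p q) = acost p + acost q + 1"
| "bcost (BEq p q) = acost p + acost q + 1"
| "bcost (BNot b) = bcost b + 1"
| "bcost (BAnd b c) = bcost b + bcost c + 1"

text \<open>
  \<open>run W c s k t\<close>: started in \<open>s\<close>, the program \<open>c\<close> terminates in \<open>t\<close> after \<open>k\<close> units of time.
\<close>

inductive run :: "nat \<Rightarrow> com \<Rightarrow> state \<Rightarrow> nat \<Rightarrow> state \<Rightarrow> bool" for W where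
  Skip: "run W Skip s 1 s"
| Assign: "afits W e s \<Longrightarrow>
    run W (Assign x e) s (acost e + 1) (s\<lparr>var := (var s)(x := aval e s)\<rparr>)"
| Put: "afits W i s \<Longrightarrow> afits W e s \<Longrightarrow>
    run W (Put a i e) s (acost i + acost e + 1)
      (s\<lparr>arr := (arr s)(a := (arr s a)(aval i s := aval e s))\<rparr>)"
| Seq: "run W c s k s' \<Longrightarrow> run W d s' l t \<Longrightarrow> run W (Seq c d) s (k + l) t"
| CondTrue: "bfits W b s \<Longrightarrow> bval b s \<Longrightarrow> run W c s k t \<Longrightarrow>
    run W (Cond b c d) s (bcost b + 1 + k) t"
| CondFalse: "bfits W b s \<Longrightarrow> \<not> bval b s \<Longrightarrow> run W d s k t \<Longrightarrow>
    run W (Cond b c d) s (bcost b + 1 + k) t"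
| WhileFalse: "bfits W b s \<Longrightarrow> \<not> bval b s \<Longrightarrow>
    run W (While b c) s (bcost b + 1) s"
| WhileTrue: "bfits W b s \<Longrightarrow> bval b s \<Longrightarrow> run W c s k s' \<Longrightarrow> run W (While b c) s' l t \<Longrightarrow>
    run W (While b c) s (bcost b + 1 + k + l) t"

section \<open>Input and output\<close>

text \<open>
  The vertices are numbered \<open>0, \<dots>, n - 1\<close> by \<open>f\<close>, and the input is the number \<open>n\<close> together with
  the adjacency matrix, stored row by row; all other memory is zero.
\<close>

definition encode_tournament :: "nat \<Rightarrow> (nat \<Rightarrow> 'a) \<Rightarrow> 'a rel \<Rightarrow> state" where
  "encode_tournament n f R =
     \<lparr>var = (\<lambda>_. 0)(''n'' := n),
      arr = (\<lambda>_ _. 0)(''arc'' :=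
        (\<lambda>p. if p < n * n \<and> (f (p div n), f (p mod n)) \<in> R then 1 else 0))\<rparr>"

text \<open>
  The output is a tree on the nodes \<open>0, \<dots>, size - 1\<close>.  The neighbours of node \<open>u\<close> are stored in
  the segment of the array \<open>nbr\<close> from \<open>first u\<close> up to but excluding \<open>first (u + 1)\<close>, and a leaf
  carries the number of the vertex that labels it.
\<close>

definition decode_tree :: "(nat \<Rightarrow> 'a) \<Rightarrow> state \<Rightarrow> 'a ltree" where
  "decode_tree f t =
     \<lparr>nodes = {..<var t ''size''},
      nbrs = (\<lambda>u. map (arr t ''nbr'') [arr t ''first'' u..<arr t ''first'' (Suc u)]),
      leaf_label = (\<lambda>u. f (arr t ''leaf'' u)),
      kind = (\<lambda>u. if arr t ''kind'' u = 0 then Complete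
                  else if arr t ''kind'' u = 1 then Circular else Prime)\<rparr>"

end

theory Submission
  imports Defs
begin

text \<open>
  Reversing all arcs across a cut does not change the umodules of a tournament.  Switching at one
  vertex \<open>z\<close> so that it dominates all others turns the umodules avoiding \<open>z\<close> into the modules of the
  switched tournament on the remaining vertices, and umodules are closed under complement.  So the
  umodular decomposition tree is the modular decomposition tree of that tournament, with the leaf
  \<open>z\<close> attached to its root; linear nodes become circular.

  Quicksort, with the arcs as comparisons, orders the vertices so that every module is an interval:
  a vertex outside a module compares in the same way with all its members.  An interval is a module
  iff no outside position separates two consecutive positions inside it, so all interval modules are
  found in quadratic time from the extreme separators of each consecutive pair.  A module is strong
  iff no module starts inside it and ends to its right, or ends inside it and starts to its left,
  which is read off from the farthest end for each start and the least start for each end.  The strong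
  modules in preorder give the tree; a node is circular iff it can be cut into two modules.
\<close>

section \<open>Loop programs\<close>

text \<open>Result, running time and absence of overflow have to be proved of one concrete program.
  Restriction to loops whose bound is fixed on entry separates the three: such a program denotes a
  total function \<open>ev\<close>, so correctness needs invariants only; the time is a polynomial
  whose degree is the nesting depth of the loops, here two; and the time in turn bounds every value
  in memory. The comparison used by the sorting is not transitive, so the result is no linear order
  of the tournament; what survives is that no outsider ends up between two members of a module. Each
  pivot rescans all vertices, hence the quadratic bound does not depend on balanced splits. Linear
  nodes become circular because the part containing \<open>z\<close> closes the row of children into
  a cycle: a union of parts that includes it is the complement of a union of children. No node is
  labelled complete. With four or more parts, two children that are not adjacent would have to form
  an interval; with three parts, complete and circular admit the same bipartitions.\<close>

datatype prog =
    PSkip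
  | PAssign string aexp
  | PPut string aexp aexp
  | PSeq prog prog
  | PIf bexp prog prog
  | PFor string string prog

definition setv :: "string \<Rightarrow> nat \<Rightarrow> state \<Rightarrow> state" where
  "setv x v s = s\<lparr>var := (var s)(x := v)\<rparr>"

definition seta :: "string \<Rightarrow> nat \<Rightarrow> nat \<Rightarrow> state \<Rightarrow> state" where
  "seta a i v s = s\<lparr>arr := (arr s)(a := (arr s a)(i := v))\<rparr>"

lemma setv_sel [simp]:
  "var (setv x v s) = (var s)(x := v)" "arr (setv x v s) = arr s"
  by (simp_all add: setv_def)

lemma seta_sel [simp]:
  "var (seta a i v s) = var s" "arr (seta a i v s) = (arr s)(a := (arr s a)(i := v))"
  by (simp_all add: seta_def)

primrec compile :: "prog \<Rightarrow> com" where
  "compile PSkip = Skip"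
| "compile (PAssign x e) = Assign x e"
| "compile (PPut a i e) = Put a i e"
| "compile (PSeq p q) = Seq (compile p) (compile q)"
| "compile (PIf b p q) = Cond b (compile p) (compile q)"
| "compile (PFor x y p) = Seq (Assign x (Const 0))
     (While (BLess (Var x) (Var y)) (Seq (compile p) (Assign x (Add (Var x) (Const 1)))))"

text \<open>The number of rounds of a loop is read from its bound on entry. This agrees with the
  test of the compiled \<open>While\<close>, since \<open>wf_prog\<close> forbids assignments to
  loop bounds.\<close>

primrec ev :: "prog \<Rightarrow> state \<Rightarrow> state" where
  "ev PSkip s = s"
| "ev (PAssign x e) s = setv x (aval e s) s"
| "ev (PPut a i e) s = seta a (aval i s) (aval e s) s"
| "ev (PSeq p q) s = ev q (ev p s)"
| "ev (PIf b p q) s = (if bval b s then ev p s else ev q s)"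
| "ev (PFor x y p) s = ((\<lambda>t. setv x (Suc (var t x)) (ev p t)) ^^ var s y) (setv x 0 s)"

primrec wv :: "prog \<Rightarrow> string set" where
  "wv PSkip = {}"
| "wv (PAssign x e) = {x}"
| "wv (PPut a i e) = {}"
| "wv (PSeq p q) = wv p \<union> wv q"
| "wv (PIf b p q) = wv p \<union> wv q"
| "wv (PFor x y p) = insert x (wv p)"

primrec wa :: "prog \<Rightarrow> string set" where
  "wa PSkip = {}"
| "wa (PAssign x e) = {}"
| "wa (PPut a i e) = {a}"
| "wa (PSeq p q) = wa p \<union> wa q"
| "wa (PIf b p q) = wa p \<union> wa q"
| "wa (PFor x y p) = wa p"

text \<open>An upper bound when all loop bounds are at most \<open>N\<close>; both branches of a
  conditional are charged. In a loop, 6 pays for the initial assignment and the failing test, 8 per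
  round for the successful test and the increment.\<close>

primrec cost :: "nat \<Rightarrow> prog \<Rightarrow> nat" where
  "cost N PSkip = 1"
| "cost N (PAssign x e) = acost e + 1"
| "cost N (PPut a i e) = acost i + acost e + 1"
| "cost N (PSeq p q) = cost N p + cost N q"
| "cost N (PIf b p q) = bcost b + 1 + cost N p + cost N q"
| "cost N (PFor x y p) = 6 + N * (8 + cost N p)"

primrec coef :: "prog \<Rightarrow> nat" where
  "coef PSkip = 1"
| "coef (PAssign x e) = acost e + 1"
| "coef (PPut a i e) = acost i + acost e + 1"
| "coef (PSeq p q) = coef p + coef q"
| "coef (PIf b p q) = bcost b + 1 + coef p + coef q"
| "coef (PFor x y p) = 14 + coef p"

primrec depth :: "prog \<Rightarrow> nat" where
  "depth PSkip = 0"
| "depth (PAssign x e) = 0"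
| "depth (PPut a i e) = 0"
| "depth (PSeq p q) = max (depth p) (depth q)"
| "depth (PIf b p q) = max (depth p) (depth q)"
| "depth (PFor x y p) = Suc (depth p)"

text \<open>A loop contributes one factor \<open>N + 1\<close>, and its constants 6 and 8 are
  absorbed by the summand 14 of \<open>coef\<close>. The quadratic time bound is the instance of
  depth two.\<close>

lemma cost_le: "depth p \<le> d \<Longrightarrow> cost N p \<le> coef p * (N + 1) ^ d"
proof (induction p arbitrary: d)
  case (PFor x y p)
  then obtain e where d: "d = Suc e" "depth p \<le> e"
    by (cases d) auto
  have "6 + N * (8 + cost N p) \<le> 14 * (N + 1) + N * cost N p"
    by (simp add: algebra_simps)
  also have "\<dots> \<le> 14 * (N + 1) ^ d + (N + 1) * (coef p * (N + 1) ^ e)"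
  proof (rule add_mono)
    have "(N + 1) ^ 1 \<le> (N + 1) ^ d"
      by (rule power_increasing) (use d in auto)
    then show "14 * (N + 1) \<le> 14 * (N + 1) ^ d" by simp
    show "N * cost N p \<le> (N + 1) * (coef p * (N + 1) ^ e)"
      using PFor.IH[OF d(2)] by (intro mult_mono) auto
  qed
  finally show ?case
    using d by (simp add: algebra_simps)
next
  case (PSeq p q)
  then have "cost N p \<le> coef p * (N + 1) ^ d" "cost N q \<le> coef q * (N + 1) ^ d" by auto
  then show ?case by (simp add: algebra_simps)
next
  case (PIf b p q)
  then have *: "cost N p \<le> coef p * (N + 1) ^ d" "cost N q \<le> coef q * (N + 1) ^ d" by auto
  have "(bcost b + 1) * 1 \<le> (bcost b + 1) * (N + 1) ^ d"
    by (rule mult_le_mono2) simp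
  with * show ?case by (simp add: algebra_simps)
next
  case (PPut a i e)
  have "(acost i + acost e + 1) * 1 \<le> (acost i + acost e + 1) * (N + 1) ^ d"
    by (rule mult_le_mono2) simp
  then show ?case by simp
next
  case (PAssign x e)
  have "(acost e + 1) * 1 \<le> (acost e + 1) * (N + 1) ^ d"
    by (rule mult_le_mono2) simp
  then show ?case by simp
qed simp

text \<open>While \<open>tame\<close> limits what is stored, \<open>small\<close> limits all
  intermediate values, including indices and operands of tests. With constants at most 2, a value is
  at most a power of the memory bound, with the cost of the expression as exponent.\<close>

fun small :: "aexp \<Rightarrow> bool" where
  "small (Const c) \<longleftrightarrow> c \<le> 2"
| "small (Var x) \<longleftrightarrow> True"
| "small (Get a i) \<longleftrightarrow> small i"
| "small (Add p q) \<longleftrightarrow> small p \<and> small q"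
| "small (Sub p q) \<longleftrightarrow> small p \<and> small q"
| "small (Mul p q) \<longleftrightarrow> small p \<and> small q"
| "small (Div p q) \<longleftrightarrow> small p \<and> small q"

text \<open>Evaluating a tame expression exceeds the largest value in memory by at most one.  Hence the
  running time bounds the values in memory, so that the word bound need not be traced through
  the correctness proof.\<close>

fun tame :: "aexp \<Rightarrow> bool" where
  "tame (Const c) \<longleftrightarrow> c \<le> 2"
| "tame (Var x) \<longleftrightarrow> True"
| "tame (Get a i) \<longleftrightarrow> True"
| "tame (Add (Var x) (Const c)) \<longleftrightarrow> c \<le> 1"
| "tame (Sub p q) \<longleftrightarrow> tame p"
| "tame _ \<longleftrightarrow> False"

fun wfb :: "nat \<Rightarrow> bexp \<Rightarrow> bool" where
  "wfb E (BLess p q) \<longleftrightarrow> small p \<and> small q \<and> acost p \<le> E \<and> acost q \<le> E"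
| "wfb E (BEq p q) \<longleftrightarrow> small p \<and> small q \<and> acost p \<le> E \<and> acost q \<le> E"
| "wfb E (BNot b) \<longleftrightarrow> wfb E b"
| "wfb E (BAnd b c) \<longleftrightarrow> wfb E b \<and> wfb E c"

text \<open>\<open>Y\<close> collects the variables that serve as loop bounds; none of them is
  assigned, so an estimate of their values survives the run. \<open>E\<close> limits the cost, and
  thereby the size, of each expression.\<close>

primrec wf_prog :: "nat \<Rightarrow> string set \<Rightarrow> prog \<Rightarrow> bool" where
  "wf_prog E Y PSkip \<longleftrightarrow> True"
| "wf_prog E Y (PAssign x e) \<longleftrightarrow> x \<notin> Y \<and> tame e \<and> small e \<and> acost e \<le> E"
| "wf_prog E Y (PPut a i e) \<longleftrightarrow> tame e \<and> small e \<and> small i \<and> acost e \<le> E \<and> acost i \<le> E"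
| "wf_prog E Y (PSeq p q) \<longleftrightarrow> wf_prog E Y p \<and> wf_prog E Y q"
| "wf_prog E Y (PIf b p q) \<longleftrightarrow> wfb E b \<and> wf_prog E Y p \<and> wf_prog E Y q"
| "wf_prog E Y (PFor x y p) \<longleftrightarrow> 3 \<le> E \<and> y \<in> Y \<and> x \<notin> Y \<and> x \<notin> wv p \<and> wf_prog E Y p"

lemma ev_var: "x \<notin> wv p \<Longrightarrow> var (ev p s) x = var s x"
proof (induction p arbitrary: s)
  case (PFor z y p)
  have "var (((\<lambda>t. setv z (Suc (var t z)) (ev p t)) ^^ i) t) x = var t x" for i t
    by (induction i) (use PFor in auto)
  with PFor show ?case by simp
qed auto

lemma ev_arr: "a \<notin> wa p \<Longrightarrow> arr (ev p s) a = arr s a"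
proof (induction p arbitrary: s)
  case (PFor z y p)
  have "arr (((\<lambda>t. setv z (Suc (var t z)) (ev p t)) ^^ i) t) a = arr t a" for i t
    by (induction i) (use PFor in auto)
  with PFor show ?case by simp
qed auto

lemma wf_prog_wv: "wf_prog E Y p \<Longrightarrow> y \<in> Y \<Longrightarrow> y \<notin> wv p"
  by (induction p) auto

text \<open>The invariant rule for all loops of the program. Its step also receives the frame facts
  about everything the body does not write, so that an invariant has to mention only what
  changes.\<close>

lemma ev_For_induct:
  assumes x: "x \<notin> wv p" and y: "y \<notin> wv p" "x \<noteq> y"
    and "I 0 (setv x 0 s)"
    and step: "\<And>i t. i < var s y \<Longrightarrow> I i t \<Longrightarrow> var t x = i \<Longrightarrow>
      (\<And>z. z \<notin> insert x (wv p) \<Longrightarrow> var t z = var s z) \<Longrightarrow>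
      (\<And>a. a \<notin> wa p \<Longrightarrow> arr t a = arr s a) \<Longrightarrow> I (Suc i) (setv x (Suc i) (ev p t))"
  shows "I (var s y) (ev (PFor x y p) s)"
proof -
  let ?t = "\<lambda>i. ((\<lambda>t. setv x (Suc (var t x)) (ev p t)) ^^ i) (setv x 0 s)"
  have "i \<le> var s y \<Longrightarrow> I i (?t i) \<and> var (?t i) x = i \<and>
      (\<forall>z. z \<notin> insert x (wv p) \<longrightarrow> var (?t i) z = var s z) \<and>
      (\<forall>a. a \<notin> wa p \<longrightarrow> arr (?t i) a = arr s a)" for i
  proof (induction i)
    case 0
    then show ?case using assms(4) by simp
  next
    case (Suc i)
    then have "I (Suc i) (setv x (Suc i) (ev p (?t i)))"
      by (intro step) auto
    with Suc show ?case by (auto simp: ev_var ev_arr)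
  qed
  from this[of "var s y"] show ?thesis by simp
qed

section \<open>Memory growth and absence of overflow\<close>

definition cells_le :: "nat \<Rightarrow> state \<Rightarrow> bool" where
  "cells_le B s \<longleftrightarrow> (\<forall>x. var s x \<le> B) \<and> (\<forall>a i. arr s a i \<le> B)"

lemma cells_le_mono: "cells_le B s \<Longrightarrow> B \<le> C \<Longrightarrow> cells_le C s"
  by (meson cells_le_def order_trans)

lemma cells_le_setv: "cells_le B s \<Longrightarrow> v \<le> B \<Longrightarrow> cells_le B (setv x v s)"
  by (simp add: cells_le_def)

lemma cells_le_seta: "cells_le B s \<Longrightarrow> v \<le> B \<Longrightarrow> cells_le B (seta a i v s)"
  by (simp add: cells_le_def)

lemma aval_tame: "tame e \<Longrightarrow> cells_le B s \<Longrightarrow> 2 \<le> B \<Longrightarrow> aval e s \<le> B + 1"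
proof (induction e rule: tame.induct)
  case (2 x) then show ?case by (auto simp: cells_le_def le_SucI)
next
  case (3 a i) then show ?case by (auto simp: cells_le_def le_SucI)
next
  case (4 x c)
  then have "var s x \<le> B" by (auto simp: cells_le_def)
  with 4 show ?case by simp
qed auto

lemma aval_small: "small e \<Longrightarrow> cells_le B s \<Longrightarrow> 2 \<le> B \<Longrightarrow> aval e s \<le> B ^ acost e"
proof (induction e)
  case (Get a i)
  then have "arr s a (aval i s) \<le> B" by (auto simp: cells_le_def)
  also have "B ^ 1 \<le> B ^ acost (Get a i)"
    using Get by (intro power_increasing) auto
  then have "B \<le> B ^ acost (Get a i)" by simp
  finally show ?case by simp
next
  case (Add p q)
  let ?k = "acost p + acost q"
  have "B ^ acost p \<le> B ^ ?k" "B ^ acost q \<le> B ^ ?k"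
    using Add by (auto intro: power_increasing)
  moreover have "aval p s \<le> B ^ acost p" "aval q s \<le> B ^ acost q"
    using Add by auto
  ultimately have "aval p s + aval q s \<le> 2 * B ^ ?k" by linarith
  also have "\<dots> \<le> B * B ^ ?k" using Add by (intro mult_right_mono) auto
  finally show ?case by simp
next
  case (Sub p q)
  have "B ^ acost p \<le> B ^ (acost p + acost q + 1)"
    using Sub by (intro power_increasing) auto
  with Sub show ?case by fastforce
next
  case (Div p q)
  have "B ^ acost p \<le> B ^ (acost p + acost q + 1)"
    using Div by (intro power_increasing) auto
  with Div have "aval p s \<le> B ^ acost (Div p q)" by fastforce
  moreover have "aval p s div aval q s \<le> aval p s" by simp
  ultimately show ?case by (metis aval.simps(7) order_trans)
next
  case (Mul p q)
  have "aval p s * aval q s \<le> B ^ acost p * B ^ acost q"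
    using Mul by (intro mult_le_mono) auto
  also have "\<dots> = B ^ (acost p + acost q)" by (simp add: power_add)
  also have "\<dots> \<le> B ^ (acost p + acost q + 1)"
    using Mul by (intro power_increasing) auto
  finally show ?case by simp
qed (auto simp: cells_le_def)

lemma subexps_small: "e' \<in> subexps e \<Longrightarrow> small e \<Longrightarrow> small e' \<and> acost e' \<le> acost e"
  by (induction e) auto

lemma afits_small:
  assumes "small e" "acost e \<le> E" "cells_le B s" "B \<le> Z" "2 \<le> B" "Z ^ E < W"
  shows "afits W e s"
  unfolding afits_def
proof
  fix e' assume "e' \<in> subexps e"
  with assms have e': "small e'" "acost e' \<le> E"
    using subexps_small by (blast, meson subexps_small order_trans)
  have "cells_le Z s" using assms cells_le_mono by blast
  then have "aval e' s \<le> Z ^ acost e'"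
    using aval_small[of e' Z s] e' assms by linarith
  also have "\<dots> \<le> Z ^ E" using e' assms by (intro power_increasing) auto
  finally show "aval e' s < W" using assms by simp
qed

lemma bfits_small:
  assumes "wfb E b" "cells_le B s" "B \<le> Z" "2 \<le> B" "Z ^ E < W"
  shows "bfits W b s"
  using assms by (induction b) (auto intro: afits_small)

text \<open>Storing a tame value raises the maximum of the memory by at most one and costs at least
  one unit, so the maximum grows no faster than the time.\<close>

lemma ev_cells_le:
  "wf_prog E Y p \<Longrightarrow> cells_le B s \<Longrightarrow> 2 \<le> B \<Longrightarrow> \<forall>y\<in>Y. var s y \<le> N \<Longrightarrow>
   cells_le (B + cost N p) (ev p s)"
proof (induction p arbitrary: B s)
  case (PAssign x e)
  then have "aval e s \<le> B + cost N (PAssign x e)"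
    using aval_tame[of e B s] by simp
  with PAssign show ?case
    by (auto intro!: cells_le_setv elim: cells_le_mono)
next
  case (PPut a i e)
  then have "aval e s \<le> B + cost N (PPut a i e)"
    using aval_tame[of e B s] by simp
  with PPut show ?case
    by (auto intro!: cells_le_seta elim: cells_le_mono)
next
  case (PSeq p q)
  then have p: "cells_le (B + cost N p) (ev p s)" by auto
  have "cells_le (B + cost N p + cost N q) (ev q (ev p s))"
    using PSeq p by (intro PSeq.IH) (auto simp: ev_var wf_prog_wv)
  then show ?case by (simp add: add.assoc)
next
  case (PIf b p q)
  then have "cells_le (B + cost N p) (ev p s)" "cells_le (B + cost N q) (ev q s)" by auto
  then show ?case by (auto elim!: cells_le_mono)
next
  case (PFor x y p)
  let ?t = "\<lambda>i. ((\<lambda>t. setv x (Suc (var t x)) (ev p t)) ^^ i) (setv x 0 s)"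
  have "cells_le (B + i * (cost N p + 1)) (?t i) \<and> (\<forall>y\<in>Y. var (?t i) y \<le> N)" for i
  proof (induction i)
    case 0
    then show ?case using PFor by (auto intro!: cells_le_setv)
  next
    case (Suc i)
    have *: "cells_le (B + i * (cost N p + 1) + cost N p) (ev p (?t i))"
      using Suc PFor by (intro PFor.IH) auto
    have "var (?t i) x \<le> B + i * (cost N p + 1)"
      using Suc by (auto simp: cells_le_def)
    with * have "cells_le (B + Suc i * (cost N p + 1)) (?t (Suc i))"
      by (auto intro!: cells_le_setv elim!: cells_le_mono)
    moreover have "\<forall>y\<in>Y. var (?t (Suc i)) y \<le> N"
      using Suc PFor.prems by (auto simp: ev_var wf_prog_wv)
    ultimately show ?case by blast
  qed
  from this[of "var s y"]
  have "cells_le (B + var s y * (cost N p + 1)) (ev (PFor x y p) s)" by simp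
  moreover have "var s y * (cost N p + 1) \<le> cost N (PFor x y p)"
  proof -
    have "var s y * (cost N p + 1) \<le> N * (8 + cost N p)"
      using PFor.prems by (intro mult_le_mono) auto
    then show ?thesis by simp
  qed
  ultimately show ?case by (meson add_left_mono cells_le_mono)
qed (auto elim: cells_le_mono)

lemma run_Assign_setv:
  "afits W e s \<Longrightarrow> run W (Assign x e) s (acost e + 1) (setv x (aval e s) s)"
  unfolding setv_def by (rule run.Assign)

text \<open>During the run all cells are at most \<open>Z\<close>, so every intermediate value is at
  most \<open>Z ^ E\<close>, which is below the word bound. The estimate for the cells is carried
  along the induction by \<open>ev_cells_le\<close>.\<close>

lemma run_compile:
  "wf_prog E Y p \<Longrightarrow> cells_le B s \<Longrightarrow> 2 \<le> B \<Longrightarrow> \<forall>y\<in>Y. var s y \<le> N \<Longrightarrow>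
   B + cost N p \<le> Z \<Longrightarrow> Z ^ E < W \<Longrightarrow> \<exists>k\<le>cost N p. run W (compile p) s k (ev p s)"
proof (induction p arbitrary: B s)
  case PSkip
  show ?case using run.Skip by force
next
  case (PAssign x e)
  have "afits W e s"
    using PAssign by (intro afits_small[of e E B s Z]) auto
  then have "run W (Assign x e) s (acost e + 1) (setv x (aval e s) s)"
    unfolding setv_def by (rule run.Assign)
  then show ?case by auto
next
  case (PPut a i e)
  have "afits W e s" "afits W i s"
    using PPut by (auto intro!: afits_small[of _ E B s Z])
  then have "run W (Put a i e) s (acost i + acost e + 1) (seta a (aval i s) (aval e s) s)"
    unfolding seta_def by (intro run.Put)
  then show ?case by auto
next
  case (PSeq p q)
  have "\<exists>k\<le>cost N p. run W (compile p) s k (ev p s)"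
    using PSeq.prems by (intro PSeq.IH) auto
  moreover have "\<exists>k\<le>cost N q. run W (compile q) (ev p s) k (ev q (ev p s))"
    using PSeq.prems ev_cells_le[of E Y p B s N]
    by (intro PSeq.IH(2)[of "B + cost N p"]) (auto simp: ev_var wf_prog_wv)
  ultimately obtain k l where "k \<le> cost N p" "l \<le> cost N q"
    "run W (compile p) s k (ev p s)" "run W (compile q) (ev p s) l (ev q (ev p s))" by blast
  then show ?case by (intro exI[of _ "k + l"]) (auto intro: run.Seq)
next
  case (PIf b p q)
  have b: "bfits W b s"
    using PIf.prems by (intro bfits_small[of E b B s Z]) auto
  show ?case
  proof (cases "bval b s")
    case True
    have "\<exists>k\<le>cost N p. run W (compile p) s k (ev p s)"
      using PIf.prems by (intro PIf.IH) auto
    then obtain k where "k \<le> cost N p" "run W (compile p) s k (ev p s)" by blast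
    with b True show ?thesis
      by (intro exI[of _ "bcost b + 1 + k"] conjI) (simp, auto intro!: run.CondTrue[simplified])
  next
    case False
    have "\<exists>k\<le>cost N q. run W (compile q) s k (ev q s)"
      using PIf.prems by (intro PIf.IH) auto
    then obtain k where "k \<le> cost N q" "run W (compile q) s k (ev q s)" by blast
    with b False show ?thesis
      by (intro exI[of _ "bcost b + 1 + k"] conjI) (simp, auto intro!: run.CondFalse[simplified])
  qed
next
  case (PFor x y p)
  let ?f = "\<lambda>t. setv x (Suc (var t x)) (ev p t)"
  let ?t = "\<lambda>i. (?f ^^ i) (setv x 0 s)"
  let ?M = "var s y"
  let ?g = "BLess (Var x) (Var y)"
  let ?inc = "Assign x (Add (Var x) (Const 1))"
  let ?w = "While ?g (Seq (compile p) ?inc)"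
  have MN: "?M \<le> N" using PFor.prems by auto
  have inv: "cells_le (B + i * (cost N p + 1)) (?t i) \<and> (\<forall>y\<in>Y. var (?t i) y = var s y)
      \<and> var (?t i) x = i" for i
  proof (induction i)
    case 0
    then show ?case using PFor by (auto intro!: cells_le_setv)
  next
    case (Suc i)
    have *: "cells_le (B + i * (cost N p + 1) + cost N p) (ev p (?t i))"
      using Suc PFor by (intro ev_cells_le[of E Y]) auto
    have "var (?t i) x \<le> B + i * (cost N p + 1)"
      using Suc by (auto simp: cells_le_def)
    with * have "cells_le (B + Suc i * (cost N p + 1)) (?t (Suc i))"
      by (auto intro!: cells_le_setv elim!: cells_le_mono)
    moreover have "\<forall>y\<in>Y. var (?t (Suc i)) y = var s y"
      using Suc PFor.prems by (auto simp: ev_var wf_prog_wv)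
    ultimately show ?case using Suc by simp
  qed
  have bnd: "B + Suc i * (cost N p + 1) \<le> Z" if "i < ?M" for i
  proof -
    have "Suc i * (cost N p + 1) \<le> N * (8 + cost N p)"
      using that MN by (intro mult_le_mono) auto
    then show ?thesis using PFor.prems by simp
  qed
  have y: "var (?t i) y = ?M" for i
    using inv PFor.prems by auto
  have g: "bfits W ?g (?t i)" if "i \<le> ?M" for i
  proof (rule bfits_small[of E])
    show "wfb E ?g" using PFor.prems by auto
    show "cells_le (B + i * (cost N p + 1)) (?t i)" using inv by auto
    have "i * (cost N p + 1) \<le> N * (8 + cost N p)"
      using that MN by (intro mult_le_mono) auto
    then show "B + i * (cost N p + 1) \<le> Z" using PFor.prems by simp
    show "2 \<le> B + i * (cost N p + 1)" using PFor.prems by auto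
  qed (use PFor.prems in auto)
  have body: "\<exists>k\<le>cost N p + 4. run W (Seq (compile p) ?inc) (?t i) k (?t (Suc i))" if "i < ?M" for i
  proof -
    have "\<exists>k\<le>cost N p. run W (compile p) (?t i) k (ev p (?t i))"
      using PFor.prems inv[of i] bnd[OF that]
      by (intro PFor.IH[of "B + i * (cost N p + 1)"]) auto
    then obtain k where k: "k \<le> cost N p" "run W (compile p) (?t i) k (ev p (?t i))" by blast
    have "cells_le (B + i * (cost N p + 1) + cost N p) (ev p (?t i))"
      using inv PFor.prems by (intro ev_cells_le[of E Y]) auto
    then have fit: "afits W (Add (Var x) (Const 1)) (ev p (?t i))"
      using bnd[OF that] PFor.prems
      by (intro afits_small[of _ E "B + i * (cost N p + 1) + cost N p" _ Z]) auto
    have "run W ?inc (ev p (?t i)) (acost (Add (Var x) (Const 1)) + 1)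
        (setv x (aval (Add (Var x) (Const 1)) (ev p (?t i))) (ev p (?t i)))"
      by (rule run_Assign_setv[OF fit])
    moreover have "setv x (aval (Add (Var x) (Const 1)) (ev p (?t i))) (ev p (?t i)) = ?t (Suc i)"
      using PFor.prems by (simp add: ev_var)
    moreover have "acost (Add (Var x) (Const 1)) + 1 = 4" by simp
    ultimately have "run W ?inc (ev p (?t i)) 4 (?t (Suc i))" by (simp only:)
    with k show ?thesis by (intro exI[of _ "k + 4"]) (auto intro: run.Seq)
  qed
  \<comment> \<open>Induction on the number of remaining rounds, because a run of
    \<open>While\<close> is built from its end.\<close>
  have while: "j \<le> ?M \<Longrightarrow> \<exists>k\<le>4 + j * (8 + cost N p). run W ?w (?t (?M - j)) k (?t ?M)" for j
  proof (induction j)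
    case 0
    have "run W ?w (?t ?M) (bcost ?g + 1) (?t ?M)"
      using g[of ?M] y[of ?M] inv[of ?M] by (intro run.WhileFalse) auto
    then show ?case by (intro exI[of _ "bcost ?g + 1"] conjI) simp_all
  next
    case (Suc j)
    let ?i = "?M - Suc j"
    have i: "?i < ?M" "Suc ?i = ?M - j" using Suc by auto
    obtain k where k: "k \<le> cost N p + 4" "run W (Seq (compile p) ?inc) (?t ?i) k (?t (?M - j))"
      using body[OF i(1)] i(2) by auto
    obtain l where l: "l \<le> 4 + j * (8 + cost N p)" "run W ?w (?t (?M - j)) l (?t ?M)"
      using Suc by auto
    have "run W ?w (?t ?i) (bcost ?g + 1 + k + l) (?t ?M)"
      using g[of ?i] y[of ?i] inv[of ?i] i by (intro run.WhileTrue[OF _ _ k(2) l(2)]) auto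
    moreover have "bcost ?g + 1 + k + l \<le> 4 + Suc j * (8 + cost N p)"
      using k l by simp
    ultimately show ?case by blast
  qed
  obtain k where k: "k \<le> 4 + ?M * (8 + cost N p)" "run W ?w (?t 0) k (?t ?M)"
    using while[of ?M] by auto
  have "2 \<le> Z" using PFor.prems by linarith
  then have "afits W (Const 0) s"
    using PFor.prems by (intro afits_small[of _ E B s Z]) auto
  from run_Assign_setv[OF this, of x]
  have "run W (Assign x (Const 0)) s 2 (?t 0)" by (simp add: numeral_2_eq_2)
  with k have "run W (compile (PFor x y p)) s (2 + k) (?t ?M)"
    using run.Seq[of W _ s 2 "?t 0" ?w k] by simp
  moreover have "?t ?M = ev (PFor x y p) s" by simp
  moreover have "2 + k \<le> cost N (PFor x y p)"
  proof -
    have "?M * (8 + cost N p) \<le> N * (8 + cost N p)" using MN by (rule mult_le_mono1)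
    with k(1) have "2 + k \<le> 6 + N * (8 + cost N p)" by linarith
    then show ?thesis by (simp only: cost.simps)
  qed
  ultimately show ?case by metis
qed

section \<open>Modules of a tournament on an initial segment of the naturals\<close>

text \<open>Only arcs leaving the outsider \<open>x\<close> are compared; in a tournament they
  determine the arcs entering it, so these are the usual modules.\<close>

definition nmodule :: "nat \<Rightarrow> (nat \<Rightarrow> nat \<Rightarrow> bool) \<Rightarrow> nat set \<Rightarrow> bool" where
  "nmodule m b S \<longleftrightarrow> S \<subseteq> {..<m} \<and> (\<forall>x<m. x \<notin> S \<longrightarrow> (\<forall>k\<in>S. \<forall>l\<in>S. b x k \<longleftrightarrow> b x l))"

lemma nmoduleD: "nmodule m b S \<Longrightarrow> x < m \<Longrightarrow> x \<notin> S \<Longrightarrow> k \<in> S \<Longrightarrow> l \<in> S \<Longrightarrow> b x k = b x l"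
  unfolding nmodule_def by blast

lemma nmodule_Un:
  assumes "nmodule m b S" "nmodule m b T" "S \<inter> T \<noteq> {}"
  shows "nmodule m b (S \<union> T)"
proof -
  obtain z where "z \<in> S" "z \<in> T" using assms by blast
  then have "b x k = b x z" if "x < m" "x \<notin> S \<union> T" "k \<in> S \<union> T" for x k
    using that nmoduleD[OF assms(1), of x k z] nmoduleD[OF assms(2), of x k z] by blast
  moreover have "S \<union> T \<subseteq> {..<m}" using assms by (auto simp: nmodule_def)
  ultimately show ?thesis unfolding nmodule_def by metis
qed

lemma nmodule_Int:
  assumes "nmodule m b S" "nmodule m b T"
  shows "nmodule m b (S \<inter> T)"
  using assms unfolding nmodule_def by blast

text \<open>One partition step of quicksort. A label names a class by the position at which it
  begins; the class of the pivot \<open>p\<close> is split into its \<open>k\<close> dominators,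
  \<open>p\<close> itself, and the vertices dominated by \<open>p\<close>.\<close>

definition qs_step :: "nat \<Rightarrow> (nat \<Rightarrow> nat \<Rightarrow> bool) \<Rightarrow> nat \<Rightarrow> (nat \<Rightarrow> nat) \<Rightarrow> nat \<Rightarrow> nat" where
  "qs_step m b p l v =
     (let k = card {u. u < m \<and> l u = l p \<and> b u p} in
      if l v = l p then if v = p then l p + k else if b p v then Suc (l p + k) else l v else l v)"

primrec qs_label :: "nat \<Rightarrow> (nat \<Rightarrow> nat \<Rightarrow> bool) \<Rightarrow> nat \<Rightarrow> nat \<Rightarrow> nat" where
  "qs_label m b 0 = (\<lambda>_. 0)"
| "qs_label m b (Suc p) = qs_step m b p (qs_label m b p)"

text \<open>Labels count the vertices in smaller classes, so they turn into positions as soon as all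
  classes are singletons.\<close>

definition ranked :: "nat \<Rightarrow> (nat \<Rightarrow> nat) \<Rightarrow> bool" where
  "ranked m l \<longleftrightarrow> (\<forall>v<m. l v = card {u. u < m \<and> l u < l v})"

locale nat_tournament =
  fixes m :: nat and b :: "nat \<Rightarrow> nat \<Rightarrow> bool"
  assumes irr: "v < m \<Longrightarrow> \<not> b v v"
    and anti: "u < m \<Longrightarrow> v < m \<Longrightarrow> u \<noteq> v \<Longrightarrow> b u v \<longleftrightarrow> \<not> b v u"
begin

text \<open>The orientation of arcs is what makes this work. For \<open>x\<close> in
  \<open>S\<close>, a vertex of \<open>T - S\<close> cannot tell \<open>x\<close> from
  \<open>z\<close>, and by antisymmetry \<open>x\<close> and \<open>z\<close> then treat
  \<open>T - S\<close> alike; but \<open>z\<close> lies outside \<open>T\<close> and is uniform on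
  it.\<close>

lemma nmodule_Diff:
  assumes "nmodule m b S" "nmodule m b T" "S - T \<noteq> {}"
  shows "nmodule m b (T - S)"
proof -
  obtain z where z: "z \<in> S" "z \<notin> T" using assms by blast
  have sub: "S \<subseteq> {..<m}" "T \<subseteq> {..<m}" using assms by (auto simp: nmodule_def)
  have "b x k = b x l" if x: "x < m" "x \<notin> T - S" and k: "k \<in> T - S" and l: "l \<in> T - S" for x k l
  proof (cases "x \<in> S")
    case True
    have "b y x = b y z" if "y \<in> T - S" for y
      using nmoduleD[OF assms(1), of y x z] that True z sub by blast
    then have "b x y = b z y" if "y \<in> T - S" for y
      using that anti[of x y] anti[of z y] True z sub by blast
    moreover have "b z k = b z l"
      using nmoduleD[OF assms(2), of z k l] z k l sub by blast
    ultimately show ?thesis using k l by simp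
  next
    case False
    then show ?thesis using nmoduleD[OF assms(2), of x k l] x k l by blast
  qed
  then show ?thesis using sub unfolding nmodule_def by blast
qed

context
  fixes p l l' k
  assumes p: "p < m" and rk: "ranked m l"
  defines "l' \<equiv> qs_step m b p l" and "k \<equiv> card {u. u < m \<and> l u = l p \<and> b u p}"
begin

lemma qs_step_other: "l v \<noteq> l p \<Longrightarrow> l' v = l v"
  by (simp add: l'_def qs_step_def)

lemma qs_step_in: "v < m \<Longrightarrow> l v = l p \<Longrightarrow> b v p \<Longrightarrow> l' v = l p"
  using anti[of p v] irr[of p] p by (auto simp: l'_def qs_step_def Let_def)

lemma qs_step_pivot: "l' p = l p + k"
  by (simp add: l'_def qs_step_def k_def)

lemma qs_step_out: "v < m \<Longrightarrow> l v = l p \<Longrightarrow> b p v \<Longrightarrow> l' v = Suc (l p + k)"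
  using irr[of p] p by (auto simp: l'_def qs_step_def k_def Let_def)

text \<open>New labels must not run into the next class. Besides the \<open>k\<close> dominators the
  class contains the pivot and, in the last case, \<open>v\<close> itself, which leaves enough
  room.\<close>

lemma qs_step_class_less:
  assumes "v < m" "l v = l p"
  shows "l' v < l p + card {u. u < m \<and> l u = l p}"
proof -
  let ?C = "{u. u < m \<and> l u = l p}" and ?L = "{u. u < m \<and> l u = l p \<and> b u p}"
  have pL: "p \<notin> ?L" using irr p by simp
  consider "b v p" | "v = p" | "v \<noteq> p" "b p v" using anti p assms by blast
  then show ?thesis
  proof cases
    case 1
    have "card ?C > 0" using p by (auto simp: card_gt_0_iff)
    then show ?thesis using 1 assms by (simp add: qs_step_in)
  next
    case 2
    have "card (insert p ?L) \<le> card ?C" using p by (intro card_mono) auto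
    then show ?thesis using 2 pL by (simp add: qs_step_pivot k_def)
  next
    case 3
    have "v \<notin> insert p ?L" using 3 anti[of p v] p assms by auto
    moreover have "card (insert v (insert p ?L)) \<le> card ?C" using p assms by (intro card_mono) auto
    ultimately show ?thesis using 3 pL assms by (simp add: qs_step_out k_def)
  qed
qed

lemma ranked_class:
  assumes "u < m" "v < m" "l u < l v"
  shows "l u + card {w. w < m \<and> l w = l u} \<le> l v"
proof -
  have "l u + card {w. w < m \<and> l w = l u} =
      card {w. w < m \<and> l w < l u} + card {w. w < m \<and> l w = l u}"
    using rk assms by (simp add: ranked_def)
  also have "\<dots> = card ({w. w < m \<and> l w < l u} \<union> {w. w < m \<and> l w = l u})"
    by (intro card_Un_disjoint[symmetric]) auto
  also have "\<dots> \<le> card {w. w < m \<and> l w < l v}"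
    using assms by (intro card_mono) auto
  also have "\<dots> = l v" using rk assms by (simp add: ranked_def)
  finally show ?thesis .
qed

lemma qs_step_ge: "v < m \<Longrightarrow> l v \<le> l' v"
  by (auto simp: l'_def qs_step_def Let_def)

lemma qs_step_mono:
  assumes "u < m" "v < m" "l u < l v"
  shows "l' u < l' v"
proof -
  have "l' u < l v"
    using qs_step_class_less[of u] ranked_class[OF assms] qs_step_other[of u] assms
    by (cases "l u = l p") auto
  then show ?thesis using qs_step_ge[of v] assms by simp
qed

lemma qs_step_eqD: "u < m \<Longrightarrow> v < m \<Longrightarrow> l' u = l' v \<Longrightarrow> l u = l v"
  by (metis linorder_neqE_nat less_irrefl qs_step_mono)

lemma qs_step_class_order:
  assumes "u < m" "v < m" "l u = l p" "l v = l p"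
  shows "l' u < l' v \<longleftrightarrow> b u p \<and> \<not> b v p \<or> u = p \<and> b p v"
proof -
  have k: "0 < k" if "b w p" "w < m" "l w = l p" for w
    using that by (auto simp: k_def card_gt_0_iff)
  have w: "b w p \<or> w = p \<or> b p w" if "w < m" for w using anti p that by blast
  have nb: "\<not> (b w p \<and> b p w)" if "w < m" for w using anti irr p that by blast
  have "\<not> b p p" using irr p by simp
  then show ?thesis
    using assms w[of u] w[of v] nb[of u] nb[of v] k[of u] k[of v] qs_step_pivot
      qs_step_in[of u] qs_step_in[of v] qs_step_out[of u] qs_step_out[of v]
    by auto
qed

lemma ranked_step: "ranked m l'"
  unfolding ranked_def
proof (intro allI impI)
  fix v assume v: "v < m"
  show "l' v = card {u. u < m \<and> l' u < l' v}"
  proof (cases "l v = l p")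
    case False
    have "l' u < l' v \<longleftrightarrow> l u < l v" if "u < m" for u
      using that v False qs_step_mono[of u v] qs_step_mono[of v u] qs_step_other[of u] qs_step_other[of v]
      by (metis linorder_neqE_nat not_less_iff_gr_or_eq)
    then have "{u. u < m \<and> l' u < l' v} = {u. u < m \<and> l u < l v}" by auto
    then show ?thesis using rk v False by (simp add: ranked_def qs_step_other)
  next
    case True
    let ?D = "{u. u < m \<and> l u < l p}" and ?E = "{u. u < m \<and> l u = l p \<and> l' u < l' v}"
    let ?L = "{u. u < m \<and> l u = l p \<and> b u p}"
    have "l' u < l' v \<longleftrightarrow> l u < l p \<or> l u = l p \<and> l' u < l' v" if "u < m" for u
      using that v True qs_step_mono[of u v] qs_step_mono[of v u]
      by (metis linorder_neqE_nat not_less_iff_gr_or_eq)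
    then have "{u. u < m \<and> l' u < l' v} = ?D \<union> ?E" by auto
    moreover have "card (?D \<union> ?E) = card ?D + card ?E"
      by (intro card_Un_disjoint) auto
    moreover have "card ?D = l p" using rk p by (simp add: ranked_def)
    moreover have "l' v = l p + card ?E"
    proof -
      have pL: "p \<notin> ?L" using irr p by simp
      consider "b v p" | "v = p" | "v \<noteq> p" "b p v" using anti p v by blast
      then show ?thesis
      proof cases
        case 1
        then have "v \<noteq> p" "\<not> b p v" using irr p anti v by blast+
        then have "?E = {}" using 1 v True by (auto simp: qs_step_class_order)
        then show ?thesis using 1 v True qs_step_in by simp
      next
        case 2
        have "?E = ?L" using 2 v p irr by (auto simp: qs_step_class_order)
        then show ?thesis using 2 qs_step_pivot k_def by simp
      next
        case 3
        then have "\<not> b v p" using anti[of p v] p v by blast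
        then have "?E = insert p ?L" using 3 v True p by (auto simp: qs_step_class_order)
        then show ?thesis using 3 pL v True by (simp add: qs_step_out k_def)
      qed
    qed
    ultimately show ?thesis by simp
  qed
qed

end

text \<open>When a module is spread over several classes, an outsider in the class of one of its members
  dominates the module if that class is not the last one meeting it, and is dominated if it is not the
  first one.  Hence later pivots inside the module move the outsider away from it.\<close>

definition qs_convex :: "(nat \<Rightarrow> nat) \<Rightarrow> bool" where
  "qs_convex l \<longleftrightarrow> (\<forall>S a c y. nmodule m b S \<longrightarrow> a \<in> S \<longrightarrow> c \<in> S \<longrightarrow> y < m \<longrightarrow> y \<notin> S \<longrightarrow> l a < l c \<longrightarrow>
     (l y \<le> l a \<or> l c \<le> l y) \<and> (l y = l a \<longrightarrow> b y a) \<and> (l y = l c \<longrightarrow> \<not> b y c))"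

text \<open>If the members \<open>a\<close> and \<open>c\<close> were already in different classes,
  an outsider \<open>y\<close> can lose its position only by sharing a class with one of them and
  the pivot; the recorded arcs then send it away from the other member. If this step separates them,
  the pivot is a member, and \<open>y\<close> compares with it as with \<open>a\<close> and
  \<open>c\<close>.\<close>

lemma qs_convex_step:
  assumes p: "p < m" and rk: "ranked m l" and Q: "qs_convex l"
  shows "qs_convex (qs_step m b p l)"
  unfolding qs_convex_def
proof (intro allI impI)
  fix S a c y
  let ?l = "qs_step m b p l"
  assume S: "nmodule m b S" and a: "a \<in> S" and c: "c \<in> S" and y: "y < m" "y \<notin> S" and ac: "?l a < ?l c"
  have m: "a < m" "c < m" using S a c by (auto simp: nmodule_def)
  have uni: "b y u = b y v" if "u \<in> S" "v \<in> S" for u v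
    using S that y nmoduleD by blast
  have ya: "y \<noteq> a" "y \<noteq> c" using a c y by auto
  note mono = qs_step_mono[OF p rk] and eqD = qs_step_eqD[OF p rk]
    and ord = qs_step_class_order[OF p rk] and other = qs_step_other[OF p rk]
  have up: "b y p \<longleftrightarrow> b y a" if "p \<in> S" using uni that a by blast
  have pu: "b p a \<longleftrightarrow> b p c" if "p \<notin> S" using that S a c p nmoduleD by blast
  have ap: "u \<noteq> p \<Longrightarrow> u < m \<Longrightarrow> b u p \<longleftrightarrow> \<not> b p u" for u using anti p by blast
  have "l a \<le> l c"
    using mono[of c a] m ac by (meson less_asym not_le)
  then consider "l a < l c" | "l a = l c" "l a = l p"
    using ac other[of a] other[of c] by fastforce
  then show "(?l y \<le> ?l a \<or> ?l c \<le> ?l y) \<and> (?l y = ?l a \<longrightarrow> b y a) \<and> (?l y = ?l c \<longrightarrow> \<not> b y c)"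
  proof cases
    case 1
    have q: "l y \<le> l a \<or> l c \<le> l y" "l y = l a \<Longrightarrow> b y a" "l y = l c \<Longrightarrow> \<not> b y c"
      using Q S a c y 1 unfolding qs_convex_def by blast+
    \<comment> \<open>The invariant with the pivot itself as the outsider.\<close>
    have pq: "l p = l a \<Longrightarrow> p \<notin> S \<Longrightarrow> b p a" "l p = l c \<Longrightarrow> p \<notin> S \<Longrightarrow> \<not> b p c"
      using Q S a c p 1 unfolding qs_convex_def by blast+
    have lea: "?l y \<le> ?l a" if e: "l y = l a"
    proof (cases "l y = l p")
      case True
      have "\<not> ?l a < ?l y"
      proof (cases "p \<in> S")
        case True
        then have "b y p" "\<not> b p y" using up q(2)[OF e] ap[of y] y by auto
        then show ?thesis using ord[of a y] \<open>l y = l p\<close> e m y by simp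
      next
        case False
        then have "b p a" "p \<noteq> a" using pq(1) \<open>l y = l p\<close> e a by auto
        then show ?thesis using ord[of a y] \<open>l y = l p\<close> e m y ap[of a] by simp
      qed
      then show ?thesis by simp
    qed (use e other in auto)
    have lec: "?l c \<le> ?l y" if e: "l y = l c"
    proof (cases "l y = l p")
      case True
      have "\<not> ?l y < ?l c"
      proof (cases "p \<in> S")
        case True
        then have "\<not> b y p" "y \<noteq> p" using up q(3)[OF e] uni[OF a c] y by auto
        then show ?thesis using ord[of y c] \<open>l y = l p\<close> e m y by simp
      next
        case False
        then have "\<not> b p c" "p \<noteq> c" using pq(2) \<open>l y = l p\<close> e c by auto
        then show ?thesis using ord[of y c] \<open>l y = l p\<close> e m y ap[of c] by simp
      qed
      then show ?thesis by simp
    qed (use e other in auto)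
    have "?l y \<le> ?l a \<or> ?l c \<le> ?l y"
      using q(1) lea lec mono[of y a] mono[of c y] m y by (cases "l y = l a \<or> l y = l c") auto
    then show ?thesis using q eqD[of y a] eqD[of y c] m y by blast
  next
    case 2
    \<comment> \<open>A pivot outside the module would send \<open>a\<close> and \<open>c\<close> to
      the same side.\<close>
    have pS: "p \<in> S"
    proof (rule ccontr)
      assume "p \<notin> S"
      then have "a \<noteq> p" "c \<noteq> p" using a c by auto
      then show False using pu[OF \<open>p \<notin> S\<close>] ord[of a c] 2 m ac ap[of a] ap[of c] by simp
    qed
    show ?thesis
    proof (cases "l y = l p")
      case False
      then have "?l y < ?l a \<or> ?l c < ?l y"
        using mono[of y a] mono[of c y] 2 m y by (metis linorder_neqE_nat)
      then show ?thesis using ac by auto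
    next
      case True
      have yp: "y \<noteq> p" using pS y by auto
      show ?thesis
      proof (cases "b y p")
        case True
        have "\<not> ?l a < ?l y" using ord[of a y] \<open>l y = l p\<close> 2 m y True yp ap[of y] by simp
        then show ?thesis using ac up[OF pS] True by auto
      next
        case False
        then have "\<not> ?l y < ?l c" using ord[of y c] \<open>l y = l p\<close> 2 m y yp by simp
        then show ?thesis using ac up[OF pS] False uni[OF a c] by auto
      qed
    qed
  qed
qed

text \<open>By the last conjunct every processed pivot is alone in its class, so after
  \<open>m\<close> rounds the labels are distinct.\<close>

lemma qs_label_inv:
  "p \<le> m \<Longrightarrow> ranked m (qs_label m b p) \<and> qs_convex (qs_label m b p) \<and>
     (\<forall>q<p. \<forall>v<m. qs_label m b p v = qs_label m b p q \<longrightarrow> v = q)"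
proof (induction p)
  case 0
  then show ?case by (auto simp: ranked_def qs_convex_def)
next
  case (Suc p)
  let ?l = "qs_label m b p"
  have p: "p < m" and rk: "ranked m ?l" and Q: "qs_convex ?l"
    and inj: "\<And>q v. q < p \<Longrightarrow> v < m \<Longrightarrow> ?l v = ?l q \<Longrightarrow> v = q"
    using Suc by auto
  have "v = q" if "q < Suc p" "v < m" "qs_step m b p ?l v = qs_step m b p ?l q" for q v
  proof (cases "q = p")
    case False
    have "?l v = ?l q" using qs_step_eqD[OF p rk, of v q] that p by auto
    then show ?thesis using inj[of q v] that False by auto
  next
    case True
    then have "?l v = ?l p" using qs_step_eqD[OF p rk, of v p] that p by auto
    then show ?thesis
      using qs_step_class_order[OF p rk, of v p] qs_step_class_order[OF p rk, of p v] that True p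
        anti[of p v] irr[of p] by (cases "v = p") auto
  qed
  then show ?case using ranked_step[OF p rk] qs_convex_step[OF p rk Q] by auto
qed

abbreviation "lab \<equiv> qs_label m b m"

lemma bij_lab: "bij_betw lab {..<m} {..<m}"
proof -
  have inj: "inj_on lab {..<m}"
    using qs_label_inv[of m] by (auto simp: inj_on_def)
  have "lab v < m" if "v < m" for v
  proof -
    have "{u. u < m \<and> lab u < lab v} \<subset> {..<m}" using that by auto
    then have "card {u. u < m \<and> lab u < lab v} < m"
      using psubset_card_mono[of "{..<m}" "{u. u < m \<and> lab u < lab v}"] by simp
    moreover have "ranked m lab" using qs_label_inv[of m] by simp
    ultimately show ?thesis using that by (auto simp: ranked_def)
  qed
  then have "lab ` {..<m} \<subseteq> {..<m}" by auto
  with inj show ?thesis by (simp add: bij_betw_def endo_inj_surj)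
qed

text \<open>Once labels are distinct, an outsider with a label between those of two members would
  have it strictly between them, which \<open>qs_convex\<close> excludes.\<close>

lemma lab_convex:
  assumes "nmodule m b S" "a \<in> S" "c \<in> S" "y < m" "lab a \<le> lab y" "lab y \<le> lab c"
  shows "y \<in> S"
proof (rule ccontr)
  assume y: "y \<notin> S"
  have m: "a < m" "c < m" using assms by (auto simp: nmodule_def)
  have Q: "qs_convex lab" and inj: "\<And>q v. q < m \<Longrightarrow> v < m \<Longrightarrow> lab v = lab q \<Longrightarrow> v = q"
    using qs_label_inv[of m] by auto
  have "y \<noteq> a" "y \<noteq> c" using y assms by auto
  then have "lab a \<noteq> lab y" "lab y \<noteq> lab c"
    using inj[of y a] inj[of c y] assms m by auto
  then have less: "lab a < lab y" "lab y < lab c" using assms by auto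
  then have "lab a < lab c" by simp
  with Q assms(1-4) y have "lab y \<le> lab a \<or> lab c \<le> lab y"
    unfolding qs_convex_def by blast
  with less show False by auto
qed

end

section \<open>Strong intervals and cuts in an abstract family of intervals\<close>

locale interval_family =
  fixes m :: nat and md :: "nat \<Rightarrow> nat \<Rightarrow> bool"
  assumes rng: "md i j \<Longrightarrow> i \<le> j \<and> j < m"
    and sing: "i < m \<Longrightarrow> md i i"
    and whole: "0 < m \<Longrightarrow> md 0 (m - 1)"
    and union: "md a u \<Longrightarrow> md v c \<Longrightarrow> a \<le> v \<Longrightarrow> v \<le> u \<Longrightarrow> u \<le> c \<Longrightarrow> md a c"
    and inter: "md a u \<Longrightarrow> md v c \<Longrightarrow> a \<le> v \<Longrightarrow> v \<le> u \<Longrightarrow> u \<le> c \<Longrightarrow> md v u"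
    and diff1: "md a u \<Longrightarrow> md v c \<Longrightarrow> a < v \<Longrightarrow> v \<le> u \<Longrightarrow> u < c \<Longrightarrow> md a (v - 1)"
    and diff2: "md a u \<Longrightarrow> md v c \<Longrightarrow> a < v \<Longrightarrow> v \<le> u \<Longrightarrow> u < c \<Longrightarrow> md (Suc u) c"
begin

definition strong :: "nat \<Rightarrow> nat \<Rightarrow> bool" where
  "strong i j \<longleftrightarrow> md i j \<and>
     \<not> (\<exists>i' j'. md i' j' \<and> (i < i' \<and> i' \<le> j \<and> j < j' \<or> i' < i \<and> i \<le> j' \<and> j' < j))"

lemma strongD:
  assumes "strong i j"
  shows "md i j" "md i' j' \<Longrightarrow> \<not> (i < i' \<and> i' \<le> j \<and> j < j')" "md i' j' \<Longrightarrow> \<not> (i' < i \<and> i \<le> j' \<and> j' < j)"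
  using assms unfolding strong_def by blast+

lemma strong_rng: "strong i j \<Longrightarrow> i \<le> j \<and> j < m"
  using strongD(1) rng by blast

lemma strong_sing: "i < m \<Longrightarrow> strong i i"
  using sing by (auto simp: strong_def)

lemma strong_whole: "0 < m \<Longrightarrow> strong 0 (m - 1)"
  using whole rng unfolding strong_def by fastforce

text \<open>Every strong interval is the longest strong one with its start or the longest one with
  its end: otherwise a longer one to the right and a longer one to the left would overlap each
  other. Starts are injective on the first kind, ends on the second.\<close>

lemma card_strong: "finite {(i, j). strong i j}" "card {(i, j). strong i j} \<le> 2 * m"
proof -
  let ?S = "{(i, j). strong i j}"
  have sub: "?S \<subseteq> {..<m} \<times> {..<m}" using strong_rng by fastforce
  then show fin: "finite ?S" using finite_subset by blast
  define A where "A = {(i, j) \<in> ?S. \<forall>j'. strong i j' \<longrightarrow> j' \<le> j}"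
  define B where "B = {(i, j) \<in> ?S. \<forall>i'. strong i' j \<longrightarrow> i \<le> i'}"
  have "?S \<subseteq> A \<union> B"
  proof (rule ccontr)
    assume "\<not> ?S \<subseteq> A \<union> B"
    then obtain i j where ij: "strong i j" "(i, j) \<notin> A" "(i, j) \<notin> B" by auto
    then obtain i' j' where "strong i j'" "j < j'" "strong i' j" "i' < i"
      unfolding A_def B_def using not_le by auto
    with ij show False
      using strongD(2)[of i' j i j'] strongD(1)[of i j'] strong_rng[of i j] by auto
  qed
  moreover have "card A \<le> m"
  proof -
    have "inj_on fst A" unfolding A_def inj_on_def by (auto intro: le_antisym)
    moreover have "fst ` A \<subseteq> {..<m}" using sub unfolding A_def by force
    ultimately show ?thesis by (metis card_inj_on_le card_lessThan finite_lessThan)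
  qed
  moreover have "card B \<le> m"
  proof -
    have "inj_on snd B" unfolding B_def inj_on_def by (auto intro: le_antisym)
    moreover have "snd ` B \<subseteq> {..<m}" using sub unfolding B_def by force
    ultimately show ?thesis by (metis card_inj_on_le card_lessThan finite_lessThan)
  qed
  moreover have "finite (A \<union> B)" using fin unfolding A_def B_def by (auto elim: rev_finite_subset)
  ultimately have "card ?S \<le> card A + card B"
    by (meson card_Un_le card_mono order_trans)
  then show "card ?S \<le> 2 * m" using \<open>card A \<le> m\<close> \<open>card B \<le> m\<close> by simp
qed

text \<open>Nodes with a cut are those of linear type, and their parts lie between consecutive cuts;
  nodes without a cut are prime.\<close>

definition cut :: "nat \<Rightarrow> nat \<Rightarrow> nat \<Rightarrow> bool" where
  "cut a c p \<longleftrightarrow> a < p \<and> p \<le> c \<and> md a (p - 1) \<and> md p c"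

text \<open>Both ends are counted as cuts, the right one as \<open>Suc c\<close>, so that blocks are
  half-open between consecutive values.\<close>

definition ecut :: "nat \<Rightarrow> nat \<Rightarrow> nat \<Rightarrow> bool" where
  "ecut a c p \<longleftrightarrow> p = a \<or> p = Suc c \<or> cut a c p"

lemma ecut_rng: "ecut a c p \<Longrightarrow> a \<le> c \<Longrightarrow> a \<le> p \<and> p \<le> Suc c"
  by (auto simp: ecut_def cut_def)

lemma ecut_interval:
  assumes "md a c" "ecut a c p" "ecut a c q" "p < q"
  shows "md p (q - 1)"
proof -
  have r: "a \<le> p" "q \<le> Suc c" using ecut_rng assms rng by blast+
  have "md p c" using assms r by (auto simp: ecut_def cut_def)
  moreover have "md a (q - 1)" using assms r by (auto simp: ecut_def cut_def)
  ultimately show ?thesis using inter[of a "q - 1" p c] assms r by auto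
qed

text \<open>An interval overlapping the block would create a cut inside it, at the boundary that
  falls within the block: one side is a difference, the other a union that reaches the end of the
  node.\<close>

lemma strong_between_cuts:
  assumes N: "strong a c" and p: "ecut a c p" and q: "ecut a c q" and "p < q"
    and none: "\<And>r. p < r \<Longrightarrow> r < q \<Longrightarrow> \<not> cut a c r"
  shows "strong p (q - 1)"
  unfolding strong_def
proof (intro conjI notI; (elim exE conjE disjE)?)
  have mdN: "md a c" "a \<le> c" using N strongD strong_rng by blast+
  have r: "a \<le> p" "q \<le> Suc c" using ecut_rng p q mdN by blast+
  have mdp: "md p c" using p mdN \<open>p < q\<close> r by (auto simp: ecut_def cut_def)
  have mdq: "md a (q - 1)" using q mdN \<open>p < q\<close> r by (auto simp: ecut_def cut_def)
  show "md p (q - 1)" using ecut_interval mdN p q \<open>p < q\<close> by blast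
  fix u v
  assume V: "md u v"
  {
    assume u: "p < u" "u \<le> q - 1" "q - 1 < v"
    have "v \<le> c" using strongD(2)[OF N V] u r by auto
    have 1: "md a (u - 1)" using diff1[OF mdq V] u r by auto
    \<comment> \<open>If \<open>V\<close> stops before \<open>c\<close>, the module that begins at
      the cut \<open>q\<close> continues it.\<close>
    have "md u c"
    proof (cases "v = c")
      case False
      then have "md q c" using q u \<open>v \<le> c\<close> \<open>p < q\<close> r by (auto simp: ecut_def cut_def)
      then show ?thesis using union[OF V, of q c] u \<open>v \<le> c\<close> by auto
    qed (use V in simp)
    with 1 have "cut a c u" using u r \<open>v \<le> c\<close> by (auto simp: cut_def)
    then show False using none[of u] u by auto
  next
    assume u: "u < p" "p \<le> v" "v < q - 1"
    have "a \<le> u" using strongD(3)[OF N V] u r by auto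
    have 1: "md (Suc v) c" using diff2[OF V mdp] u r by auto
    have "md a (p - 1)" using p u \<open>a \<le> u\<close> \<open>p < q\<close> r by (auto simp: ecut_def cut_def)
    then have "md a v" using union[of a "p - 1" u v] V u \<open>a \<le> u\<close> by auto
    with 1 have "cut a c (Suc v)" using u r \<open>a \<le> u\<close> by (auto simp: cut_def)
    then show False using none[of "Suc v"] u by auto
  }
qed

text \<open>The nearest cuts on both sides of \<open>x\<close> delimit the block; the given cut
  \<open>r\<close> keeps it from being the whole node.\<close>

lemma strong_block:
  assumes N: "strong a c" and r: "cut a c r" and x: "a \<le> x" "x \<le> c"
  obtains p q where "ecut a c p" "ecut a c (Suc q)" "p \<le> x" "x \<le> q" "strong p q" "\<not> (p \<le> a \<and> c \<le> q)"
proof -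
  define p where "p = (GREATEST p. ecut a c p \<and> p \<le> x)"
  have p: "ecut a c p \<and> p \<le> x" unfolding p_def
    by (rule GreatestI_nat[of _ a x]) (use x in \<open>auto simp: ecut_def\<close>)
  have pmax: "p' \<le> p" if "ecut a c p'" "p' \<le> x" for p'
    unfolding p_def by (rule Greatest_le_nat[of _ _ x]) (use that in auto)
  define q where "q = (LEAST q. ecut a c q \<and> x < q)"
  have q: "ecut a c q \<and> x < q" unfolding q_def
    by (rule LeastI[of _ "Suc c"]) (use x in \<open>auto simp: ecut_def\<close>)
  have qmin: "q \<le> q'" if "ecut a c q'" "x < q'" for q'
    unfolding q_def by (rule Least_le) (use that in auto)
  have pq: "p < q" using p q by auto
  have "strong p (q - 1)"
  proof (rule strong_between_cuts[OF N])
    fix r assume "p < r" "r < q"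
    then show "\<not> cut a c r" using pmax[of r] qmin[of r] by (auto simp: ecut_def) (meson not_le)
  qed (use p q pq in auto)
  moreover have "\<not> (p \<le> a \<and> c \<le> q - 1)"
  proof
    assume "p \<le> a \<and> c \<le> q - 1"
    moreover have "ecut a c r" "a < r" "r \<le> c" using r by (auto simp: ecut_def cut_def)
    ultimately show False using pmax[of r] qmin[of r] q by (cases "r \<le> x") auto
  qed
  ultimately show thesis
    using that[of p "q - 1"] p q pq by auto
qed

text \<open>The premise \<open>max\<close> says that \<open>{x..y}\<close> is a maximal strong
  interval properly inside the node. The block around one of its ends does not overlap it, so if the
  block went beyond that end it would contain \<open>{x..y}\<close> and contradict
  maximality.\<close>

lemma strong_child_ecut:
  assumes N: "strong a c" and r: "cut a c r" and ch: "strong x y" "a \<le> x" "y \<le> c"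
    and max: "\<And>x' y'. strong x' y' \<Longrightarrow> x' \<le> x \<Longrightarrow> y \<le> y' \<Longrightarrow>
      x' \<le> a \<and> c \<le> y' \<or> x' = x \<and> y' = y"
  shows "ecut a c x" "ecut a c (Suc y)"
proof -
  have xy: "x \<le> y" "y < m" using ch strong_rng by blast+
  obtain p q where 1: "ecut a c p" "ecut a c (Suc q)" "p \<le> x" "x \<le> q" "strong p q"
      "\<not> (p \<le> a \<and> c \<le> q)"
    by (rule strong_block[OF N r, of x]) (use ch xy in auto)
  have "p = x"
    using max[of p q] 1 strongD(3)[OF ch(1) strongD(1)[OF 1(5)]] by linarith
  then show "ecut a c x" using 1 by simp
  obtain p q where 2: "ecut a c p" "ecut a c (Suc q)" "p \<le> y" "y \<le> q" "strong p q"
      "\<not> (p \<le> a \<and> c \<le> q)"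
    by (rule strong_block[OF N r, of y]) (use ch xy in auto)
  have "q = y"
    using max[of p q] 2 strongD(2)[OF ch(1) strongD(1)[OF 2(5)]] by linarith
  then show "ecut a c (Suc y)" using 2 by simp
qed

text \<open>Among the modules that contain \<open>{i..j}\<close> and lie properly inside the node,
  take a longest one. By \<open>min\<close> it is not strong, so some module overlaps it. That
  module stays inside the node, since the node is strong, and the union of both is longer, hence the
  whole node; the difference of the two then exhibits a cut.\<close>

lemma nonstrong_cut:
  assumes N: "strong a c" and ij: "md i j" "\<not> strong i j" "a \<le> i" "j \<le> c"
    and min: "\<And>x y. strong x y \<Longrightarrow> x \<le> i \<Longrightarrow> j \<le> y \<Longrightarrow> x \<le> a \<and> c \<le> y"
  shows "\<exists>r. cut a c r"
proof -
  define P where "P z \<longleftrightarrow> md (fst z) (snd z) \<and> fst z \<le> i \<and> j \<le> snd z \<and> a \<le> fst z \<and> snd z \<le> c \<and>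
    \<not> (fst z = a \<and> snd z = c)" for z
  define f :: "nat \<times> nat \<Rightarrow> nat" where "f z = snd z - fst z" for z
  have "P (i, j)" using ij N by (auto simp: P_def)
  moreover have "\<forall>z. P z \<longrightarrow> f z < Suc c" by (auto simp: P_def f_def)
  ultimately have "\<exists>z. P z \<and> (\<forall>z'. P z' \<longrightarrow> f z' \<le> f z)" by (rule ex_has_greatest_nat)
  then obtain u w where z: "P (u, w)" "\<And>z'. P z' \<Longrightarrow> f z' \<le> f (u, w)" by (metis surj_pair)
  have U: "md u w" "u \<le> i" "j \<le> w" "a \<le> u" "w \<le> c" "\<not> (u = a \<and> w = c)"
    using z(1) by (auto simp: P_def)
  have big: "x = a \<and> y = c" if "md x y" "x \<le> u" "w \<le> y" "a \<le> x" "y \<le> c" "w - u < y - x" for x y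
    using z(2)[of "(x, y)"] that U by (auto simp: P_def f_def)
  have uw: "u \<le> w" using U rng by blast
  have "\<not> strong u w" using min[of u w] U by auto
  then obtain v1 v2 where V: "md v1 v2" "u < v1 \<and> v1 \<le> w \<and> w < v2 \<or> v1 < u \<and> u \<le> v2 \<and> v2 < w"
    using U unfolding strong_def by blast
  from V(2) show ?thesis
  proof (elim disjE conjE)
    assume v: "u < v1" "v1 \<le> w" "w < v2"
    have "v2 \<le> c" using strongD(2)[OF N V(1)] v U by auto
    moreover have "md u v2" using union[OF U(1) V(1)] v by auto
    ultimately have "u = a" "v2 = c" using big[of u v2] v U uw by auto
    moreover have "md (Suc w) v2" using diff2[OF U(1) V(1)] v by auto
    ultimately have "cut a c (Suc w)" using U v uw by (auto simp: cut_def)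
    then show ?thesis by blast
  next
    assume v: "v1 < u" "u \<le> v2" "v2 < w"
    have "a \<le> v1" using strongD(3)[OF N V(1)] v U by auto
    moreover have "md v1 w" using union[OF V(1) U(1)] v by auto
    ultimately have "v1 = a" "w = c" using big[of v1 w] v U uw by auto
    moreover have "md v1 (u - 1)" using diff1[OF V(1) U(1)] v by auto
    ultimately have "cut a c u" using U v uw by (auto simp: cut_def)
    then show ?thesis by blast
  qed
qed

end

section \<open>Modules as intervals of the sorted order\<close>

locale ordered_tournament = nat_tournament +
  fixes perm :: "nat \<Rightarrow> nat"
  assumes perm_lab: "v < m \<Longrightarrow> perm (lab v) = v"
begin

definition interval_module :: "nat \<Rightarrow> nat \<Rightarrow> bool" where
  "interval_module i j \<longleftrightarrow> i \<le> j \<and> j < m \<and> nmodule m b (perm ` {i..j})"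

lemma lab_perm_less:
  assumes "i < m"
  shows "lab (perm i) = i \<and> perm i < m"
proof -
  have "i \<in> lab ` {..<m}" using bij_lab assms by (simp add: bij_betw_def)
  then show ?thesis using perm_lab by auto
qed

lemma lab_perm: "i < m \<Longrightarrow> lab (perm i) = i"
  and perm_less: "i < m \<Longrightarrow> perm i < m"
  using lab_perm_less by simp_all

lemma inj_perm: "inj_on perm {..<m}"
  by (rule inj_on_inverseI[of _ lab]) (simp add: lab_perm)

lemma perm_image_subset: "A \<subseteq> {..<m} \<Longrightarrow> perm ` A \<subseteq> {..<m}"
  using perm_less by auto

text \<open>By \<open>lab_convex\<close> a module fills all positions from its least to its greatest
  one.\<close>

lemma nmodule_interval:
  assumes S: "nmodule m b S" "S \<noteq> {}"
  obtains i j where "interval_module i j" "S = perm ` {i..j}"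
proof -
  have sub: "S \<subseteq> {..<m}" using S by (auto simp: nmodule_def)
  then have fin: "finite S" using finite_subset by blast
  let ?i = "Min (lab ` S)" and ?j = "Max (lab ` S)"
  have "?i \<in> lab ` S" "?j \<in> lab ` S" using fin S by auto
  then obtain a c where ac: "a \<in> S" "?i = lab a" "c \<in> S" "?j = lab c" by auto
  have lt: "lab v < m" if "v < m" for v
    using bij_lab that by (auto simp: bij_betw_def)
  have le: "?i \<le> ?j" using \<open>?i \<in> lab ` S\<close> fin by (intro Max_ge) auto
  have j: "?j < m" using ac lt sub by auto
  have "S = perm ` {?i..?j}"
  proof (intro equalityI subsetI)
    fix v assume "v \<in> S"
    then have "lab v \<in> {?i..?j}" "perm (lab v) = v" using fin sub perm_lab by auto
    then show "v \<in> perm ` {?i..?j}" by (metis imageI)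
  next
    fix v assume "v \<in> perm ` {?i..?j}"
    then obtain k where k: "v = perm k" "?i \<le> k" "k \<le> ?j" by auto
    then have "k < m" using j by simp
    then have "v < m" "lab v = k" using k lab_perm perm_less by auto
    then show "v \<in> S" using lab_convex[OF S(1) ac(1) ac(3), of v] k ac by auto
  qed
  then show thesis using that[of ?i ?j] S le j by (auto simp: interval_module_def)
qed

sublocale interval_family m interval_module
proof
  fix i j assume "interval_module i j"
  then show "i \<le> j \<and> j < m" by (simp add: interval_module_def)
next
  fix i assume "i < m"
  then show "interval_module i i" using perm_less by (auto simp: interval_module_def nmodule_def)
next
  assume m: "0 < m"
  have "perm ` {0..m - 1} = {..<m}"
  proof (intro equalityI subsetI)
    fix v assume "v \<in> {..<m}"
    then have "lab v < m" "perm (lab v) = v"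
      using bij_lab perm_lab by (auto simp: bij_betw_def)
    then have "lab v \<in> {0..m - 1}" "perm (lab v) = v" by auto
    then show "v \<in> perm ` {0..m - 1}" by (metis imageI)
  qed (use perm_less m in auto)
  then show "interval_module 0 (m - 1)" using m by (auto simp: interval_module_def nmodule_def)
next
  fix a u v c
  assume A: "interval_module a u" and C: "interval_module v c" and le: "a \<le> v" "v \<le> u" "u \<le> c"
  let ?A = "{a..u}" and ?C = "{v..c}"
  have r: "c < m" "?A \<subseteq> {..<m}" "?C \<subseteq> {..<m}" using C le by (auto simp: interval_module_def)
  have mod: "nmodule m b (perm ` ?A)" "nmodule m b (perm ` ?C)"
    using A C by (auto simp: interval_module_def)
  have "perm v \<in> perm ` ?A \<inter> perm ` ?C" using le by auto
  then have "nmodule m b (perm ` ?A \<union> perm ` ?C)" by (intro nmodule_Un mod) blast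
  moreover have "?A \<union> ?C = {a..c}" using le by auto
  ultimately show "interval_module a c"
    using le r by (simp add: interval_module_def image_Un[symmetric])
  have "nmodule m b (perm ` ?A \<inter> perm ` ?C)" by (intro nmodule_Int mod)
  moreover have "perm ` ?A \<inter> perm ` ?C = perm ` (?A \<inter> ?C)"
    using r by (intro inj_on_image_Int[OF inj_perm, symmetric])
  moreover have "?A \<inter> ?C = {v..u}" using le by auto
  ultimately show "interval_module v u" using le r by (auto simp: interval_module_def)
next
  fix a u v c
  assume A: "interval_module a u" and C: "interval_module v c" and le: "a < v" "v \<le> u" "u < c"
  let ?A = "{a..u}" and ?C = "{v..c}"
  have r: "c < m" "?A \<subseteq> {..<m}" "?C \<subseteq> {..<m}" using C le by (auto simp: interval_module_def)
  have mod: "nmodule m b (perm ` ?A)" "nmodule m b (perm ` ?C)"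
    using A C by (auto simp: interval_module_def)
  have diff: "perm ` ?A - perm ` ?C = perm ` (?A - ?C)" "perm ` ?C - perm ` ?A = perm ` (?C - ?A)"
    using r by (auto intro!: inj_on_image_set_diff[OF inj_perm, symmetric])
  have "?A - ?C = {a..v - 1}" "?C - ?A = {Suc u..c}" using le by auto
  with diff have im: "perm ` ?A - perm ` ?C = perm ` {a..v - 1}" "perm ` ?C - perm ` ?A = perm ` {Suc u..c}"
    by simp_all
  have "nmodule m b (perm ` ?A - perm ` ?C)" "nmodule m b (perm ` ?C - perm ` ?A)"
    using nmodule_Diff[OF mod(2,1)] nmodule_Diff[OF mod(1,2)] im le by auto
  then show "interval_module a (v - 1)" "interval_module (Suc u) c"
    using im le r by (auto simp: interval_module_def)
qed

end

section \<open>Trees given by parent pointers\<close>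

text \<open>Parents have smaller numbers than their children, so induction along a path to the root
  is induction on numbers. The parent heads the neighbour list: at a node other than the root, index
  \<open>0\<close> is the side of the parent and \<open>Suc i\<close> belongs to the child with
  index \<open>i\<close>.\<close>

locale parent_tree =
  fixes S :: nat and par :: "nat \<Rightarrow> nat" and T :: "'a ltree"
  assumes S_pos: "0 < S"
    and par_less: "0 < c \<Longrightarrow> c < S \<Longrightarrow> par c < c"
    and nodes_T: "nodes T = {..<S}"
    and nbrs_T: "c < S \<Longrightarrow>
      nbrs T c = (if c = 0 then [] else [par c]) @ filter (\<lambda>d. par d = c) [Suc c..<S]"
begin

lemma par_less_S: "0 < c \<Longrightarrow> c < S \<Longrightarrow> par c < S"
  using par_less by (meson less_trans)

lemma adjacency_iff:
  "(u, v) \<in> adjacency T \<longleftrightarrow> u < S \<and> v < S \<and> (0 < u \<and> v = par u \<or> 0 < v \<and> u = par v)"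
proof -
  have "(u, v) \<in> adjacency T \<longleftrightarrow> u < S \<and> (0 < u \<and> v = par u \<or> u < v \<and> v < S \<and> par v = u)"
    by (cases "u = 0") (auto simp: adjacency_def nodes_T nbrs_T)
  then show ?thesis using par_less par_less_S by auto
qed

lemma sym_adjacency: "sym (adjacency T)"
  by (auto simp: sym_def adjacency_iff)

lemma adjacency_less: "(u, v) \<in> adjacency T \<Longrightarrow> u < v \<Longrightarrow> u = par v"
  using par_less unfolding adjacency_iff by (meson less_asym)

definition desc :: "nat \<Rightarrow> nat set" where
  "desc c = {d. d < S \<and> (d, c) \<in> {(d, par d) | d. 0 < d \<and> d < S}\<^sup>*}"

lemma desc_self: "c < S \<Longrightarrow> c \<in> desc c"
  by (simp add: desc_def)

lemma desc_less_S: "d \<in> desc c \<Longrightarrow> d < S"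
  by (simp add: desc_def)

lemma desc_par: "d \<in> desc c \<Longrightarrow> d \<noteq> c \<Longrightarrow> 0 < d \<and> par d \<in> desc c"
  unfolding desc_def by (auto elim: converse_rtranclE simp: par_less_S)

lemma descI: "0 < d \<Longrightarrow> d < S \<Longrightarrow> par d \<in> desc c \<Longrightarrow> d \<in> desc c"
  unfolding desc_def by (auto intro: converse_rtrancl_into_rtrancl)

lemma desc_ge: "d \<in> desc c \<Longrightarrow> c \<le> d"
proof (induction d rule: less_induct)
  case (less d)
  then show ?case
    using desc_par[of d c] par_less[of d] desc_less_S[of d c]
    by (cases "d = c") (fastforce dest: less_imp_le)+
qed

lemma desc_child:
  assumes "d \<in> desc c" "d \<noteq> c"
  obtains e where "0 < e" "e < S" "par e = c" "d \<in> desc e"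
proof -
  have "(d, c) \<in> {(d, par d) | d. 0 < d \<and> d < S}\<^sup>*" "d < S" using assms by (auto simp: desc_def)
  then show thesis
    using assms(2) that by (cases rule: rtranclE) (auto simp: desc_def)
qed

text \<open>The relation \<open>A\<close> is left open because the statement serves twice, for the
  tree without an edge and for the tree without a node.\<close>

lemma reach_desc:
  assumes "sym A" "c < S"
    and up: "\<And>d. d \<in> desc c \<Longrightarrow> d \<noteq> c \<Longrightarrow> (d, par d) \<in> A"
    and closed: "\<And>x y. (x, y) \<in> A \<Longrightarrow> x \<in> desc c \<Longrightarrow> y \<in> desc c"
  shows "A\<^sup>* `` {c} = desc c"
proof (intro equalityI subsetI)
  fix d assume "d \<in> A\<^sup>* `` {c}"
  then have "(c, d) \<in> A\<^sup>*" by simp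
  then show "d \<in> desc c"
    by induction (use assms desc_self in auto)
next
  fix d assume "d \<in> desc c"
  then have "(d, c) \<in> A\<^sup>*"
  proof (induction d rule: less_induct)
    case (less d)
    then show ?case
      using desc_par[of d c] par_less[of d] desc_less_S[of d c] up[of d]
      by (cases "d = c") (auto intro: converse_rtrancl_into_rtrancl)
  qed
  then have "(c, d) \<in> A\<^sup>*" using \<open>sym A\<close> by (meson symD sym_rtrancl)
  then show "d \<in> A\<^sup>* `` {c}" by simp
qed

text \<open>From a node outside the subtree the parents lead to node \<open>0\<close> without
  entering it, so all outer nodes are joined through node \<open>0\<close>.\<close>

lemma reach_not_desc:
  assumes "sym A" "0 < c" "u < S" "u \<notin> desc c"
    and up: "\<And>d. d < S \<Longrightarrow> d \<notin> desc c \<Longrightarrow> 0 < d \<Longrightarrow> (d, par d) \<in> A"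
    and closed: "\<And>x y. (x, y) \<in> A \<Longrightarrow> x < S \<Longrightarrow> x \<notin> desc c \<Longrightarrow> y < S \<and> y \<notin> desc c"
  shows "A\<^sup>* `` {u} = {..<S} - desc c"
proof (intro equalityI subsetI)
  fix d assume "d \<in> A\<^sup>* `` {u}"
  then have "(u, d) \<in> A\<^sup>*" by simp
  then show "d \<in> {..<S} - desc c"
    by induction (use assms in auto)
next
  have root: "(d, 0) \<in> A\<^sup>*" if "d < S" "d \<notin> desc c" for d
    using that
  proof (induction d rule: less_induct)
    case (less d)
    show ?case
    proof (cases "d = 0")
      case False
      then have "par d \<notin> desc c" using less descI by blast
      with less False have "(par d, 0) \<in> A\<^sup>*" by (simp add: par_less par_less_S)
      then show ?thesis using up[of d] less False by (auto intro: converse_rtrancl_into_rtrancl)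
    qed simp
  qed
  fix d assume "d \<in> {..<S} - desc c"
  then have "(0, d) \<in> A\<^sup>*" using root[of d] \<open>sym A\<close> by (meson DiffD1 DiffD2 lessThan_iff symD sym_rtrancl)
  with root[of u] assms have "(u, d) \<in> A\<^sup>*" by (meson rtrancl_trans)
  then show "d \<in> A\<^sup>* `` {u}" by simp
qed

lemma not_desc_par: "0 < c \<Longrightarrow> c < S \<Longrightarrow> par c \<notin> desc c"
  using desc_ge par_less by (meson not_le)

lemma reach_without_edge:
  assumes c: "0 < c" "c < S"
  defines "A \<equiv> adjacency T - {(x, y). {x, y} = {c, par c}}"
  shows "A\<^sup>* `` {c} = desc c" "A\<^sup>* `` {par c} = {..<S} - desc c"
proof -
  have sym: "sym A" using sym_adjacency by (auto simp: A_def sym_def insert_commute)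
  have A: "(x, y) \<in> A \<longleftrightarrow> x < S \<and> y < S \<and> (0 < x \<and> y = par x \<or> 0 < y \<and> x = par y) \<and> {x, y} \<noteq> {c, par c}" for x y
    by (auto simp: A_def adjacency_iff)
  show "A\<^sup>* `` {c} = desc c"
  proof (rule reach_desc[OF sym c(2)])
    fix d assume d: "d \<in> desc c" "d \<noteq> c"
    then have "d > 0" "d < S" using desc_par desc_less_S by blast+
    moreover have "c \<le> par d" "c \<le> d" using d desc_par desc_ge by blast+
    ultimately show "(d, par d) \<in> A"
      using d c par_less[of c] by (auto simp: A par_less_S doubleton_eq_iff)
  next
    fix x y assume xy: "(x, y) \<in> A" "x \<in> desc c"
    then show "y \<in> desc c" using desc_par[of x c] descI[of y c] by (auto simp: A)
  qed
  show "A\<^sup>* `` {par c} = {..<S} - desc c"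
  proof (rule reach_not_desc[OF sym c(1)])
    fix d assume d: "d < S" "d \<notin> desc c" "0 < d"
    then have "d \<noteq> c" "par d \<noteq> c" using desc_self descI c by blast+
    with d show "(d, par d) \<in> A"
      by (auto simp: A par_less_S doubleton_eq_iff)
  next
    fix x y assume xy: "(x, y) \<in> A" "x < S" "x \<notin> desc c"
    then show "y < S \<and> y \<notin> desc c"
      using desc_par[of y c] descI[of x c] by (auto simp: A insert_commute)
  qed (use c not_desc_par par_less_S in auto)
qed

lemma reach_without_node:
  assumes N: "0 < N" "N < S"
  defines "A \<equiv> adjacency T - {(x, y). x = N \<or> y = N}"
  shows "A\<^sup>* `` {par N} = {..<S} - desc N" "0 < d \<Longrightarrow> d < S \<Longrightarrow> par d = N \<Longrightarrow> A\<^sup>* `` {d} = desc d"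
proof -
  have sym: "sym A" using sym_adjacency by (auto simp: A_def sym_def)
  have A: "(x, y) \<in> A \<longleftrightarrow> x < S \<and> y < S \<and> (0 < x \<and> y = par x \<or> 0 < y \<and> x = par y) \<and> x \<noteq> N \<and> y \<noteq> N" for x y
    by (auto simp: A_def adjacency_iff)
  show "A\<^sup>* `` {par N} = {..<S} - desc N"
  proof (rule reach_not_desc[OF sym N(1)])
    fix d assume d: "d < S" "d \<notin> desc N" "0 < d"
    then have "d \<noteq> N" "par d \<noteq> N" using desc_self descI N by blast+
    with d show "(d, par d) \<in> A" by (auto simp: A par_less_S)
  next
    fix x y assume xy: "(x, y) \<in> A" "x < S" "x \<notin> desc N"
    then show "y < S \<and> y \<notin> desc N"
      using desc_par[of y N] descI[of x N] by (auto simp: A)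
  qed (use N not_desc_par par_less_S in auto)
  assume d: "0 < d" "d < S" "par d = N"
  then have Nd: "N < d" using par_less by blast
  show "A\<^sup>* `` {d} = desc d"
  proof (rule reach_desc[OF sym d(2)])
    fix e assume e: "e \<in> desc d" "e \<noteq> d"
    then have "e > 0" "e < S" using desc_par desc_less_S by blast+
    moreover have "d \<le> par e" "d \<le> e" using e desc_par desc_ge by blast+
    ultimately show "(e, par e) \<in> A" using Nd by (auto simp: A par_less_S)
  next
    fix x y assume xy: "(x, y) \<in> A" "x \<in> desc d"
    then show "y \<in> desc d" using desc_par[of x d] descI[of y d] d by (auto simp: A)
  qed
qed

lemma is_tree_T: "is_tree T"
  unfolding is_tree_def
proof (intro conjI)
  show "finite (nodes T)" "nodes T \<noteq> {}" using S_pos unfolding nodes_T by auto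
  show "\<forall>u\<in>nodes T. distinct (nbrs T u) \<and> set (nbrs T u) \<subseteq> nodes T"
  proof
    fix u assume "u \<in> nodes T"
    then show "distinct (nbrs T u) \<and> set (nbrs T u) \<subseteq> nodes T"
      using par_less[of u] par_less_S[of u] by (cases "u = 0") (auto simp: nodes_T nbrs_T)
  qed
  show "sym (adjacency T)" by (rule sym_adjacency)
  show "irrefl (adjacency T)"
    unfolding irrefl_def adjacency_iff by (metis less_irrefl par_less)
  have root: "u < S \<Longrightarrow> (u, 0) \<in> (adjacency T)\<^sup>*" for u
  proof (induction u rule: less_induct)
    case (less u)
    show ?case
    proof (cases "u = 0")
      case False
      then have "(u, par u) \<in> adjacency T" using less by (auto simp: adjacency_iff par_less_S)
      moreover have "(par u, 0) \<in> (adjacency T)\<^sup>*" using less False by (simp add: par_less par_less_S)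
      ultimately show ?thesis by (rule converse_rtrancl_into_rtrancl)
    qed simp
  qed
  then show "\<forall>u\<in>nodes T. \<forall>v\<in>nodes T. (u, v) \<in> (adjacency T)\<^sup>*"
    using sym_adjacency unfolding nodes_T
    by (metis lessThan_iff rtrancl_trans symD sym_rtrancl)
  show "\<not> (\<exists>p. length p \<ge> 3 \<and> distinct p \<and>
            (\<forall>i<length p. (p ! i, p ! (Suc i mod length p)) \<in> adjacency T))"
  proof
    assume "\<exists>p. length p \<ge> 3 \<and> distinct p \<and>
            (\<forall>i<length p. (p ! i, p ! (Suc i mod length p)) \<in> adjacency T)"
    then obtain p where p: "length p \<ge> 3" "distinct p"
      and adj: "\<And>i. i < length p \<Longrightarrow> (p ! i, p ! (Suc i mod length p)) \<in> adjacency T" by blast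
    \<comment> \<open>The greatest node of a cycle has two distinct neighbours on it. Both are
      smaller, so both would be its parent.\<close>
    let ?L = "length p"
    have "p \<noteq> []" using p by auto
    then have "Max (set p) \<in> set p" by simp
    then obtain i where i: "i < ?L" "p ! i = Max (set p)" by (metis in_set_conv_nth)
    have below: "p ! j < p ! i" if "j < ?L" "j \<noteq> i" for j
      using that p i Max_ge[of "set p" "p ! j"] nth_eq_iff_index_eq[of p j i]
      by (metis List.finite_set le_neq_implies_less nth_mem)
    define j where "j = (if Suc i = ?L then 0 else Suc i)"
    define k where "k = (if i = 0 then ?L - 1 else i - 1)"
    have jk: "j < ?L" "k < ?L" "j \<noteq> i" "k \<noteq> i" "j \<noteq> k" "Suc i mod ?L = j" "Suc k mod ?L = i"
      using i p by (auto simp: j_def k_def)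
    have "(p ! j, p ! i) \<in> adjacency T"
      using adj[of i] i jk sym_adjacency by (metis symD)
    moreover have "(p ! k, p ! i) \<in> adjacency T" using adj[of k] jk by simp
    ultimately have "p ! j = par (p ! i)" "p ! k = par (p ! i)"
      using adjacency_less below jk by blast+
    then show False using jk p nth_eq_iff_index_eq[of p j k] by simp
  qed
qed

lemma edges_T: "edges T = (\<lambda>c. {c, par c}) ` {1..<S}"
proof (intro equalityI subsetI)
  fix e assume "e \<in> edges T"
  then obtain u v where "e = {u, v}" "(u, v) \<in> adjacency T" by (auto simp: edges_def)
  then show "e \<in> (\<lambda>c. {c, par c}) ` {1..<S}"
    by (auto simp: adjacency_iff insert_commute)
next
  fix e assume "e \<in> (\<lambda>c. {c, par c}) ` {1..<S}"
  then obtain c where "c \<in> {1..<S}" "e = {c, par c}" by blast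
  then have c: "0 < c" "c < S" "e = {c, par c}" by auto
  then have "(c, par c) \<in> adjacency T" by (auto simp: adjacency_iff par_less_S)
  then show "e \<in> edges T" using c by (auto simp: edges_def)
qed

lemma edge_bip_T:
  "0 < c \<Longrightarrow> c < S \<Longrightarrow> edge_bip T {c, par c} = {labels_of T (desc c), labels_of T ({..<S} - desc c)}"
  by (simp add: edge_bip_def reach_without_edge)

definition children :: "nat \<Rightarrow> nat list" where
  "children c = filter (\<lambda>d. par d = c) [Suc c..<S]"

lemma set_children: "c < S \<Longrightarrow> set (children c) = {d. 0 < d \<and> d < S \<and> par d = c}"
  using par_less by (auto simp: children_def Suc_le_eq)

lemma sorted_children: "i < j \<Longrightarrow> j < length (children c) \<Longrightarrow> children c ! i < children c ! j"
proof -
  have "sorted_wrt (<) (children c)" unfolding children_def by (simp add: sorted_wrt_filter)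
  then show "i < j \<Longrightarrow> j < length (children c) \<Longrightarrow> children c ! i < children c ! j"
    by (simp add: sorted_wrt_nth_less)
qed

lemma degree_T: "c < S \<Longrightarrow> degree T c = (if c = 0 then 0 else 1) + length (children c)"
  by (simp add: degree_def nbrs_T children_def)

lemma node_part_par:
  "0 < N \<Longrightarrow> N < S \<Longrightarrow> node_part T N 0 = labels_of T ({..<S} - desc N)"
  using reach_without_node(1)[of N] by (simp add: node_part_def nbrs_T)

lemma node_part_child:
  assumes "0 < N" "N < S" "i < length (children N)"
  shows "node_part T N (Suc i) = labels_of T (desc (children N ! i))"
proof -
  have "children N ! i \<in> set (children N)" using assms by simp
  then have "0 < children N ! i" "children N ! i < S" "par (children N ! i) = N"
    using set_children assms by auto
  moreover have "nbrs T N ! Suc i = children N ! i"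
    using assms by (simp add: nbrs_T children_def)
  ultimately show ?thesis
    using reach_without_node(2)[of N] assms by (simp add: node_part_def)
qed

end

section \<open>The tree of strong intervals\<close>

text \<open>Node \<open>0\<close> is the leaf labelled \<open>z\<close>.  It serves as the root of the parent pointers, and the value
  \<open>en 0 = m\<close> makes it enclose all other nodes.\<close>

locale decomposition_tree = interval_family m md + parent_tree S par T
  for m md S par and T :: "'a ltree" +
  fixes st en :: "nat \<Rightarrow> nat" and X :: "'a set" and g :: "nat \<Rightarrow> 'a" and z :: 'a
  assumes st_en_root: "st 0 = 0" "en 0 = m"
    and bij_nodes: "bij_betw (\<lambda>c. (st c, en c)) {1..<S} {(i, j). strong i j}"
    and preorder: "0 < c \<Longrightarrow> c < d \<Longrightarrow> d < S \<Longrightarrow> st c < st d \<or> st c = st d \<and> en d < en c"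
    and par_en: "0 < c \<Longrightarrow> c < S \<Longrightarrow> en c \<le> en (par c)"
    and par_last: "par c < d \<Longrightarrow> d < c \<Longrightarrow> c < S \<Longrightarrow> en d < en c"
    and root_label: "leaf_label T 0 = z"
    and node_label: "0 < c \<Longrightarrow> c < S \<Longrightarrow> leaf_label T c = g (st c)"
    and kind_T: "0 < c \<Longrightarrow> c < S \<Longrightarrow> st c < en c \<Longrightarrow>
      kind T c = (if \<exists>p. cut (st c) (en c) p then Circular else Prime)"
    and bij_g: "bij_betw g {..<m} (X - {z})" and z: "z \<in> X"
begin

lemma node_strong: "0 < c \<Longrightarrow> c < S \<Longrightarrow> strong (st c) (en c)"
  using bij_nodes unfolding bij_betw_def by fastforce

lemma node_rng: "0 < c \<Longrightarrow> c < S \<Longrightarrow> st c \<le> en c \<and> en c < m"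
  using node_strong strong_rng by blast

lemma node_inj: "0 < c \<Longrightarrow> c < S \<Longrightarrow> 0 < d \<Longrightarrow> d < S \<Longrightarrow> st c = st d \<Longrightarrow> en c = en d \<Longrightarrow> c = d"
  using bij_nodes unfolding bij_betw_def inj_on_def by force

lemma strong_node:
  assumes "strong i j"
  obtains c where "0 < c" "c < S" "st c = i" "en c = j"
proof -
  have "(i, j) \<in> (\<lambda>c. (st c, en c)) ` {1..<S}"
    using bij_nodes assms unfolding bij_betw_def by blast
  then obtain c where "(i, j) = (st c, en c)" "c \<in> {1..<S}" by (rule imageE)
  then show thesis using that[of c] by simp
qed

lemma preorder_root: "c < d \<Longrightarrow> d < S \<Longrightarrow> st c < st d \<or> st c = st d \<and> en d < en c"
  using preorder[of c d] node_rng[of d] st_en_root by (cases "c = 0") auto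

text \<open>By the preorder the later node starts no earlier. If it started inside the earlier one
  and ended behind it, two strong intervals would overlap.\<close>

lemma nested: "c < d \<Longrightarrow> d < S \<Longrightarrow> en d \<le> en c \<or> en c < st d"
  using preorder_root[of c d] node_strong[of c] node_strong[of d] node_rng[of d]
    strongD(2)[of "st c" "en c" "st d" "en d"] strongD(1)[of "st d" "en d"] st_en_root
  by (cases "c = 0") auto

text \<open>\<open>par d\<close> is the last earlier node that reaches at least as far as
  \<open>d\<close>. Hence an earlier node \<open>c\<close> that also reaches that far is at most
  \<open>par d\<close>, and the induction goes on from \<open>par d\<close>.\<close>

lemma desc_iff: "c < S \<Longrightarrow> d \<in> desc c \<longleftrightarrow> c \<le> d \<and> d < S \<and> en d \<le> en c"
proof (induction d rule: less_induct)
  case (less d)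
  show ?case
  proof (cases "d = c")
    case True
    then show ?thesis using desc_self less by auto
  next
    case False
    show ?thesis
    proof
      assume d: "d \<in> desc c"
      then have "0 < d" "par d \<in> desc c" "d < S" using False desc_par desc_less_S by blast+
      then show "c \<le> d \<and> d < S \<and> en d \<le> en c"
        using less.IH[of "par d"] less.prems par_less[of d] par_en[of d] by auto
    next
      assume d: "c \<le> d \<and> d < S \<and> en d \<le> en c"
      then have d0: "0 < d" "c < d" using False by auto
      have pd: "par d < d" "par d < S" using d0 d par_less par_less_S by auto
      have c_le: "c \<le> par d" using par_last[of d c] d d0 by (meson not_le)
      have "en (par d) \<le> en c"
      proof (cases "par d = c")
        case False
        then have "c < par d" using c_le by simp
        moreover have "\<not> en c < st (par d)"
          using preorder_root[of "par d" d] pd d d0 node_rng[of d] by auto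
        ultimately show ?thesis using nested[of c "par d"] pd by auto
      qed simp
      then have "par d \<in> desc c" using less.IH[of "par d"] pd c_le less.prems by auto
      then show "d \<in> desc c" using descI d0 d by blast
    qed
  qed
qed

lemma desc_contains: "c < S \<Longrightarrow> d \<in> desc c \<Longrightarrow> st c \<le> st d \<and> en d \<le> en c"
  using desc_iff[of c d] preorder_root[of c d] by (cases "c = d") auto

lemma contains_desc: "c < S \<Longrightarrow> d < S \<Longrightarrow> st c \<le> st d \<Longrightarrow> en d \<le> en c \<Longrightarrow> d \<in> desc c"
  using desc_iff[of c d] preorder_root[of d c] by (cases "d < c") auto

lemma sing_node:
  assumes "i < m"
  obtains c where "0 < c" "c < S" "st c = i" "en c = i"
  using strong_node[OF strong_sing[OF assms]] .

lemma root_child: "0 < S \<Longrightarrow> 1 < S \<Longrightarrow> st 1 = 0 \<and> en 1 = m - 1"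
proof -
  assume "1 < S"
  then have "0 < m" using node_rng[of 1] by auto
  then obtain c where c: "0 < c" "c < S" "st c = 0" "en c = m - 1"
    using strong_node[OF strong_whole] by blast
  have "\<not> 1 < c" using preorder[of 1 c] c node_rng[of 1] \<open>1 < S\<close> by auto
  then show "st 1 = 0 \<and> en 1 = m - 1" using c by (cases "c = 1") auto
qed

text \<open>Node \<open>1\<close> is the interval of all positions and reaches as far as any later
  node, so none of these is attached to node \<open>0\<close>. This is why node \<open>0\<close> is
  a leaf.\<close>

lemma par_pos: "1 < c \<Longrightarrow> c < S \<Longrightarrow> 0 < par c"
  using par_last[of c 1] root_child node_rng[of c] by (cases "par c = 0") auto

lemma children_root: "length (children 0) \<le> 1"
proof -
  have "d = 1" if "d \<in> set (children 0)" for d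
    using that set_children[OF S_pos] par_pos[of d] by (cases "1 < d") auto
  then have "set (children 0) \<subseteq> {1}" by auto
  then have "card (set (children 0)) \<le> 1" using card_mono[of "{1::nat}"] by fastforce
  moreover have "distinct (children 0)" by (simp add: children_def)
  ultimately show ?thesis by (simp add: distinct_card)
qed

lemma children_Nil_iff:
  assumes "0 < c" "c < S"
  shows "children c = [] \<longleftrightarrow> st c = en c"
proof
  assume e: "st c = en c"
  show "children c = []"
  proof (rule ccontr)
    assume "children c \<noteq> []"
    then obtain d where d: "0 < d" "d < S" "par d = c"
      using set_children[OF assms(2)] by (cases "children c") auto
    then have "d \<in> desc c" using descI desc_self assms by blast
    then have "d = c"
      using desc_contains[of c d] node_rng[of d] node_inj[of d c] assms d e by auto
    then show False using d par_less[of d] by auto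
  qed
next
  assume n: "children c = []"
  show "st c = en c"
  proof (rule ccontr)
    assume ne: "st c \<noteq> en c"
    then have lt: "st c < en c" "st c < m" using node_rng[OF assms] by auto
    obtain d where d: "0 < d" "d < S" "st d = st c" "en d = st c" using sing_node lt by blast
    have "d \<in> desc c" using contains_desc d assms lt by auto
    moreover have "d \<noteq> c" using d ne by auto
    ultimately obtain e where "0 < e" "e < S" "par e = c" by (rule desc_child)
    then show False using set_children[OF assms(2)] n by auto
  qed
qed

lemma leaves_T: "leaves T = insert 0 {c. 0 < c \<and> c < S \<and> st c = en c}"
proof (intro set_eqI)
  fix c
  have "c < S \<Longrightarrow> degree T c \<le> 1 \<longleftrightarrow> c = 0 \<or> st c = en c"
    using degree_T[of c] children_root children_Nil_iff[of c] by auto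
  then show "c \<in> leaves T \<longleftrightarrow> c \<in> insert 0 {c. 0 < c \<and> c < S \<and> st c = en c}"
    using S_pos by (auto simp: leaves_def nodes_T)
qed

lemma internal_T: "internal T = {c. 0 < c \<and> c < S \<and> st c < en c}"
  using node_rng by (auto simp: internal_def leaves_T nodes_T le_less)

lemma inj_g: "inj_on g {..<m}" and g_image: "g ` {..<m} = X - {z}"
  using bij_g by (auto simp: bij_betw_def)

lemma bij_leaf_label: "bij_betw (leaf_label T) (leaves T) X"
  unfolding bij_betw_def
proof
  show "inj_on (leaf_label T) (leaves T)"
  proof (rule inj_onI)
    fix c d assume cd: "c \<in> leaves T" "d \<in> leaves T" "leaf_label T c = leaf_label T d"
    have g: "leaf_label T c \<in> X - {z} \<and> st c < m" if "c \<in> leaves T" "0 < c" for c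
      using that node_rng[of c] g_image by (auto simp: leaves_T node_label)
    show "c = d"
    proof (cases "c = 0 \<or> d = 0")
      case True
      then show ?thesis using g[of c] g[of d] cd root_label by (cases "c = 0"; cases "d = 0") auto
    next
      case False
      then have "g (st c) = g (st d)" "st c < m" "st d < m"
        using cd g[of c] g[of d] by (auto simp: leaves_T node_label)
      then have "st c = st d" using inj_g by (auto dest: inj_onD)
      then show ?thesis using cd False node_inj[of c d] by (auto simp: leaves_T)
    qed
  qed
  show "leaf_label T ` leaves T = X"
  proof (intro equalityI subsetI)
    fix x assume "x \<in> leaf_label T ` leaves T"
    then obtain c where "c \<in> leaves T" "x = leaf_label T c" by blast
    then show "x \<in> X" using z root_label node_label g_image node_rng[of c]
      by (cases "c = 0") (auto simp: leaves_T)
  next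
    fix x assume x: "x \<in> X"
    show "x \<in> leaf_label T ` leaves T"
    proof (cases "x = z")
      case True
      then show ?thesis using root_label by (auto simp: leaves_T)
    next
      case False
      then obtain i where i: "i < m" "x = g i" using x g_image by (metis DiffI imageE lessThan_iff singletonD)
      obtain c where c: "0 < c" "c < S" "st c = i" "en c = i" using sing_node i by blast
      then have "c \<in> leaves T" "leaf_label T c = x" using i by (auto simp: leaves_T node_label)
      then show ?thesis by blast
    qed
  qed
qed

lemma labels_desc:
  assumes "0 < c" "c < S"
  shows "labels_of T (desc c) = g ` {st c..en c}"
proof (intro equalityI subsetI)
  fix x assume "x \<in> labels_of T (desc c)"
  then obtain d where d: "d \<in> desc c" "d \<in> leaves T" "x = leaf_label T d" by (auto simp: labels_of_def)
  then have "d \<noteq> 0" "d < S" using desc_ge[of d c] assms desc_less_S by auto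
  then have "x = g (st d)" "st d = en d" using d by (auto simp: leaves_T node_label)
  then show "x \<in> g ` {st c..en c}" using desc_contains[OF assms(2) d(1)] by auto
next
  fix x assume "x \<in> g ` {st c..en c}"
  then obtain i where i: "x = g i" "st c \<le> i" "i \<le> en c" by auto
  then have "i < m" using node_rng[OF assms] by auto
  then obtain d where d: "0 < d" "d < S" "st d = i" "en d = i" using sing_node by blast
  then have "d \<in> desc c" "d \<in> leaves T" "leaf_label T d = x"
    using contains_desc assms i by (auto simp: leaves_T node_label)
  then show "x \<in> labels_of T (desc c)" by (auto simp: labels_of_def)
qed

lemma labels_not_desc:
  assumes "0 < c" "c < S"
  shows "labels_of T ({..<S} - desc c) = X - g ` {st c..en c}"
proof -
  have "leaves T \<subseteq> {..<S}" by (auto simp: leaves_def nodes_T)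
  then have "({..<S} - desc c) \<inter> leaves T = leaves T - (desc c \<inter> leaves T)" by auto
  moreover have "leaf_label T ` (leaves T - (desc c \<inter> leaves T)) =
      leaf_label T ` leaves T - leaf_label T ` (desc c \<inter> leaves T)"
    using bij_leaf_label by (intro inj_on_image_set_diff) (auto simp: bij_betw_def)
  ultimately show ?thesis
    using labels_desc[OF assms] bij_leaf_label by (simp add: labels_of_def bij_betw_def)
qed

definition bip :: "nat \<Rightarrow> nat \<Rightarrow> 'a set set" where
  "bip i j = {g ` {i..j}, X - g ` {i..j}}"

lemma g_subset: "j < m \<Longrightarrow> g ` {i..j} \<subseteq> X - {z}"
  using g_image by auto

text \<open>The part without \<open>z\<close> is the interval, so the bipartition determines
  it.\<close>

lemma bip_inj:
  assumes "i \<le> j" "j < m" "i' \<le> j'" "j' < m" "bip i j = bip i' j'"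
  shows "i = i' \<and> j = j'"
proof -
  have "z \<notin> g ` {i..j}" "z \<in> X - g ` {i'..j'}"
    using g_subset[of j i] g_subset[of j' i'] assms(2,4) z by blast+
  then have "g ` {i..j} \<noteq> X - g ` {i'..j'}" by blast
  then have "g ` {i..j} = g ` {i'..j'}" using assms(5) by (auto simp: bip_def doubleton_eq_iff)
  then have "{i..j} = {i'..j'}"
    using assms by (subst (asm) inj_on_image_eq_iff[OF inj_g]) auto
  then show ?thesis using assms by (auto simp: Icc_eq_Icc)
qed

text \<open>Both complements contain \<open>z\<close>, so one of the four intersections is never
  empty; the other three are those that decide whether the intervals overlap.\<close>

lemma overlap_bip:
  assumes "i \<le> j" "j < m" "i' \<le> j'" "j' < m"
  shows "overlap (bip i j) (bip i' j') \<longleftrightarrow> i < i' \<and> i' \<le> j \<and> j < j' \<or> i' < i \<and> i \<le> j' \<and> j' < j"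
proof -
  let ?A = "{i..j}" and ?B = "{i'..j'}"
  have sub: "?A \<subseteq> {..<m}" "?B \<subseteq> {..<m}" using assms by auto
  have gs: "g ` ?A \<subseteq> X - {z}" "g ` ?B \<subseteq> X - {z}" using g_subset assms by auto
  have "overlap (bip i j) (bip i' j') \<longleftrightarrow>
      g ` ?A \<inter> g ` ?B \<noteq> {} \<and> g ` ?A - g ` ?B \<noteq> {} \<and> g ` ?B - g ` ?A \<noteq> {}"
  proof -
    have "g ` ?A \<inter> (X - g ` ?B) = g ` ?A - g ` ?B" "(X - g ` ?A) \<inter> g ` ?B = g ` ?B - g ` ?A"
      using gs by blast+
    moreover have "(X - g ` ?A) \<inter> (X - g ` ?B) \<noteq> {}" using gs z by blast
    ultimately show ?thesis unfolding overlap_def bip_def by auto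
  qed
  also have "\<dots> \<longleftrightarrow> g ` (?A \<inter> ?B) \<noteq> {} \<and> g ` (?A - ?B) \<noteq> {} \<and> g ` (?B - ?A) \<noteq> {}"
  proof -
    have "g ` ?A \<inter> g ` ?B = g ` (?A \<inter> ?B)"
      by (rule inj_on_image_Int[OF inj_g sub, symmetric])
    moreover have "g ` ?A - g ` ?B = g ` (?A - ?B)" "g ` ?B - g ` ?A = g ` (?B - ?A)"
      using sub by (intro inj_on_image_set_diff[OF inj_g, symmetric]; auto)+
    ultimately show ?thesis by (simp only:)
  qed
  also have "\<dots> \<longleftrightarrow> ?A \<inter> ?B \<noteq> {} \<and> \<not> ?A \<subseteq> ?B \<and> \<not> ?B \<subseteq> ?A" by auto
  also have "\<dots> \<longleftrightarrow> i < i' \<and> i' \<le> j \<and> j < j' \<or> i' < i \<and> i \<le> j' \<and> j' < j"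
    using assms by auto
  finally show ?thesis .
qed

definition interval :: "nat \<Rightarrow> nat set" where
  "interval c = {st c..en c}"

lemma edge_bip_bip: "0 < c \<Longrightarrow> c < S \<Longrightarrow> edge_bip T {c, par c} = bip (st c) (en c)"
  by (simp add: edge_bip_T labels_desc labels_not_desc bip_def)

context
  fixes R :: "'a rel"
  assumes umod: "umod_bips X R = {bip i j | i j. md i j}"
begin

lemma strong_bips_eq: "strong_bips X R = {bip i j | i j. strong i j}"
proof (intro equalityI subsetI)
  fix P assume "P \<in> strong_bips X R"
  then have "P \<in> umod_bips X R" and no: "\<And>Q. Q \<in> umod_bips X R \<Longrightarrow> Q \<noteq> P \<Longrightarrow> \<not> overlap P Q"
    by (simp_all add: strong_bips_def)
  then obtain i j where P: "P = bip i j" "md i j" using umod by auto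
  have "strong i j" unfolding strong_def
  proof (intro conjI notI P)
    assume "\<exists>i' j'. md i' j' \<and> (i < i' \<and> i' \<le> j \<and> j < j' \<or> i' < i \<and> i \<le> j' \<and> j' < j)"
    then obtain i' j' where 1: "md i' j'" "i < i' \<and> i' \<le> j \<and> j < j' \<or> i' < i \<and> i \<le> j' \<and> j' < j"
      by blast
    then have "overlap P (bip i' j')"
      using overlap_bip[of i j i' j'] rng[OF P(2)] rng[OF 1(1)] P(1) by simp
    moreover have "bip i' j' \<noteq> P"
      using bip_inj[of i' j' i j] rng[OF P(2)] rng[OF 1(1)] P(1) 1(2) by auto
    moreover have "bip i' j' \<in> umod_bips X R" unfolding umod using 1(1) by (intro CollectI exI conjI) simp_all
    ultimately show False using no by simp
  qed
  then show "P \<in> {bip i j | i j. strong i j}" using P(1) by auto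
next
  fix P assume "P \<in> {bip i j | i j. strong i j}"
  then obtain i j where P: "P = bip i j" "strong i j" by auto
  note md = strongD(1)[OF P(2)]
  have "\<not> overlap P Q" if q: "Q \<in> umod_bips X R" for Q
  proof -
    obtain i' j' where Q: "Q = bip i' j'" "md i' j'" using q umod by auto
    show ?thesis
      using overlap_bip[of i j i' j'] rng[OF md] rng[OF Q(2)] P Q strongD(2,3)[OF P(2) Q(2)] by simp
  qed
  then show "P \<in> strong_bips X R" using P md umod by (auto simp: strong_bips_def)
qed

lemma bij_edge_bip: "bij_betw (edge_bip T) (edges T) (strong_bips X R)"
  unfolding bij_betw_def
proof
  show "inj_on (edge_bip T) (edges T)"
  proof (rule inj_onI)
    fix e e' assume "e \<in> edges T" "e' \<in> edges T" and eq: "edge_bip T e = edge_bip T e'"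
    then obtain c d where "c \<in> {1..<S}" "e = {c, par c}" "d \<in> {1..<S}" "e' = {d, par d}"
      unfolding edges_T by blast
    then have cd: "0 < c" "c < S" "e = {c, par c}" "0 < d" "d < S" "e' = {d, par d}" by auto
    then have "bip (st c) (en c) = bip (st d) (en d)" using eq by (simp add: edge_bip_bip)
    then have "c = d"
      using bip_inj node_rng[of c] node_rng[of d] node_inj[of c d] cd by blast
    then show "e = e'" using cd by simp
  qed
  have "edge_bip T ` edges T = (\<lambda>c. bip (st c) (en c)) ` {1..<S}"
    unfolding edges_T image_image by (intro image_cong) (auto simp: edge_bip_bip)
  also have "\<dots> = (\<lambda>(i, j). bip i j) ` (\<lambda>c. (st c, en c)) ` {1..<S}"
    by (simp add: image_image)
  also have "(\<lambda>c. (st c, en c)) ` {1..<S} = {(i, j). strong i j}"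
    using bij_nodes by (simp only: bij_betw_def)
  also have "(\<lambda>(i, j). bip i j) ` {(i, j). strong i j} = {bip i j | i j. strong i j}" by auto
  also have "\<dots> = strong_bips X R" unfolding strong_bips_eq by auto
  finally show "edge_bip T ` edges T = strong_bips X R" .
qed

end

section \<open>Bipartitions displayed at the internal nodes\<close>

abbreviation child :: "nat \<Rightarrow> nat \<Rightarrow> nat" where
  "child N i \<equiv> children N ! i"

abbreviation arity :: "nat \<Rightarrow> nat" where
  "arity N \<equiv> length (children N)"

lemma child_props:
  assumes "N < S" "i < arity N"
  shows "0 < child N i" "child N i < S" "par (child N i) = N" "N < child N i" "child N i \<in> desc N"
proof -
  have "child N i \<in> set (children N)" using assms by simp
  then show *: "0 < child N i" "child N i < S" "par (child N i) = N"
    using set_children assms by auto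
  then show "N < child N i" using par_less by metis
  show "child N i \<in> desc N" using descI[OF *(1,2)] *(3) desc_self assms by simp
qed

lemma children_disjoint:
  assumes "N < S" "i < j" "j < arity N"
  shows "en (child N i) < st (child N j)"
proof -
  let ?c = "child N i" and ?d = "child N j"
  have c: "?c < S" "par ?c = N" "N < ?c" and d: "?d < S" "par ?d = N"
    using child_props assms by auto
  have cd: "?c < ?d" using sorted_children assms by simp
  have "?d \<notin> desc ?c"
    using desc_par[of ?d ?c] desc_ge[of N ?c] c d cd by auto
  then show ?thesis using nested[OF cd d(1)] desc_iff[OF c(1), of ?d] cd d by auto
qed

lemma child_interval_subset: "N < S \<Longrightarrow> i < arity N \<Longrightarrow> interval (child N i) \<subseteq> interval N"
  using desc_contains child_props unfolding interval_def by fastforce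

lemma children_cover:
  assumes N: "0 < N" "N < S" "st N < en N" and x: "x \<in> interval N"
  obtains i where "i < arity N" "x \<in> interval (child N i)"
proof -
  have x': "st N \<le> x" "x \<le> en N" "x < m" using x node_rng[OF N(1,2)] by (auto simp: interval_def)
  obtain d where d: "0 < d" "d < S" "st d = x" "en d = x" using sing_node x' by blast
  have "d \<in> desc N" using contains_desc d N x' by auto
  moreover have "d \<noteq> N" using d N by auto
  ultimately obtain e where e: "0 < e" "e < S" "par e = N" "d \<in> desc e" by (rule desc_child)
  then have "e \<in> set (children N)" using set_children N by simp
  then obtain i where "i < arity N" "child N i = e" by (metis in_set_conv_nth)
  moreover have "x \<in> interval e" using desc_contains[OF e(2,4)] d by (simp add: interval_def)
  ultimately show thesis using that by blast
qed

lemma child_interval_iff: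
  assumes "N < S" "i < arity N" "j < arity N" "x \<in> interval (child N i)" "x \<in> interval (child N j)"
  shows "i = j"
  using children_disjoint[of N i j] children_disjoint[of N j i] assms
  by (cases i j rule: linorder_cases) (auto simp: interval_def)

text \<open>The children are disjoint, increase from left to right and cover the node, so there is
  no gap between neighbouring ones.\<close>

lemma Union_children:
  assumes N: "0 < N" "N < S" "st N < en N" and ab: "a < b" "b \<le> arity N"
  shows "(\<Union>i\<in>{a..<b}. interval (child N i)) = {st (child N a)..en (child N (b - 1))}"
proof (intro equalityI subsetI)
  fix x assume "x \<in> (\<Union>i\<in>{a..<b}. interval (child N i))"
  then obtain i where i: "a \<le> i" "i < b" "st (child N i) \<le> x" "x \<le> en (child N i)"
    by (auto simp: interval_def)
  have r: "st (child N i) \<le> en (child N i)" if "i < b" for i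
    using node_rng child_props[of N i] that N ab by auto
  have "st (child N a) \<le> x"
    using children_disjoint[of N a i] i r[of a] N ab by (cases "a = i") auto
  moreover have "x \<le> en (child N (b - 1))"
  proof (cases "i = b - 1")
    case False
    then have "i < b - 1" "b - 1 < arity N" using i ab by auto
    then show ?thesis using children_disjoint[of N i "b - 1"] i r[of "b - 1"] N ab by auto
  qed (use i in auto)
  ultimately show "x \<in> {st (child N a)..en (child N (b - 1))}" by simp
next
  fix x assume x: "x \<in> {st (child N a)..en (child N (b - 1))}"
  have "interval (child N a) \<subseteq> interval N" "interval (child N (b - 1)) \<subseteq> interval N"
    using child_interval_subset N ab by auto
  moreover have "st (child N a) \<le> en (child N a)" "st (child N (b - 1)) \<le> en (child N (b - 1))"
    using node_rng child_props N ab by auto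
  ultimately have "x \<in> interval N" using x by (auto simp: interval_def)
  then obtain i where i: "i < arity N" "x \<in> interval (child N i)" using children_cover N by blast
  have "a \<le> i"
    using children_disjoint[of N i a] x i N ab by (intro leI) (auto simp: interval_def)
  moreover have "\<not> b - 1 < i"
    using children_disjoint[of N "b - 1" i] x i N ab by (auto simp: interval_def)
  ultimately show "x \<in> (\<Union>i\<in>{a..<b}. interval (child N i))" using i ab by auto
qed

lemma node_part_0: "0 < N \<Longrightarrow> N < S \<Longrightarrow> node_part T N 0 = X - g ` interval N"
  by (simp add: node_part_par labels_not_desc interval_def)

lemma node_part_Suc:
  "0 < N \<Longrightarrow> N < S \<Longrightarrow> i < arity N \<Longrightarrow> node_part T N (Suc i) = g ` interval (child N i)"
  using child_props[of N i] by (simp add: node_part_child labels_desc interval_def)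

lemma node_bip_root: "0 < N \<Longrightarrow> N < S \<Longrightarrow> node_bip X T N {0} = bip (st N) (en N)"
proof -
  assume N: "0 < N" "N < S"
  have "g ` interval N \<subseteq> X" using g_subset[of "en N" "st N"] node_rng[OF N] by (auto simp: interval_def)
  then have "X - (X - g ` interval N) = g ` interval N" by auto
  then show ?thesis using N by (simp add: node_bip_def node_part_0 bip_def interval_def insert_commute)
qed

lemma node_bip_children:
  assumes N: "0 < N" "N < S" "st N < en N" and ab: "a < b" "b \<le> arity N"
  shows "node_bip X T N {Suc a..<Suc b} = bip (st (child N a)) (en (child N (b - 1)))"
proof -
  have "(\<Union>i\<in>{Suc a..<Suc b}. node_part T N i) = (\<Union>i\<in>Suc ` {a..<b}. node_part T N i)"
    by (simp only: image_Suc_atLeastLessThan)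
  also have "\<dots> = (\<Union>i\<in>{a..<b}. node_part T N (Suc i))" by (simp only: image_image)
  also have "\<dots> = (\<Union>i\<in>{a..<b}. g ` interval (child N i))"
    using N ab by (intro SUP_cong) (auto simp: node_part_Suc)
  also have "\<dots> = g ` {st (child N a)..en (child N (b - 1))}"
    using Union_children[OF N ab] by (metis image_UN)
  finally show ?thesis by (simp add: node_bip_def bip_def)
qed

lemma node_parts_cover:
  assumes N: "0 < N" "N < S" "st N < en N"
  shows "(\<Union>i<Suc (arity N). node_part T N i) = X"
proof -
  have gN: "g ` interval N \<subseteq> X"
    using g_subset[of "en N" "st N"] node_rng[OF N(1,2)] by (auto simp: interval_def)
  have "(\<Union>i<Suc (arity N). node_part T N i) =
      node_part T N 0 \<union> (\<Union>i<arity N. node_part T N (Suc i))"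
    unfolding lessThan_Suc_eq_insert_0 by auto
  also have "\<dots> = (X - g ` interval N) \<union> g ` (\<Union>i<arity N. interval (child N i))"
    using N by (auto simp: node_part_0 node_part_Suc)
  also have "(\<Union>i<arity N. interval (child N i)) = interval N"
    using children_cover[OF N] child_interval_subset[OF N(2)] by blast
  finally show ?thesis using gN by auto
qed

lemma node_parts_disjoint:
  assumes N: "0 < N" "N < S" "st N < en N" and ij: "i < j" "j < Suc (arity N)"
  shows "node_part T N i \<inter> node_part T N j = {}"
proof -
  have m: "interval N \<subseteq> {..<m}" using node_rng[OF N(1,2)] by (auto simp: interval_def)
  obtain j' where j: "j = Suc j'" "j' < arity N" using ij by (cases j) auto
  show ?thesis
  proof (cases i)
    case 0
    then show ?thesis
      using N j child_interval_subset[OF N(2) j(2)] by (auto simp: node_part_0 node_part_Suc)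
  next
    case (Suc i')
    have sub: "interval (child N k) \<subseteq> {..<m}" if "k < arity N" for k
      using child_interval_subset[OF N(2) that] m by blast
    have "interval (child N i') \<inter> interval (child N j') = {}"
      using child_interval_iff[of N i' j'] N ij j Suc by auto
    moreover have "g ` (interval (child N i') \<inter> interval (child N j')) =
        g ` interval (child N i') \<inter> g ` interval (child N j')"
      using sub[of i'] sub[of j'] ij j Suc by (intro inj_on_image_Int[OF inj_g]) auto
    ultimately show ?thesis using N ij j Suc by (simp add: node_part_Suc)
  qed
qed

text \<open>Replaces an index set containing \<open>0\<close>, the part of the parent, by one that
  consists of children only.\<close>

lemma node_bip_swap:
  assumes N: "0 < N" "N < S" "st N < en N" and I: "I \<subseteq> {..<Suc (arity N)}"
  shows "node_bip X T N I = node_bip X T N ({..<Suc (arity N)} - I)"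
proof -
  let ?P = "node_part T N" and ?K = "{..<Suc (arity N)}"
  have dis: "?P i \<inter> ?P j = {}" if "i \<in> ?K" "j \<in> ?K" "i \<noteq> j" for i j
    using node_parts_disjoint[OF N, of i j] node_parts_disjoint[OF N, of j i] that
    by (cases i j rule: linorder_cases) auto
  have cov: "(\<Union>i\<in>?K. ?P i) = X" using node_parts_cover[OF N] .
  have "X - (\<Union>i\<in>I. ?P i) = (\<Union>i\<in>?K - I. ?P i)"
    unfolding cov[symmetric] using dis I by blast
  moreover have "X - (\<Union>i\<in>?K - I. ?P i) = (\<Union>i\<in>I. ?P i)"
    unfolding cov[symmetric] using dis I by blast
  ultimately show ?thesis by (simp add: node_bip_def insert_commute)
qed

text \<open>A strong interval around a child is the interval of some node; that node is the child
  itself or has \<open>N\<close> among its descendants. So the child is maximal in the sense of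
  \<open>strong_child_ecut\<close>.\<close>

lemma child_ecut:
  assumes N: "0 < N" "N < S" and r: "cut (st N) (en N) r" and i: "i < arity N"
  shows "ecut (st N) (en N) (st (child N i))" "ecut (st N) (en N) (Suc (en (child N i)))"
proof -
  let ?c = "child N i"
  have c: "0 < ?c" "?c < S" "par ?c = N" "?c \<in> desc N" using child_props N i by auto
  have con: "st N \<le> st ?c" "en ?c \<le> en N" using desc_contains[OF N(2) c(4)] by auto
  have max: "x' \<le> st N \<and> en N \<le> y' \<or> x' = st ?c \<and> y' = en ?c"
    if s: "strong x' y'" "x' \<le> st ?c" "en ?c \<le> y'" for x' y'
  proof -
    obtain d where d: "0 < d" "d < S" "st d = x'" "en d = y'" using strong_node[OF s(1)] by blast
    have "?c \<in> desc d" using contains_desc c d s by auto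
    then have "?c = d \<or> N \<in> desc d" using desc_par[of ?c d] c by auto
    then show ?thesis using desc_contains[of d N] d by auto
  qed
  have cs: "strong (st ?c) (en ?c)" using node_strong c by blast
  show "ecut (st N) (en N) (st ?c)" "ecut (st N) (en N) (Suc (en ?c))"
    using strong_child_ecut[OF node_strong[OF N] r cs con max] by blast+
qed

lemma node_bips_subset:
  assumes N: "0 < N" "N < S" "st N < en N"
  shows "node_bips X T N \<subseteq> {bip i j | i j. md i j}"
proof
  fix P assume "P \<in> node_bips X T N"
  then obtain I where I: "P = node_bip X T N I" "I \<subseteq> {..<Suc (arity N)}" "1 \<le> card I"
      "card I < Suc (arity N)" "kind_admits (kind T N) I"
    using N by (auto simp: node_bips_def degree_T)
  show "P \<in> {bip i j | i j. md i j}"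
  proof (cases "\<exists>r. cut (st N) (en N) r")
    case False
    then have "kind T N = Prime" using kind_T N by simp
    then obtain a where a: "I = {a}" using I by auto
    show ?thesis
    proof (cases a)
      case 0
      then show ?thesis using a I(1) node_bip_root[OF N(1,2)] strongD(1)[OF node_strong[OF N(1,2)]] by blast
    next
      case (Suc i)
      then have "i < arity N" using I a by auto
      moreover have "node_bip X T N {Suc i} = bip (st (child N i)) (en (child N i))"
        using node_bip_children[OF N, of i "Suc i"] \<open>i < arity N\<close> by (simp add: atLeastLessThanSuc)
      ultimately show ?thesis
        using a I(1) Suc strongD(1)[OF node_strong[of "child N i"]] child_props[of N i] N by auto
    qed
  next
    case True
    then obtain r where r: "cut (st N) (en N) r" by blast
    have md: "md (st (child N a)) (en (child N (b - 1)))" if ab: "a < b" "b \<le> arity N" for a b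
    proof -
      have "st (child N a) < Suc (en (child N (b - 1)))"
      proof (cases "a = b - 1")
        case True
        then show ?thesis using node_rng[of "child N a"] child_props[of N a] N ab by auto
      next
        case False
        then have "a < b - 1" "b - 1 < arity N" using ab by auto
        then show ?thesis
          using children_disjoint[of N a "b - 1"] N ab node_rng[of "child N a"] child_props[of N a]
            node_rng[of "child N (b - 1)"] child_props[of N "b - 1"] by auto
      qed
      then show ?thesis
        using ecut_interval[of "st N" "en N" "st (child N a)" "Suc (en (child N (b - 1)))"]
          strongD(1)[OF node_strong[OF N(1,2)]] child_ecut[OF N(1,2) r] ab by auto
    qed
    have "kind T N = Circular" using kind_T N r by auto
    then obtain a b where ab: "I = {a..<b}" using I by auto
    then have "a < b" using I by auto
    then have "b - 1 \<in> {..<Suc (arity N)}" using I(2) ab by auto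
    with \<open>a < b\<close> have lt: "a < b" "b \<le> Suc (arity N)" by auto
    show ?thesis
    proof (cases a)
      case (Suc a')
      obtain b' where b': "b = Suc b'" using lt by (cases b) auto
      then have "P = bip (st (child N a')) (en (child N (b' - 1)))"
        using node_bip_children[OF N, of a' b'] I ab Suc lt by simp
      then show ?thesis using md[of a' b'] lt Suc b' by auto
    next
      \<comment> \<open>The index interval begins with the part of the parent, so its complement is
        a run of children up to the last one.\<close>
      case 0
      have "b < Suc (arity N)" using I(4) ab 0 by simp
      obtain b' where b': "b = Suc b'" using lt by (cases b) auto
      have "{..<Suc (arity N)} - I = {Suc b'..<Suc (arity N)}" using ab 0 b' by auto
      then have "P = bip (st (child N b')) (en (child N (arity N - 1)))"
        using node_bip_swap[OF N I(2)] node_bip_children[OF N, of b' "arity N"] I(1) b'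
          \<open>b < Suc (arity N)\<close> by simp
      then show ?thesis using md[of b' "arity N"] b' \<open>b < Suc (arity N)\<close> by auto
    qed
  qed
qed

lemma internal_arity: "0 < N \<Longrightarrow> N < S \<Longrightarrow> st N < en N \<Longrightarrow> 0 < arity N"
  using children_Nil_iff[of N] by auto

text \<open>An internal node displays its own interval as the complement of part \<open>0\<close>. A
  singleton is displayed at its parent, which is internal unless there is only one position, the
  case \<open>m = 1\<close>.\<close>

lemma strong_in_node_bips:
  assumes "m \<noteq> 1" "0 < c" "c < S"
  shows "\<exists>N\<in>internal T. bip (st c) (en c) \<in> node_bips X T N"
proof (cases "st c < en c")
  case True
  have k: "kind_admits k {0}" for k
  proof (cases k)
    case Circular
    have "{0::nat} = {0..<1}" by auto
    then show ?thesis using Circular kind_admits.simps(2) by metis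
  qed auto
  have "bip (st c) (en c) \<in> node_bips X T c"
    unfolding node_bips_def
    using node_bip_root[OF assms(2,3)] internal_arity[OF assms(2,3) True] degree_T[OF assms(3)] assms k
    by (intro CollectI exI[of _ "{0}"]) auto
  moreover have "c \<in> internal T" using True assms by (simp add: internal_T)
  ultimately show ?thesis by (rule bexI)
next
  case False
  let ?N = "par c"
  have eq: "st c = en c" "en c < m" using False node_rng[OF assms(2,3)] by simp_all
  then have "c \<noteq> 1" using root_child S_pos assms by auto
  then have N: "0 < ?N" "?N < S" using par_pos[of c] par_less_S[of c] assms by simp_all
  have cd: "c \<in> desc ?N" using descI desc_self assms N by blast
  have "c \<in> set (children ?N)" using set_children assms N by simp
  then obtain i where i: "i < arity ?N" "child ?N i = c" by (metis in_set_conv_nth)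
  have lt: "st ?N < en ?N"
    using children_Nil_iff[OF N] i node_rng[OF N] by (cases "st ?N = en ?N") auto
  have k: "kind_admits k {Suc i}" for k
  proof (cases k)
    case Circular
    have "{Suc i} = {Suc i..<Suc (Suc i)}" by auto
    then show ?thesis using Circular kind_admits.simps(2) by metis
  qed auto
  have "node_bip X T ?N {Suc i} = bip (st c) (en c)"
    using node_bip_children[OF N lt, of i "Suc i"] i by (simp add: atLeastLessThanSuc)
  then have "bip (st c) (en c) \<in> node_bips X T ?N"
    unfolding node_bips_def
    using i degree_T[OF N(2)] N k by (intro CollectI exI[of _ "{Suc i}"]) auto
  moreover have "?N \<in> internal T" using lt N by (simp add: internal_T)
  ultimately show ?thesis by (rule bexI)
qed

text \<open>In preorder, the last node enclosing the interval is the smallest one. It has a cut by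
  \<open>nonstrong_cut\<close> and is therefore circular. A child that meets the interval neither
  overlaps nor contains it, so it lies inside; the interval is a run of children.\<close>

lemma nonstrong_in_node_bips:
  assumes ij: "md i j" "\<not> strong i j"
  shows "\<exists>N\<in>internal T. bip i j \<in> node_bips X T N"
proof -
  have r: "i \<le> j" "j < m" using rng ij by auto
  then obtain c where c: "0 < c" "c < S" "st c = 0" "en c = m - 1"
    using strong_node[OF strong_whole] by auto
  define N where "N = (GREATEST N. N < S \<and> 0 < N \<and> st N \<le> i \<and> j \<le> en N)"
  have N: "N < S \<and> 0 < N \<and> st N \<le> i \<and> j \<le> en N"
    unfolding N_def by (rule GreatestI_nat[of _ c S]) (use c r in auto)
  have max: "N' \<le> N" if "N' < S" "0 < N'" "st N' \<le> i" "j \<le> en N'" for N'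
    unfolding N_def by (rule Greatest_le_nat[of _ _ S]) (use that in auto)
  have N': "0 < N" "N < S" using N by auto
  have ne: "\<not> (st N = i \<and> en N = j)" using ij node_strong[OF N'] by auto
  then have lt: "st N < en N" using N r by auto
  have min: "x \<le> st N \<and> en N \<le> y" if s: "strong x y" "x \<le> i" "j \<le> y" for x y
  proof -
    obtain d where d: "0 < d" "d < S" "st d = x" "en d = y" using strong_node[OF s(1)] by blast
    then have "d \<le> N" using max s by auto
    then show ?thesis
      using nested[of d N] preorder[of d N] d s N r by (cases "d = N") auto
  qed
  obtain q where q: "cut (st N) (en N) q"
    using nonstrong_cut[OF node_strong[OF N'] ij _ _ min] N by blast
  then have kind: "kind T N = Circular" using kind_T N' lt by auto
  have inside: "i \<le> st (child N k) \<and> en (child N k) \<le> j"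
    if k: "k < arity N" "x \<in> interval (child N k)" "i \<le> x" "x \<le> j" for k x
  proof -
    let ?c = "child N k"
    have c: "0 < ?c" "?c < S" "N < ?c" using child_props k N' by auto
    have "strong (st ?c) (en ?c)" using node_strong c by blast
    then have "\<not> (st ?c < i \<and> i \<le> en ?c \<and> en ?c < j)" "\<not> (i < st ?c \<and> st ?c \<le> j \<and> j < en ?c)"
      using strongD(2,3) ij(1) by blast+
    moreover have "\<not> (st ?c \<le> i \<and> j \<le> en ?c)" using max[of ?c] c by auto
    ultimately show ?thesis using k by (auto simp: interval_def)
  qed
  have "i \<in> interval N" "j \<in> interval N" using N r by (auto simp: interval_def)
  then obtain a b where a: "a < arity N" "i \<in> interval (child N a)"
      and b: "b < arity N" "j \<in> interval (child N b)"
    by (meson children_cover[OF N' lt])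
  have ends: "st (child N a) = i" "en (child N b) = j"
    using inside[OF a] inside[OF b] a b r by (auto simp: interval_def)
  have "a \<le> b"
  proof (rule leI, rule notI)
    assume "b < a"
    then show False using children_disjoint[OF N'(2) _ a(1)] ends r by fastforce
  qed
  have bip: "node_bip X T N {Suc a..<Suc (Suc b)} = bip i j"
    using node_bip_children[OF N' lt, of a "Suc b"] \<open>a \<le> b\<close> b ends by simp
  have "\<not> (a = 0 \<and> Suc b = arity N)"
  proof
    assume ab: "a = 0 \<and> Suc b = arity N"
    have "interval N \<subseteq> {i..j}"
    proof
      fix x assume "x \<in> interval N"
      then obtain k where "k < arity N" "x \<in> interval (child N k)"
        by (rule children_cover[OF N' lt])
      then have "x \<in> (\<Union>i\<in>{0..<arity N}. interval (child N i))" by auto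
      moreover have e: "arity N = Suc b" "st (child N 0) = i" using ab ends by auto
      moreover have "(\<Union>i\<in>{0..<Suc b}. interval (child N i)) = {st (child N 0)..en (child N (Suc b - 1))}"
        by (rule Union_children[OF N' lt]) (simp_all add: e)
      ultimately show "x \<in> {i..j}" by (simp only: e ends diff_Suc_1)
    qed
    then show False using ne N node_rng[OF N'] by (auto simp: interval_def)
  qed
  have "bip i j \<in> node_bips X T N"
    unfolding node_bips_def
  proof (intro CollectI exI[of _ "{Suc a..<Suc (Suc b)}"] conjI)
    show "kind_admits (kind T N) {Suc a..<Suc (Suc b)}" using kind by auto
  qed (use bip degree_T[OF N'(2)] N' a b \<open>a \<le> b\<close> in auto)
  moreover have "N \<in> internal T" using lt N' by (simp add: internal_T)
  ultimately show ?thesis by (rule bexI)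
qed

lemma Union_node_bips:
  assumes "m \<noteq> 1"
  shows "(\<Union>N\<in>internal T. node_bips X T N) = {bip i j | i j. md i j}"
proof (intro equalityI subsetI)
  fix P assume "P \<in> (\<Union>N\<in>internal T. node_bips X T N)"
  then show "P \<in> {bip i j | i j. md i j}" using node_bips_subset by (auto simp: internal_T)
next
  fix P assume "P \<in> {bip i j | i j. md i j}"
  then obtain i j where P: "P = bip i j" "md i j" by blast
  show "P \<in> (\<Union>N\<in>internal T. node_bips X T N)"
  proof (cases "strong i j")
    case True
    then obtain c where "0 < c" "c < S" "st c = i" "en c = j" by (rule strong_node)
    then show ?thesis using strong_in_node_bips[OF assms, of c] P by auto
  next
    case False
    then show ?thesis using nonstrong_in_node_bips P by auto
  qed
qed

theorem umodular_tree_T: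
  assumes "umod_bips X R = {bip i j | i j. md i j}"
  shows "umodular_tree X R T"
proof -
  have "card (X - {z}) = m" using bij_betw_same_card[OF bij_g] by simp
  then have "card X = Suc m \<or> infinite X" using z by (metis card_Suc_Diff1 finite_Diff2 finite.emptyI finite.insertI)
  moreover have "finite X" using g_image finite_imageI[of "{..<m}" g] by auto
  ultimately have "card X \<noteq> 2 \<longrightarrow> m \<noteq> 1" by auto
  then show ?thesis
    using is_tree_T bij_leaf_label bij_edge_bip[OF assms] Union_node_bips assms
    by (auto simp: umodular_tree_def)
qed

end

section \<open>Switching\<close>

text \<open>An exclusive or of three arcs: the arc between \<open>u\<close> and \<open>w\<close> is
  reversed iff exactly one of them dominates \<open>z\<close>.\<close>

definition switched :: "nat \<Rightarrow> (nat \<Rightarrow> nat \<Rightarrow> bool) \<Rightarrow> nat \<Rightarrow> nat \<Rightarrow> bool" where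
  "switched z a u w \<longleftrightarrow> ((a u w \<noteq> a u z) \<noteq> a w z)"

lemma tournamentD:
  assumes "tournament X R"
  shows "(x, y) \<in> R \<Longrightarrow> (y, x) \<notin> R"
    "x \<in> X \<Longrightarrow> y \<in> X \<Longrightarrow> x \<noteq> y \<Longrightarrow> (x, y) \<in> R \<longleftrightarrow> (y, x) \<notin> R"
proof -
  have as: "asym R" and tot: "total_on X R" using assms by (auto simp: tournament_def)
  show 1: "(x, y) \<in> R \<Longrightarrow> (y, x) \<notin> R" for x y using as by (auto dest: asymD)
  show "x \<in> X \<Longrightarrow> y \<in> X \<Longrightarrow> x \<noteq> y \<Longrightarrow> (x, y) \<in> R \<longleftrightarrow> (y, x) \<notin> R"
    using tot 1[of x y] unfolding total_on_def by blast
qed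

lemma homogeneous_iff:
  assumes "tournament X R" "p \<in> X" "q \<in> X" "r \<in> X" "p \<noteq> q" "p \<noteq> r"
  shows "homogeneous R p q r \<longleftrightarrow> ((p, q) \<in> R \<longleftrightarrow> (p, r) \<in> R)"
  using tournamentD(2)[OF assms(1), of p q] tournamentD(2)[OF assms(1), of p r] assms
  by (auto simp: homogeneous_def out_nbhd_def in_nbhd_def)

lemma umodule_iff:
  assumes "tournament X R"
  shows "umodule X R U \<longleftrightarrow> U \<subseteq> X \<and> (\<forall>u\<in>U. \<forall>u'\<in>U. \<forall>x\<in>X - U. \<forall>x'\<in>X - U.
    ((u, x) \<in> R \<longleftrightarrow> (u, x') \<in> R) \<longleftrightarrow> ((u', x) \<in> R \<longleftrightarrow> (u', x') \<in> R))"
proof (cases "U \<subseteq> X")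
  case True
  have "homogeneous R u x x' \<longleftrightarrow> ((u, x) \<in> R \<longleftrightarrow> (u, x') \<in> R)"
    if "u \<in> U" "x \<in> X - U" "x' \<in> X - U" for u x x'
    using that True by (intro homogeneous_iff[OF assms]) auto
  then show ?thesis unfolding umodule_def by simp
qed (simp add: umodule_def)

text \<open>For two vertices on each side, the condition says that an even number of the four arcs
  between them leave \<open>U\<close>. Seen from the other side all four arcs are reversed, which
  keeps the parity.\<close>

lemma umodule_Compl:
  assumes T: "tournament X R" and U: "umodule X R U"
  shows "umodule X R (X - U)"
proof -
  have sub: "U \<subseteq> X" using U by (simp add: umodule_def)
  have "((u, x) \<in> R \<longleftrightarrow> (u, x') \<in> R) \<longleftrightarrow> ((u', x) \<in> R \<longleftrightarrow> (u', x') \<in> R)"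
    if "u \<in> X - U" "u' \<in> X - U" "x \<in> U" "x' \<in> U" for u u' x x'
  proof -
    have "((x, u) \<in> R \<longleftrightarrow> (x, u') \<in> R) \<longleftrightarrow> ((x', u) \<in> R \<longleftrightarrow> (x', u') \<in> R)"
      using U that unfolding umodule_iff[OF T] by blast
    moreover have "(p, q) \<in> R \<longleftrightarrow> (q, p) \<notin> R" if "p \<in> U" "q \<in> X - U" for p q
      using tournamentD(2)[OF T, of p q] that sub by blast
    ultimately show ?thesis using that by blast
  qed
  moreover have X: "X - (X - U) = U" using sub by auto
  ultimately show ?thesis unfolding umodule_iff[OF T] X by blast
qed

locale indexed_tournament =
  fixes X :: "'a set" and R :: "'a rel" and f :: "nat \<Rightarrow> 'a" and m :: nat
  assumes tourn: "tournament X R" and card_X: "card X = Suc m" and bij_f: "bij_betw f {..<Suc m} X"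
begin

definition a :: "nat \<Rightarrow> nat \<Rightarrow> bool" where "a u w \<longleftrightarrow> (f u, f w) \<in> R"

definition b :: "nat \<Rightarrow> nat \<Rightarrow> bool" where "b = switched m a"

lemma inj_f: "inj_on f {..<Suc m}" and f_image: "f ` {..<Suc m} = X"
  using bij_f by (auto simp: bij_betw_def)

lemma f_in: "u \<le> m \<Longrightarrow> f u \<in> X"
  using f_image by auto

lemma f_eq: "u \<le> m \<Longrightarrow> w \<le> m \<Longrightarrow> f u = f w \<longleftrightarrow> u = w"
  using inj_f by (auto simp: inj_on_def less_Suc_eq_le)

lemma a_anti: "u \<le> m \<Longrightarrow> w \<le> m \<Longrightarrow> u \<noteq> w \<Longrightarrow> a u w \<longleftrightarrow> \<not> a w u"
  unfolding a_def using tournamentD(2)[OF tourn, of "f u" "f w"] f_in f_eq by auto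

lemma a_irrefl: "\<not> a u u"
  unfolding a_def using tournamentD(1)[OF tourn] by blast

sublocale nat_tournament m b
proof
  fix v show "\<not> b v v" by (auto simp: b_def switched_def a_irrefl)
next
  fix u v assume "u < m" "v < m" "u \<noteq> v"
  then show "b u v \<longleftrightarrow> \<not> b v u"
    using a_anti[of u v] by (auto simp: b_def switched_def)
qed

text \<open>It suffices to compare each outer vertex \<open>x\<close> with \<open>m\<close>, which
  is an outer vertex too. The outcome at a member \<open>k\<close> depends on the exclusive or of
  \<open>a x k\<close> and \<open>a k m\<close>, and this is the part of \<open>b x k\<close> that
  varies with \<open>k\<close>.\<close>

lemma umodule_nmodule:
  assumes "S \<subseteq> {..<m}"
  shows "umodule X R (f ` S) \<longleftrightarrow> nmodule m b S"
proof -
  have sub: "f ` S \<subseteq> X" using assms f_in by force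
  have compl: "X - f ` S = f ` ({..m} - S)"
  proof -
    have "f ` ({..<Suc m} - S) = f ` {..<Suc m} - f ` S"
      using assms by (intro inj_on_image_set_diff[OF inj_f]) auto
    then show ?thesis using f_image by (simp add: lessThan_Suc_atMost)
  qed
  have "umodule X R (f ` S) \<longleftrightarrow>
      (\<forall>u\<in>S. \<forall>u'\<in>S. \<forall>x\<in>{..m} - S. \<forall>x'\<in>{..m} - S. (a u x = a u x') = (a u' x = a u' x'))"
    unfolding umodule_iff[OF tourn] compl using sub by (simp add: a_def)
  also have "\<dots> \<longleftrightarrow> nmodule m b S"
  proof
    assume L: "\<forall>u\<in>S. \<forall>u'\<in>S. \<forall>x\<in>{..m} - S. \<forall>x'\<in>{..m} - S. (a u x = a u x') = (a u' x = a u' x')"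
    have "b x k = b x l" if "x < m" "x \<notin> S" "k \<in> S" "l \<in> S" for x k l
    proof -
      have "x \<in> {..m} - S" "m \<in> {..m} - S" using that assms by auto
      then have "(a k x = a k m) = (a l x = a l m)" using L that by blast
      moreover have "a k x = (\<not> a x k)" "a l x = (\<not> a x l)"
        using a_anti[of k x] a_anti[of l x] that assms by force+
      ultimately show ?thesis by (auto simp: b_def switched_def)
    qed
    then show "nmodule m b S" using assms unfolding nmodule_def by blast
  next
    assume M: "nmodule m b S"
    have *: "(a k x = a k m) = (a l x = a l m)" if "x \<in> {..m} - S" "k \<in> S" "l \<in> S" for x k l
    proof (cases "x = m")
      case False
      then have "b x k = b x l" using nmoduleD[OF M, of x k l] that by auto
      moreover have "a k x = (\<not> a x k)" "a l x = (\<not> a x l)"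
        using a_anti[of k x] a_anti[of l x] that assms by force+
      ultimately show ?thesis by (auto simp: b_def switched_def)
    qed simp
    show "\<forall>u\<in>S. \<forall>u'\<in>S. \<forall>x\<in>{..m} - S. \<forall>x'\<in>{..m} - S. (a u x = a u x') = (a u' x = a u' x')"
    proof (intro ballI)
      fix u u' x x' assume "u \<in> S" "u' \<in> S" "x \<in> {..m} - S" "x' \<in> {..m} - S"
      then show "(a u x = a u x') = (a u' x = a u' x')" using *[of x u u'] *[of x' u u'] by blast
    qed
  qed
  finally show ?thesis .
qed

lemma umod_bips_nmodule:
  "umod_bips X R = {{f ` S, X - f ` S} | S. S \<noteq> {} \<and> nmodule m b S}"
proof (intro equalityI subsetI)
  fix P assume "P \<in> umod_bips X R"
  then obtain U where U: "P = {U, X - U}" "umodule X R U" "U \<noteq> {}" "U \<noteq> X" by (auto simp: umod_bips_def)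
  have "U \<subseteq> X" using U by (simp add: umodule_def)
  \<comment> \<open>The side that avoids \<open>f m\<close>; it is a umodule whichever side was
    given.\<close>
  obtain V where V: "P = {V, X - V}" "umodule X R V" "V \<noteq> {}" "V \<subseteq> X" "f m \<notin> V"
  proof (cases "f m \<in> U")
    case True
    have "X - (X - U) = U" using \<open>U \<subseteq> X\<close> by auto
    then show thesis
      using that[of "X - U"] U umodule_Compl[OF tourn U(2)] True \<open>U \<subseteq> X\<close> by auto
  qed (use that U \<open>U \<subseteq> X\<close> in auto)
  define S where "S = {i. i < m \<and> f i \<in> V}"
  have "V = f ` S"
  proof (intro equalityI subsetI)
    fix x assume x: "x \<in> V"
    then obtain i where "i < Suc m" "x = f i" using V f_image by blast
    then show "x \<in> f ` S" using x V by (cases "i = m") (auto simp: S_def)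
  qed (auto simp: S_def)
  moreover have "S \<subseteq> {..<m}" by (auto simp: S_def)
  ultimately show "P \<in> {{f ` S, X - f ` S} | S. S \<noteq> {} \<and> nmodule m b S}"
    using V umodule_nmodule[of S] by blast
next
  fix P assume "P \<in> {{f ` S, X - f ` S} | S. S \<noteq> {} \<and> nmodule m b S}"
  then obtain S where S: "P = {f ` S, X - f ` S}" "S \<noteq> {}" "nmodule m b S" by blast
  then have sub: "S \<subseteq> {..<m}" by (simp add: nmodule_def)
  then have "f m \<notin> f ` S" using f_eq by force
  then have "f ` S \<noteq> X" using f_in by blast
  then show "P \<in> umod_bips X R"
    using S umodule_nmodule[OF sub] unfolding umod_bips_def by blast
qed

end

locale ordered_indexed_tournament = indexed_tournament + ordered_tournament m b
begin

lemma umod_bips_interval: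
  "umod_bips X R = {{f ` perm ` {i..j}, X - f ` perm ` {i..j}} | i j. interval_module i j}"
proof (intro equalityI subsetI)
  fix P assume "P \<in> umod_bips X R"
  then obtain S where S: "P = {f ` S, X - f ` S}" "S \<noteq> {}" "nmodule m b S"
    unfolding umod_bips_nmodule by blast
  obtain i j where "interval_module i j" "S = perm ` {i..j}" using nmodule_interval[OF S(3,2)] .
  with S show "P \<in> {{f ` perm ` {i..j}, X - f ` perm ` {i..j}} | i j. interval_module i j}" by blast
next
  fix P assume "P \<in> {{f ` perm ` {i..j}, X - f ` perm ` {i..j}} | i j. interval_module i j}"
  then obtain i j where "P = {f ` perm ` {i..j}, X - f ` perm ` {i..j}}" "interval_module i j" by blast
  moreover from this have "nmodule m b (perm ` {i..j})" "perm ` {i..j} \<noteq> {}"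
    by (auto simp: interval_module_def)
  ultimately show "P \<in> umod_bips X R" unfolding umod_bips_nmodule by blast
qed

lemma bij_f_perm: "bij_betw (\<lambda>i. f (perm i)) {..<m} (X - {f m})"
proof -
  have "perm ` {..<m} = {..<m}"
    using endo_inj_surj[of "{..<m}" perm] perm_less inj_perm by auto
  then have "bij_betw perm {..<m} {..<m}" using inj_perm by (simp add: bij_betw_def)
  moreover have "bij_betw f {..<m} (X - {f m})"
    unfolding bij_betw_def
  proof
    show "inj_on f {..<m}" using inj_f by (rule inj_on_subset) auto
    have "f ` {..<Suc m} = insert (f m) (f ` {..<m})" by (simp add: lessThan_Suc)
    moreover have "f m \<notin> f ` {..<m}" using f_eq by force
    ultimately show "f ` {..<m} = X - {f m}" using f_image by auto
  qed
  ultimately have "bij_betw (f \<circ> perm) {..<m} (X - {f m})" by (rule bij_betw_trans)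
  then show ?thesis by (simp add: comp_def)
qed

end

section \<open>The program\<close>

text \<open>All matrices keep the row length \<open>n\<close> of the input; the computed ones are
  filled in rows and columns below \<open>m = n - 1\<close>.\<close>

abbreviation idx :: "aexp \<Rightarrow> aexp \<Rightarrow> aexp" where
  "idx p q \<equiv> Add (Mul p (Var ''n'')) q"

abbreviation "Vi \<equiv> Var ''i''"
abbreviation "Vj \<equiv> Var ''j''"
abbreviation "C1 \<equiv> Const 1"

lemma idx_eq_iff:
  fixes n :: nat
  assumes "j < n" "j' < n"
  shows "i * n + j = i' * n + j' \<longleftrightarrow> i = i' \<and> j = j'"
proof
  assume e: "i * n + j = i' * n + j'"
  have "(i * n + j) div n = (i' * n + j') div n" "(i * n + j) mod n = (i' * n + j') mod n"
    by (simp_all only: e)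
  with assms show "i = i' \<and> j = j'" by simp
qed simp

definition arcs3 :: aexp where
  "arcs3 = Add (Add (Get ''arc'' (idx Vi Vj)) (Get ''arc'' (idx Vi (Var ''m''))))
     (Get ''arc'' (idx Vj (Var ''m'')))"

text \<open>There is no exclusive or among the operators; the parity of a sum of three bits,
  computed as \<open>e - 2 * (e div 2)\<close>, takes its place.\<close>

definition switch_cell :: prog where
  "switch_cell = PIf (BEq (Sub arcs3 (Mul (Const 2) (Div arcs3 (Const 2)))) C1)
     (PPut ''b'' (idx Vi Vj) C1) (PPut ''b'' (idx Vi Vj) (Const 0))"

definition switch_row :: prog where
  "switch_row = PFor ''j'' ''m''
     switch_cell"

definition switch_prog :: prog where
  "switch_prog = PFor ''i'' ''m'' switch_row"

lemma switch_mods [simp]: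
  "wv switch_cell = {}" "wa switch_cell = {''b''}"
  "wv switch_row = {''j''}" "wa switch_row = {''b''}"
  "wv switch_prog = {''i'', ''j''}" "wa switch_prog = {''b''}"
  by (simp_all add: switch_cell_def switch_row_def switch_prog_def)

lemma switch_row:
  assumes n: "var s ''n'' = n" and m: "var s ''m'' = m" "m < n" and i: "var s ''i'' = i"
    and arc: "\<And>i j. i < n \<Longrightarrow> j < n \<Longrightarrow> arr s ''arc'' (i * n + j) = of_bool (a i j)" and im: "i < m"
  shows "(\<forall>j<m. arr (ev switch_row s) ''b'' (i * n + j) = of_bool ((a i j \<noteq> a i m) \<noteq> a j m)) \<and>
    (\<forall>i' j. i' \<noteq> i \<longrightarrow> j < n \<longrightarrow> arr (ev switch_row s) ''b'' (i' * n + j) = arr s ''b'' (i' * n + j))"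
proof -
  define v :: "nat \<Rightarrow> nat" where "v j = of_bool ((a i j \<noteq> a i m) \<noteq> a j m)" for j
  define I where "I k t \<longleftrightarrow> (\<forall>j<k. arr t ''b'' (i * n + j) = v j) \<and>
    (\<forall>i' j. i' \<noteq> i \<longrightarrow> j < n \<longrightarrow> arr t ''b'' (i' * n + j) = arr s ''b'' (i' * n + j))"
    for k and t :: state
  have "I (var s ''m'') (ev switch_row s)" unfolding switch_row_def
  proof (rule ev_For_induct, goal_cases)
    case (5 k t)
    have [simp]: "var t ''n'' = n" "var t ''m'' = m" "var t ''i'' = i" "var t ''j'' = k"
      "arr t ''arc'' = arr s ''arc''"
      using 5(3-5) n m i by simp_all
    have k: "k < m" using 5 m by simp
    have "aval arcs3 t = of_bool (a i k) + of_bool (a i m) + of_bool (a k m)"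
      using k m im arc by (simp add: arcs3_def)
    then have c: "aval (Sub arcs3 (Mul (Const 2) (Div arcs3 (Const 2)))) t = v k"
      by (simp add: v_def)
    have "ev switch_cell t = seta ''b'' (i * n + k) (v k) t"
      unfolding switch_cell_def ev.simps bval.simps c by (simp add: v_def)
    then show ?case
      using 5(2) k m unfolding I_def by (auto simp: idx_eq_iff less_Suc_eq)
  qed (auto simp: I_def switch_cell_def)
  then show ?thesis
    by (simp add: I_def v_def m)
qed

lemma switch_prog:
  assumes n: "var s ''n'' = n" and m: "var s ''m'' = m" "m < n"
    and arc: "\<And>i j. i < n \<Longrightarrow> j < n \<Longrightarrow> arr s ''arc'' (i * n + j) = of_bool (a i j)"
  shows "\<forall>i<m. \<forall>j<m. arr (ev switch_prog s) ''b'' (i * n + j) = of_bool ((a i j \<noteq> a i m) \<noteq> a j m)"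
proof -
  define I where "I k t \<longleftrightarrow> (\<forall>i<k. \<forall>j<m. arr t ''b'' (i * n + j) = of_bool ((a i j \<noteq> a i m) \<noteq> a j m))"
    for k and t :: state
  have "I (var s ''m'') (ev switch_prog s)" unfolding switch_prog_def
  proof (rule ev_For_induct, goal_cases)
    case (5 k t)
    have "(\<forall>j<m. arr (ev switch_row t) ''b'' (k * n + j) = of_bool ((a k j \<noteq> a k m) \<noteq> a j m)) \<and>
      (\<forall>i' j. i' \<noteq> k \<longrightarrow> j < n \<longrightarrow> arr (ev switch_row t) ''b'' (i' * n + j) = arr t ''b'' (i' * n + j))"
      using 5 n m arc by (intro switch_row) simp_all
    with 5(2) m show ?case by (auto simp: I_def less_Suc_eq)
  qed (simp_all add: I_def)
  then show ?thesis by (simp add: I_def m)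
qed

definition in_test :: bexp where
  "in_test = BAnd (BEq (Get ''lab'' Vj) (Var ''l'')) (BEq (Get ''b'' (idx Vj Vi)) C1)"

definition count_row :: prog where
  "count_row = PFor ''j'' ''m''
     (PIf in_test
        (PAssign ''a'' (Add (Var ''a'') C1)) PSkip)"

definition refine_row :: prog where
  "refine_row = PFor ''j'' ''m''
     (PIf (BEq (Get ''lab'' Vj) (Var ''l''))
        (PIf (BEq Vj Vi) (PPut ''lab'' Vj (Var ''a''))
           (PIf (BEq (Get ''b'' (idx Vi Vj)) C1) (PPut ''lab'' Vj (Add (Var ''a'') C1)) PSkip)) PSkip)"

text \<open>The old label of the pivot is kept in \<open>l\<close>, since the refinement overwrites
  it on the way; \<open>a\<close> counts up from it to the new label of the pivot.\<close>

definition sort_step :: prog where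
  "sort_step = PSeq (PAssign ''a'' (Get ''lab'' Vi)) (PSeq (PAssign ''l'' (Get ''lab'' Vi))
     (PSeq count_row refine_row))"

definition sort_prog :: prog where
  "sort_prog = PFor ''i'' ''m''
     sort_step"

lemma sort_mods [simp]:
  "wv count_row = {''j'', ''a''}" "wa count_row = {}"
  "wv refine_row = {''j''}" "wa refine_row = {''lab''}"
  "wv sort_step = {''j'', ''a'', ''l''}" "wa sort_step = {''lab''}"
  "wv sort_prog = {''i'', ''j'', ''a'', ''l''}" "wa sort_prog = {''lab''}"
  by (auto simp: count_row_def refine_row_def sort_step_def sort_prog_def)

lemma count_row:
  assumes n: "var s ''n'' = n" and m: "var s ''m'' = m" and i: "var s ''i'' = i" "i < m"
    and b: "\<And>i j. i < m \<Longrightarrow> j < m \<Longrightarrow> (arr s ''b'' (i * n + j) = 1) = b i j"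
  shows "var (ev count_row s) ''a'' = var s ''a'' + card {u. u < m \<and> arr s ''lab'' u = var s ''l'' \<and> b u i}"
proof -
  define Q where "Q u \<longleftrightarrow> arr s ''lab'' u = var s ''l'' \<and> b u i" for u
  define I where "I k t \<longleftrightarrow> var t ''a'' = var s ''a'' + card {u. u < k \<and> Q u}" for k and t :: state
  have "I (var s ''m'') (ev count_row s)" unfolding count_row_def
  proof (rule ev_For_induct, goal_cases)
    case (5 k t)
    have [simp]: "var t ''n'' = n" "var t ''l'' = var s ''l''" "var t ''i'' = i" "var t ''j'' = k"
      "arr t ''lab'' = arr s ''lab''" "arr t ''b'' = arr s ''b''"
      using 5(3-5) n m i by simp_all
    have k: "k < m" using 5 m by simp
    have "{u. u < Suc k \<and> Q u} = (if Q k then insert k {u. u < k \<and> Q u} else {u. u < k \<and> Q u})"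
      by (auto simp: less_Suc_eq)
    then have "card {u. u < Suc k \<and> Q u} = card {u. u < k \<and> Q u} + of_bool (Q k)" by simp
    moreover have "bval in_test t \<longleftrightarrow> Q k"
      using b[of k i] k i by (simp add: in_test_def Q_def)
    ultimately show ?case using 5(2) by (simp only: I_def ev.simps) simp
  qed (simp_all add: I_def)
  then show ?thesis by (simp add: I_def m Q_def)
qed

lemma refine_row:
  assumes n: "var s ''n'' = n" and m: "var s ''m'' = m" and i: "var s ''i'' = i" "i < m"
    and b: "\<And>i j. i < m \<Longrightarrow> j < m \<Longrightarrow> (arr s ''b'' (i * n + j) = 1) = b i j"
  shows "\<forall>v<m. arr (ev refine_row s) ''lab'' v =
    (if arr s ''lab'' v = var s ''l'' then if v = i then var s ''a''
       else if b i v then Suc (var s ''a'') else arr s ''lab'' v else arr s ''lab'' v)"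
proof -
  define q where "q v = (if arr s ''lab'' v = var s ''l'' then if v = i then var s ''a''
       else if b i v then Suc (var s ''a'') else arr s ''lab'' v else arr s ''lab'' v)" for v
  define I where "I k t \<longleftrightarrow> (\<forall>v. arr t ''lab'' v = (if v < k then q v else arr s ''lab'' v))"
    for k and t :: state
  have "I (var s ''m'') (ev refine_row s)" unfolding refine_row_def
  proof (rule ev_For_induct, goal_cases)
    case (5 k t)
    have [simp]: "var t ''n'' = n" "var t ''l'' = var s ''l''" "var t ''a'' = var s ''a''"
      "var t ''i'' = i" "var t ''j'' = k" "arr t ''b'' = arr s ''b''"
      using 5(3-5) n m i by simp_all
    have k: "k < m" using 5 m by simp
    have l: "arr t ''lab'' k = arr s ''lab'' k" using 5(2) by (simp add: I_def)
    have "(arr s ''b'' (i * n + k) = 1) = b i k" using b i k by simp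
    then show ?case
      using 5(2) l unfolding I_def by (simp add: q_def less_Suc_eq)
  qed (simp_all add: I_def)
  then show ?thesis by (simp add: I_def m q_def)
qed

lemma sort_prog:
  assumes n: "var s ''n'' = n" and m: "var s ''m'' = m"
    and b: "\<And>i j. i < m \<Longrightarrow> j < m \<Longrightarrow> (arr s ''b'' (i * n + j) = 1) = b i j"
    and irr: "\<And>i. i < m \<Longrightarrow> \<not> b i i"
    and lab: "arr s ''lab'' = (\<lambda>_. 0)"
  shows "\<forall>v<m. arr (ev sort_prog s) ''lab'' v = qs_label m b m v"
proof -
  define I where "I k t \<longleftrightarrow> (\<forall>v<m. arr t ''lab'' v = qs_label m b k v)" for k and t :: state
  have "I (var s ''m'') (ev sort_prog s)" unfolding sort_prog_def
  proof (rule ev_For_induct, goal_cases)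
    case (5 k t)
    have vars: "var t ''n'' = n" "var t ''m'' = m" "var t ''i'' = k" "arr t ''b'' = arr s ''b''"
      using 5(3-5) n m by simp_all
    have k: "k < m" using 5 m by simp
    define l where "l = qs_label m b k"
    have l: "arr t ''lab'' v = l v" if "v < m" for v using 5(2) that by (simp add: I_def l_def)
    define t1 where "t1 = setv ''l'' (l k) (setv ''a'' (l k) t)"
    define t2 where "t2 = ev count_row t1"
    have "var t2 ''a'' = var t1 ''a'' + card {u. u < m \<and> arr t1 ''lab'' u = var t1 ''l'' \<and> b u k}"
      unfolding t2_def
      by (rule count_row[of _ n]) (use vars k b in \<open>simp_all add: t1_def\<close>)
    also have "{u. u < m \<and> arr t1 ''lab'' u = var t1 ''l'' \<and> b u k} = {u. u < m \<and> l u = l k \<and> b u k}"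
      using l by (auto simp: t1_def)
    finally have a: "var t2 ''a'' = l k + card {u. u < m \<and> l u = l k \<and> b u k}"
      by (simp add: t1_def)
    have t2: "var t2 ''l'' = l k" "arr t2 ''lab'' = arr t ''lab''" "arr t2 ''b'' = arr s ''b''"
      "var t2 ''n'' = n" "var t2 ''m'' = m" "var t2 ''i'' = k"
      using vars by (simp_all add: t2_def t1_def ev_var ev_arr)
    have "\<forall>v<m. arr (ev refine_row t2) ''lab'' v =
      (if arr t2 ''lab'' v = var t2 ''l'' then if v = k then var t2 ''a''
       else if b k v then Suc (var t2 ''a'') else arr t2 ''lab'' v else arr t2 ''lab'' v)"
      by (rule refine_row[of _ n]) (use t2 k b in simp_all)
    then have "\<forall>v<m. arr (ev refine_row t2) ''lab'' v = qs_step m b k l v"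
      using l by (simp add: t2 a qs_step_def)
    moreover have "ev sort_step t = ev refine_row t2"
      using l[OF k] vars by (simp add: sort_step_def t2_def t1_def)
    ultimately show ?case by (simp add: I_def l_def)
  qed (simp_all add: I_def lab)
  then show ?thesis by (simp add: I_def m)
qed

definition perm_prog :: prog where
  "perm_prog = PFor ''j'' ''m'' (PPut ''perm'' (Get ''lab'' Vj) Vj)"

lemma perm_mods [simp]: "wv perm_prog = {''j''}" "wa perm_prog = {''perm''}"
  by (simp_all add: perm_prog_def)

lemma perm_prog:
  assumes m: "var s ''m'' = m" and inj: "inj_on (arr s ''lab'') {..<m}"
  shows "\<forall>v<m. arr (ev perm_prog s) ''perm'' (arr s ''lab'' v) = v"
proof -
  define I where "I k t \<longleftrightarrow> (\<forall>v<k. arr t ''perm'' (arr s ''lab'' v) = v)" for k and t :: state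
  have "I (var s ''m'') (ev perm_prog s)" unfolding perm_prog_def
  proof (rule ev_For_induct, goal_cases)
    case (5 k t)
    have "arr s ''lab'' v \<noteq> arr s ''lab'' k" if "v < k" for v
      using that 5(1) m inj by (auto simp: inj_on_def)
    then show ?case using 5 by (simp add: I_def less_Suc_eq)
  qed (simp_all add: I_def)
  then show ?thesis by (simp add: I_def m)
qed

section \<open>Interval modules from extreme separators\<close>

definition separated :: bexp where
  "separated = BAnd (BNot (BEq Vj Vi)) (BAnd (BNot (BEq Vj (Add Vi C1)))
     (BNot (BEq (Get ''b'' (idx (Get ''perm'' Vj) (Get ''perm'' Vi)))
        (Get ''b'' (idx (Get ''perm'' Vj) (Get ''perm'' (Add Vi C1)))))))"

definition split_cell :: prog where
  "split_cell = PIf separated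
     (PSeq (PIf (BLess Vj (Get ''lo'' Vi)) (PPut ''lo'' Vi Vj) PSkip)
       (PIf (BLess (Get ''hi'' Vi) Vj) (PPut ''hi'' Vi Vj) PSkip)) PSkip"

definition split_row :: prog where
  "split_row = PFor ''j'' ''m'' split_cell"

text \<open>The defaults \<open>i\<close> and \<open>i + 1\<close> stand for a pair without
  separators: every interval that contains the pair passes the tests on \<open>lo\<close> and
  \<open>hi\<close>.\<close>

definition split_step :: prog where
  "split_step = PSeq (PPut ''lo'' Vi Vi) (PSeq (PPut ''hi'' Vi (Add Vi C1)) split_row)"

definition split_prog :: prog where
  "split_prog = PFor ''i'' ''m'' split_step"

lemma split_mods [simp]:
  "wv split_cell = {}" "wa split_cell = {''lo'', ''hi''}"
  "wv split_row = {''j''}" "wa split_row = {''lo'', ''hi''}"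
  "wv split_step = {''j''}" "wa split_step = {''lo'', ''hi''}"
  "wv split_prog = {''i'', ''j''}" "wa split_prog = {''lo'', ''hi''}"
  by (auto simp: split_cell_def split_row_def split_step_def split_prog_def)

text \<open>\<open>c\<close> is meant to be the raw content of memory, so that the loop is specified
  also at the last position, where \<open>Suc k\<close> is out of range. The tests for modules
  consult pairs inside an interval only.\<close>

definition splits :: "(nat \<Rightarrow> nat \<Rightarrow> nat) \<Rightarrow> nat \<Rightarrow> nat \<Rightarrow> bool" where
  "splits c x k \<longleftrightarrow> x \<noteq> k \<and> x \<noteq> Suc k \<and> c x k \<noteq> c x (Suc k)"

text \<open>\<open>lo\<close> and \<open>hi\<close> are described by the thresholds they respect,
  not as \<open>Min\<close> and \<open>Max\<close>. This fits an update by one separator and is the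
  form in which the interval test uses them.\<close>

lemma split_row:
  assumes m: "var s ''m'' = m" and i: "var s ''i'' = i"
    and c: "\<And>x y. c x y = arr s ''b'' (arr s ''perm'' x * var s ''n'' + arr s ''perm'' y)"
    and lo: "arr s ''lo'' i = i" and hi: "arr s ''hi'' i = Suc i"
  shows "(\<forall>t. arr (ev split_row s) ''lo'' i < t \<longleftrightarrow> i < t \<or> (\<exists>x<m. splits c x i \<and> x < t)) \<and>
    (\<forall>t. arr (ev split_row s) ''hi'' i \<le> t \<longleftrightarrow> Suc i \<le> t \<and> (\<forall>x<m. splits c x i \<longrightarrow> x \<le> t)) \<and>
    (\<forall>k. k \<noteq> i \<longrightarrow> arr (ev split_row s) ''lo'' k = arr s ''lo'' k \<and> arr (ev split_row s) ''hi'' k = arr s ''hi'' k)"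
proof -
  define I where "I q u \<longleftrightarrow> (\<forall>t. arr u ''lo'' i < t \<longleftrightarrow> i < t \<or> (\<exists>x<q. splits c x i \<and> x < t)) \<and>
    (\<forall>t. arr u ''hi'' i \<le> t \<longleftrightarrow> Suc i \<le> t \<and> (\<forall>x<q. splits c x i \<longrightarrow> x \<le> t)) \<and>
    (\<forall>k. k \<noteq> i \<longrightarrow> arr u ''lo'' k = arr s ''lo'' k \<and> arr u ''hi'' k = arr s ''hi'' k)"
    for q and u :: state
  have "I (var s ''m'') (ev split_row s)" unfolding split_row_def
  proof (rule ev_For_induct, goal_cases)
    case (5 q u)
    have [simp]: "var u ''n'' = var s ''n''" "var u ''i'' = i" "var u ''j'' = q"
      "arr u ''b'' = arr s ''b''" "arr u ''perm'' = arr s ''perm''"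
      using 5(3-5) i by simp_all
    have sep: "bval separated u \<longleftrightarrow> splits c q i"
      by (simp add: separated_def splits_def c)
    have lo: "\<And>t. arr u ''lo'' i < t \<longleftrightarrow> i < t \<or> (\<exists>x<q. splits c x i \<and> x < t)"
      and hi: "\<And>t. arr u ''hi'' i \<le> t \<longleftrightarrow> Suc i \<le> t \<and> (\<forall>x<q. splits c x i \<longrightarrow> x \<le> t)"
      and other: "\<And>k. k \<noteq> i \<Longrightarrow> arr u ''lo'' k = arr s ''lo'' k \<and> arr u ''hi'' k = arr s ''hi'' k"
      using 5(2) by (auto simp: I_def)
    let ?u = "setv ''j'' (Suc q) (ev split_cell u)"
    have lo': "arr ?u ''lo'' i = (if splits c q i then min (arr u ''lo'' i) q else arr u ''lo'' i)"
      and hi': "arr ?u ''hi'' i = (if splits c q i then max (arr u ''hi'' i) q else arr u ''hi'' i)"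
      and other': "\<And>k. k \<noteq> i \<Longrightarrow> arr ?u ''lo'' k = arr u ''lo'' k \<and> arr ?u ''hi'' k = arr u ''hi'' k"
      by (auto simp: split_cell_def sep)
    have "arr ?u ''lo'' i < t \<longleftrightarrow> i < t \<or> (\<exists>x<Suc q. splits c x i \<and> x < t)" for t
      unfolding lo' less_Suc_eq using lo[of t] by (auto simp: min_less_iff_disj)
    moreover have "arr ?u ''hi'' i \<le> t \<longleftrightarrow> Suc i \<le> t \<and> (\<forall>x<Suc q. splits c x i \<longrightarrow> x \<le> t)" for t
      unfolding hi' less_Suc_eq using hi[of t] by auto
    ultimately show ?case unfolding I_def using other other' by simp
  qed (auto simp: I_def lo hi)
  then show ?thesis by (simp add: I_def m)
qed

lemma split_prog:
  assumes m: "var s ''m'' = m"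
    and c: "\<And>x y. c x y = arr s ''b'' (arr s ''perm'' x * var s ''n'' + arr s ''perm'' y)"
  shows "\<forall>i<m. (\<forall>t. arr (ev split_prog s) ''lo'' i < t \<longleftrightarrow> i < t \<or> (\<exists>x<m. splits c x i \<and> x < t)) \<and>
    (\<forall>t. arr (ev split_prog s) ''hi'' i \<le> t \<longleftrightarrow> Suc i \<le> t \<and> (\<forall>x<m. splits c x i \<longrightarrow> x \<le> t))"
proof -
  define P where "P u i \<longleftrightarrow> (\<forall>t. arr u ''lo'' i < t \<longleftrightarrow> i < t \<or> (\<exists>x<m. splits c x i \<and> x < t)) \<and>
    (\<forall>t. arr u ''hi'' i \<le> t \<longleftrightarrow> Suc i \<le> t \<and> (\<forall>x<m. splits c x i \<longrightarrow> x \<le> t))" for u :: state and i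
  define I where "I k u \<longleftrightarrow> (\<forall>i<k. P u i)" for k and u :: state
  have "I (var s ''m'') (ev split_prog s)" unfolding split_prog_def
  proof (rule ev_For_induct, goal_cases)
    case (5 k u)
    define v where "v = seta ''hi'' k (Suc k) (seta ''lo'' k k u)"
    have "ev split_step u = ev split_row v"
      using 5(3) by (simp add: split_step_def v_def)
    moreover have "(\<forall>t. arr (ev split_row v) ''lo'' k < t \<longleftrightarrow> k < t \<or> (\<exists>x<m. splits c x k \<and> x < t)) \<and>
      (\<forall>t. arr (ev split_row v) ''hi'' k \<le> t \<longleftrightarrow> Suc k \<le> t \<and> (\<forall>x<m. splits c x k \<longrightarrow> x \<le> t)) \<and>
      (\<forall>i. i \<noteq> k \<longrightarrow> arr (ev split_row v) ''lo'' i = arr v ''lo'' i \<and> arr (ev split_row v) ''hi'' i = arr v ''hi'' i)"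
      by (rule split_row) (use 5 m c in \<open>simp_all add: v_def\<close>)
    ultimately show ?case using 5(2) by (simp add: I_def P_def less_Suc_eq v_def)
  qed (simp_all add: I_def)
  then show ?thesis by (simp add: I_def P_def m)
qed

text \<open>For a position \<open>j\<close>, \<open>near j\<close> is one more than the least start of a module ending at \<open>j\<close>, since
  \<open>0\<close> marks an unset entry.\<close>

definition module_cell :: prog where
  "module_cell = PIf (BNot (BLess Vj Vi)) (PSeq
     (PIf (BAnd (BEq (Var ''ok'') C1) (BNot (BLess Vj (Var ''h''))))
       (PSeq (PPut ''md'' (idx Vi Vj) C1) (PSeq (PPut ''far'' Vi Vj)
          (PIf (BEq (Get ''near'' Vj) (Const 0)) (PPut ''near'' Vj (Add Vi C1)) PSkip)))
       (PPut ''md'' (idx Vi Vj) (Const 0)))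
     (PSeq (PIf (BLess (Get ''lo'' Vj) Vi) (PAssign ''ok'' (Const 0)) PSkip)
       (PIf (BLess (Var ''h'') (Get ''hi'' Vj)) (PAssign ''h'' (Get ''hi'' Vj)) PSkip))) PSkip"

definition module_row :: prog where
  "module_row = PFor ''j'' ''m'' module_cell"

definition module_step :: prog where
  "module_step = PSeq (PAssign ''ok'' C1) (PSeq (PAssign ''h'' (Const 0))
     (PSeq (PPut ''far'' Vi (Const 0)) module_row))"

definition module_prog :: prog where
  "module_prog = PFor ''i'' ''m'' module_step"

lemma module_mods [simp]:
  "wv module_cell = {''ok'', ''h''}" "wa module_cell = {''md'', ''far'', ''near''}"
  "wv module_row = {''j'', ''ok'', ''h''}" "wa module_row = {''md'', ''far'', ''near''}"
  "wv module_step = {''j'', ''ok'', ''h''}" "wa module_step = {''md'', ''far'', ''near''}"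
  "wv module_prog = {''i'', ''j'', ''ok'', ''h''}" "wa module_prog = {''md'', ''far'', ''near''}"
  by (auto simp: module_cell_def module_row_def module_step_def module_prog_def)

text \<open>The local form of being a module: a position outside that compares equally with any two
  consecutive positions of the interval compares equally with all of them.\<close>

definition unsplit :: "(nat \<Rightarrow> nat) \<Rightarrow> (nat \<Rightarrow> nat) \<Rightarrow> nat \<Rightarrow> nat \<Rightarrow> bool" where
  "unsplit lo hi i j \<longleftrightarrow> (\<forall>k. i \<le> k \<and> k < j \<longrightarrow> i \<le> lo k \<and> hi k \<le> j)"

text \<open>As \<open>j\<close> grows, \<open>ok\<close> records that no separator to the left of
  \<open>i\<close> has been met, and \<open>h\<close> is the farthest separator to the right. The
  cell first decides about \<open>{i..j}\<close> and only then takes in the pair of \<open>j\<close>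
  and \<open>j + 1\<close>.\<close>

lemma module_row:
  assumes n: "var s ''n'' = n" and m: "var s ''m'' = m" "m < n" and i: "var s ''i'' = i" "i < m"
    and lo: "arr s ''lo'' = lo" and hi: "arr s ''hi'' = hi"
    and init: "var s ''ok'' = 1" "var s ''h'' = 0" "arr s ''far'' i = 0"
  shows "(\<forall>j<m. i \<le> j \<longrightarrow> (arr (ev module_row s) ''md'' (i * n + j) = 1) = unsplit lo hi i j) \<and>
    (\<forall>i' j. i' \<noteq> i \<longrightarrow> j < n \<longrightarrow> arr (ev module_row s) ''md'' (i' * n + j) = arr s ''md'' (i' * n + j)) \<and>
    (\<forall>t. arr (ev module_row s) ''far'' i \<le> t \<longleftrightarrow> (\<forall>j<m. i \<le> j \<and> unsplit lo hi i j \<longrightarrow> j \<le> t)) \<and>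
    (\<forall>i'. i' \<noteq> i \<longrightarrow> arr (ev module_row s) ''far'' i' = arr s ''far'' i') \<and>
    (\<forall>j<m. arr (ev module_row s) ''near'' j =
       (if i \<le> j \<and> arr s ''near'' j = 0 \<and> unsplit lo hi i j then Suc i else arr s ''near'' j))"
proof -
  let ?U = "unsplit lo hi i"
  define I where "I q u \<longleftrightarrow>
    (\<forall>j<q. i \<le> j \<longrightarrow> (arr u ''md'' (i * n + j) = 1) = ?U j) \<and>
    (\<forall>i' j. i' \<noteq> i \<longrightarrow> j < n \<longrightarrow> arr u ''md'' (i' * n + j) = arr s ''md'' (i' * n + j)) \<and>
    (\<forall>t. arr u ''far'' i \<le> t \<longleftrightarrow> (\<forall>j<q. i \<le> j \<and> ?U j \<longrightarrow> j \<le> t)) \<and>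
    (\<forall>i'. i' \<noteq> i \<longrightarrow> arr u ''far'' i' = arr s ''far'' i') \<and>
    (\<forall>j. arr u ''near'' j =
       (if j < q \<and> i \<le> j \<and> arr s ''near'' j = 0 \<and> ?U j then Suc i else arr s ''near'' j)) \<and>
    ((var u ''ok'' = 1) = (\<forall>k. i \<le> k \<and> k < q \<longrightarrow> i \<le> lo k)) \<and>
    (\<forall>t. var u ''h'' \<le> t \<longleftrightarrow> (\<forall>k. i \<le> k \<and> k < q \<longrightarrow> hi k \<le> t))"
    for q and u :: state
  have "I (var s ''m'') (ev module_row s)" unfolding module_row_def
  proof (rule ev_For_induct, goal_cases)
    case (5 q u)
    have [simp]: "var u ''n'' = n" "var u ''i'' = i" "var u ''j'' = q"
      "arr u ''lo'' = lo" "arr u ''hi'' = hi"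
      using 5(3-5) i n lo hi by simp_all
    have q: "q < m" "q < n" using 5 m by simp_all
    have md: "\<And>j. j < q \<Longrightarrow> i \<le> j \<Longrightarrow> (arr u ''md'' (i * n + j) = 1) = ?U j"
      "\<And>i' j. i' \<noteq> i \<Longrightarrow> j < n \<Longrightarrow> arr u ''md'' (i' * n + j) = arr s ''md'' (i' * n + j)"
      and far: "\<And>t. arr u ''far'' i \<le> t \<longleftrightarrow> (\<forall>j<q. i \<le> j \<and> ?U j \<longrightarrow> j \<le> t)"
      "\<And>i'. i' \<noteq> i \<Longrightarrow> arr u ''far'' i' = arr s ''far'' i'"
      and near: "\<And>j. arr u ''near'' j =
        (if j < q \<and> i \<le> j \<and> arr s ''near'' j = 0 \<and> ?U j then Suc i else arr s ''near'' j)"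
      and ok: "(var u ''ok'' = 1) = (\<forall>k. i \<le> k \<and> k < q \<longrightarrow> i \<le> lo k)"
      and h: "\<And>t. var u ''h'' \<le> t \<longleftrightarrow> (\<forall>k. i \<le> k \<and> k < q \<longrightarrow> hi k \<le> t)"
      using 5(2) by (auto simp: I_def)
    let ?u = "setv ''j'' (Suc q) (ev module_cell u)"
    show ?case
    proof (cases "i \<le> q")
      case False
      then have "?u = setv ''j'' (Suc q) u" by (simp add: module_cell_def)
      then show ?thesis using 5(2) False by (auto simp: I_def less_Suc_eq)
    next
      case True
      have U: "var u ''ok'' = 1 \<and> var u ''h'' \<le> q \<longleftrightarrow> ?U q"
        unfolding ok h unsplit_def by blast
      have md': "arr ?u ''md'' = (arr u ''md'')(i * n + q := of_bool (?U q))"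
        and far': "arr ?u ''far'' = (if ?U q then (arr u ''far'')(i := q) else arr u ''far'')"
        and near': "arr ?u ''near'' = (if ?U q \<and> arr u ''near'' q = 0 then (arr u ''near'')(q := Suc i) else arr u ''near'')"
        and ok': "(var ?u ''ok'' = 1) = (var u ''ok'' = 1 \<and> i \<le> lo q)"
        and h': "var ?u ''h'' = max (var u ''h'') (hi q)"
        using True by (auto simp: module_cell_def U[symmetric])
      have "(\<forall>j<Suc q. i \<le> j \<longrightarrow> (arr ?u ''md'' (i * n + j) = 1) = ?U j)"
        unfolding md' using md(1) q by (auto simp: less_Suc_eq)
      moreover have "\<forall>i' j. i' \<noteq> i \<longrightarrow> j < n \<longrightarrow> arr ?u ''md'' (i' * n + j) = arr s ''md'' (i' * n + j)"
        unfolding md' using md(2) q by (simp add: idx_eq_iff)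
      moreover have "\<forall>t. arr ?u ''far'' i \<le> t \<longleftrightarrow> (\<forall>j<Suc q. i \<le> j \<and> ?U j \<longrightarrow> j \<le> t)"
        unfolding far' less_Suc_eq using far(1) True by (auto intro: less_imp_le order_trans)
      moreover have "\<forall>i'. i' \<noteq> i \<longrightarrow> arr ?u ''far'' i' = arr s ''far'' i'"
        unfolding far' using far(2) by simp
      moreover have "\<forall>j. arr ?u ''near'' j =
        (if j < Suc q \<and> i \<le> j \<and> arr s ''near'' j = 0 \<and> ?U j then Suc i else arr s ''near'' j)"
        unfolding near' using near True by (auto simp: less_Suc_eq)
      moreover have "(var ?u ''ok'' = 1) = (\<forall>k. i \<le> k \<and> k < Suc q \<longrightarrow> i \<le> lo k)"
        unfolding ok' ok less_Suc_eq using True by auto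
      moreover have "\<forall>t. var ?u ''h'' \<le> t \<longleftrightarrow> (\<forall>k. i \<le> k \<and> k < Suc q \<longrightarrow> hi k \<le> t)"
        unfolding h' less_Suc_eq using h True by auto
      ultimately show ?thesis unfolding I_def by blast
    qed
  qed (simp_all add: I_def init)
  then show ?thesis unfolding I_def m by simp
qed

lemma unsplit_refl: "unsplit lo hi j j"
  by (simp add: unsplit_def)

text \<open>Starts are tried in increasing order, so the first to write \<open>near j\<close> is the
  least. Every entry gets written, at the latest by the singleton at \<open>j\<close>.\<close>

lemma module_prog:
  assumes n: "var s ''n'' = n" and m: "var s ''m'' = m" "m < n"
    and lo: "arr s ''lo'' = lo" and hi: "arr s ''hi'' = hi"
    and near: "arr s ''near'' = (\<lambda>_. 0)"
  shows "(\<forall>i j. i \<le> j \<longrightarrow> j < m \<longrightarrow> (arr (ev module_prog s) ''md'' (i * n + j) = 1) = unsplit lo hi i j)"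
    "(\<forall>i<m. \<forall>t. arr (ev module_prog s) ''far'' i \<le> t \<longleftrightarrow> (\<forall>j<m. i \<le> j \<and> unsplit lo hi i j \<longrightarrow> j \<le> t))"
    "(\<forall>j<m. \<forall>t. arr (ev module_prog s) ''near'' j \<le> t \<longleftrightarrow> (\<exists>i<t. i \<le> j \<and> unsplit lo hi i j))"
proof -
  let ?U = "unsplit lo hi"
  define I where "I q u \<longleftrightarrow>
    (\<forall>i<q. \<forall>j<m. i \<le> j \<longrightarrow> (arr u ''md'' (i * n + j) = 1) = ?U i j) \<and>
    (\<forall>i<q. \<forall>t. arr u ''far'' i \<le> t \<longleftrightarrow> (\<forall>j<m. i \<le> j \<and> ?U i j \<longrightarrow> j \<le> t)) \<and>
    (\<forall>j<m. if arr u ''near'' j = 0 then \<not> (\<exists>i<q. i \<le> j \<and> ?U i j)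
      else \<forall>t. arr u ''near'' j \<le> t \<longleftrightarrow> (\<exists>i<t. i \<le> j \<and> ?U i j))" for q and u :: state
  have "I (var s ''m'') (ev module_prog s)" unfolding module_prog_def
  proof (rule ev_For_induct, goal_cases)
    case (5 q u)
    define v where "v = seta ''far'' q 0 (setv ''h'' 0 (setv ''ok'' 1 u))"
    have e: "ev module_step u = ev module_row v"
      using 5(3) by (simp add: module_step_def v_def)
    have row: "(\<forall>j<m. q \<le> j \<longrightarrow> (arr (ev module_row v) ''md'' (q * n + j) = 1) = ?U q j) \<and>
      (\<forall>i' j. i' \<noteq> q \<longrightarrow> j < n \<longrightarrow> arr (ev module_row v) ''md'' (i' * n + j) = arr v ''md'' (i' * n + j)) \<and>
      (\<forall>t. arr (ev module_row v) ''far'' q \<le> t \<longleftrightarrow> (\<forall>j<m. q \<le> j \<and> ?U q j \<longrightarrow> j \<le> t)) \<and>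
      (\<forall>i'. i' \<noteq> q \<longrightarrow> arr (ev module_row v) ''far'' i' = arr v ''far'' i') \<and>
      (\<forall>j<m. arr (ev module_row v) ''near'' j =
       (if q \<le> j \<and> arr v ''near'' j = 0 \<and> ?U q j then Suc q else arr v ''near'' j))"
      by (rule module_row) (use 5 n m lo hi in \<open>simp_all add: v_def\<close>)
    have near': "if arr (ev module_row v) ''near'' j = 0 then \<not> (\<exists>i<Suc q. i \<le> j \<and> ?U i j)
      else \<forall>t. arr (ev module_row v) ''near'' j \<le> t \<longleftrightarrow> (\<exists>i<t. i \<le> j \<and> ?U i j)" if j: "j < m" for j
    proof -
      have r: "arr (ev module_row v) ''near'' j =
         (if q \<le> j \<and> arr u ''near'' j = 0 \<and> ?U q j then Suc q else arr u ''near'' j)"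
        using row j by (simp add: v_def)
      have old: "if arr u ''near'' j = 0 then \<not> (\<exists>i<q. i \<le> j \<and> ?U i j)
        else \<forall>t. arr u ''near'' j \<le> t \<longleftrightarrow> (\<exists>i<t. i \<le> j \<and> ?U i j)"
        using 5(2) j by (simp add: I_def)
      show ?thesis
      proof (cases "q \<le> j \<and> arr u ''near'' j = 0 \<and> ?U q j")
        case True
        then have "Suc q \<le> t \<longleftrightarrow> (\<exists>i<t. i \<le> j \<and> ?U i j)" for t
          using old by (metis Suc_le_eq linorder_neqE_nat order.strict_trans)
        with True r show ?thesis by simp
      next
        case False
        with old r show ?thesis by (auto simp: less_Suc_eq)
      qed
    qed
    have old: "\<And>i j. i < q \<Longrightarrow> j < m \<Longrightarrow> i \<le> j \<Longrightarrow> (arr u ''md'' (i * n + j) = 1) = ?U i j"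
      "\<And>i t. i < q \<Longrightarrow> arr u ''far'' i \<le> t \<longleftrightarrow> (\<forall>j<m. i \<le> j \<and> ?U i j \<longrightarrow> j \<le> t)"
      using 5(2) by (simp_all add: I_def)
    have "(arr (ev module_row v) ''md'' (i * n + j) = 1) = ?U i j"
      if "i < Suc q" "j < m" "i \<le> j" for i j
      using row old(1)[of i j] that m by (cases "i = q") (simp_all add: v_def)
    moreover have "arr (ev module_row v) ''far'' i \<le> t \<longleftrightarrow> (\<forall>j<m. i \<le> j \<and> ?U i j \<longrightarrow> j \<le> t)"
      if "i < Suc q" for i t
    proof (cases "i = q")
      case True
      then show ?thesis using row by blast
    next
      case False
      then have "arr (ev module_row v) ''far'' i = arr u ''far'' i" using row by (simp add: v_def)
      then show ?thesis using old(2)[of i t] that False by simp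
    qed
    ultimately show ?case unfolding e I_def setv_sel using near' by blast
  qed (simp_all add: I_def near)
  then have I: "I m (ev module_prog s)" by (simp add: m)
  then show "(\<forall>i j. i \<le> j \<longrightarrow> j < m \<longrightarrow> (arr (ev module_prog s) ''md'' (i * n + j) = 1) = ?U i j)"
    "(\<forall>i<m. \<forall>t. arr (ev module_prog s) ''far'' i \<le> t \<longleftrightarrow> (\<forall>j<m. i \<le> j \<and> ?U i j \<longrightarrow> j \<le> t))"
    by (auto simp: I_def)
  have "arr (ev module_prog s) ''near'' j \<noteq> 0" if "j < m" for j
    using I that unsplit_refl[of lo hi j] unfolding I_def by (metis order_refl)
  with I show "(\<forall>j<m. \<forall>t. arr (ev module_prog s) ''near'' j \<le> t \<longleftrightarrow> (\<exists>i<t. i \<le> j \<and> ?U i j))"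
    unfolding I_def by simp
qed

section \<open>Selection of the strong intervals\<close>

definition strong_cell :: prog where
  "strong_cell = PIf (BNot (BLess Vj Vi)) (PSeq
     (PIf (BAnd (BLess Vi Vj) (BLess (Var ''h'') (Get ''far'' Vj))) (PAssign ''h'' (Get ''far'' Vj)) PSkip)
     (PSeq (PIf (BAnd (BEq (Get ''md'' (idx Vi Vj)) C1) (BAnd (BNot (BLess Vj (Var ''h''))) (BEq (Var ''ok'') C1)))
         (PPut ''str'' (idx Vi Vj) C1) (PPut ''str'' (idx Vi Vj) (Const 0)))
       (PIf (BNot (BLess Vi (Get ''near'' Vj))) (PAssign ''ok'' (Const 0)) PSkip))) PSkip"

definition strong_row :: prog where
  "strong_row = PFor ''j'' ''m'' strong_cell"

definition strong_step :: prog where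
  "strong_step = PSeq (PAssign ''ok'' C1) (PSeq (PAssign ''h'' (Const 0)) strong_row)"

definition strong_prog :: prog where
  "strong_prog = PFor ''i'' ''m'' strong_step"

lemma strong_mods [simp]:
  "wv strong_cell = {''ok'', ''h''}" "wa strong_cell = {''str''}"
  "wv strong_row = {''j'', ''ok'', ''h''}" "wa strong_row = {''str''}"
  "wv strong_step = {''j'', ''ok'', ''h''}" "wa strong_step = {''str''}"
  "wv strong_prog = {''i'', ''j'', ''ok'', ''h''}" "wa strong_prog = {''str''}"
  by (auto simp: strong_cell_def strong_row_def strong_step_def strong_prog_def)

text \<open>Since \<open>near\<close> is shifted by one, \<open>i < near k\<close> says that no
  module ending at \<open>k\<close> starts before \<open>i\<close>. The first range includes
  \<open>j\<close> and the second does not; accordingly \<open>strong_cell\<close> updates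
  \<open>h\<close> before its test and \<open>ok\<close> after it.\<close>

definition unoverlapped :: "(nat \<Rightarrow> nat) \<Rightarrow> (nat \<Rightarrow> nat) \<Rightarrow> nat \<Rightarrow> nat \<Rightarrow> bool" where
  "unoverlapped far near i j \<longleftrightarrow>
     (\<forall>k. i < k \<and> k \<le> j \<longrightarrow> far k \<le> j) \<and> (\<forall>k. i \<le> k \<and> k < j \<longrightarrow> i < near k)"

lemma strong_row:
  assumes n: "var s ''n'' = n" and m: "var s ''m'' = m" "m < n" and i: "var s ''i'' = i" "i < m"
    and far: "arr s ''far'' = far" and near: "arr s ''near'' = near"
    and md: "\<And>i j. i \<le> j \<Longrightarrow> j < m \<Longrightarrow> (arr s ''md'' (i * n + j) = 1) = M i j"
    and init: "var s ''ok'' = 1" "var s ''h'' = 0"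
  shows "(\<forall>j<m. i \<le> j \<longrightarrow> (arr (ev strong_row s) ''str'' (i * n + j) = 1) = (M i j \<and> unoverlapped far near i j)) \<and>
    (\<forall>i' j. i' \<noteq> i \<longrightarrow> j < n \<longrightarrow> arr (ev strong_row s) ''str'' (i' * n + j) = arr s ''str'' (i' * n + j))"
proof -
  let ?U = "unoverlapped far near i"
  define I where "I q u \<longleftrightarrow>
    (\<forall>j<q. i \<le> j \<longrightarrow> (arr u ''str'' (i * n + j) = 1) = (M i j \<and> ?U j)) \<and>
    (\<forall>i' j. i' \<noteq> i \<longrightarrow> j < n \<longrightarrow> arr u ''str'' (i' * n + j) = arr s ''str'' (i' * n + j)) \<and>
    ((var u ''ok'' = 1) = (\<forall>k. i \<le> k \<and> k < q \<longrightarrow> i < near k)) \<and>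
    (\<forall>t. var u ''h'' \<le> t \<longleftrightarrow> (\<forall>k. i < k \<and> k < q \<longrightarrow> far k \<le> t))"
    for q and u :: state
  have "I (var s ''m'') (ev strong_row s)" unfolding strong_row_def
  proof (rule ev_For_induct, goal_cases)
    case (5 q u)
    have [simp]: "var u ''n'' = n" "var u ''i'' = i" "var u ''j'' = q"
      "arr u ''far'' = far" "arr u ''near'' = near" "arr u ''md'' = arr s ''md''"
      using 5(3-5) i n far near by simp_all
    have q: "q < m" "q < n" using 5 m by simp_all
    have str: "\<And>j. j < q \<Longrightarrow> i \<le> j \<Longrightarrow> (arr u ''str'' (i * n + j) = 1) = (M i j \<and> ?U j)"
      "\<And>i' j. i' \<noteq> i \<Longrightarrow> j < n \<Longrightarrow> arr u ''str'' (i' * n + j) = arr s ''str'' (i' * n + j)"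
      and ok: "(var u ''ok'' = 1) = (\<forall>k. i \<le> k \<and> k < q \<longrightarrow> i < near k)"
      and h: "\<And>t. var u ''h'' \<le> t \<longleftrightarrow> (\<forall>k. i < k \<and> k < q \<longrightarrow> far k \<le> t)"
      using 5(2) by (auto simp: I_def)
    let ?u = "setv ''j'' (Suc q) (ev strong_cell u)"
    show ?case
    proof (cases "i \<le> q")
      case False
      then have "?u = setv ''j'' (Suc q) u" by (simp add: strong_cell_def)
      then show ?thesis using 5(2) False by (auto simp: I_def less_Suc_eq)
    next
      case True
      define h' where "h' = (if i < q then max (var u ''h'') (far q) else var u ''h'')"
      have h'_le: "h' \<le> t \<longleftrightarrow> (\<forall>k. i < k \<and> k < Suc q \<longrightarrow> far k \<le> t)" for t
        using h[of t] by (auto simp: h'_def less_Suc_eq)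
      have U: "(arr s ''md'' (i * n + q) = 1 \<and> h' \<le> q \<and> var u ''ok'' = 1) \<longleftrightarrow> M i q \<and> ?U q"
        unfolding ok h'_le unoverlapped_def less_Suc_eq_le using md[OF True q(1)] by blast
      have h_eq: "var ?u ''h'' = h'" using True by (auto simp: strong_cell_def h'_def)
      have ok': "(var ?u ''ok'' = 1) = (var u ''ok'' = 1 \<and> i < near q)" using True by (auto simp: strong_cell_def)
      have str': "arr ?u ''str'' = (arr u ''str'')(i * n + q := of_bool (M i q \<and> ?U q))"
        unfolding U[symmetric] using True by (auto simp: strong_cell_def h'_def)
      have "(\<forall>j<Suc q. i \<le> j \<longrightarrow> (arr ?u ''str'' (i * n + j) = 1) = (M i j \<and> ?U j))"
        unfolding str' using str(1) q by (auto simp: less_Suc_eq)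
      moreover have "\<forall>i' j. i' \<noteq> i \<longrightarrow> j < n \<longrightarrow> arr ?u ''str'' (i' * n + j) = arr s ''str'' (i' * n + j)"
        unfolding str' using str(2) q by (simp add: idx_eq_iff)
      moreover have "(var ?u ''ok'' = 1) = (\<forall>k. i \<le> k \<and> k < Suc q \<longrightarrow> i < near k)"
        unfolding ok' ok less_Suc_eq using True by auto
      ultimately show ?thesis unfolding I_def h_eq h'_le by blast
    qed
  qed (simp_all add: I_def init)
  then show ?thesis unfolding I_def m by simp
qed

lemma strong_prog:
  assumes n: "var s ''n'' = n" and m: "var s ''m'' = m" "m < n"
    and far: "arr s ''far'' = far" and near: "arr s ''near'' = near"
    and md: "\<And>i j. i \<le> j \<Longrightarrow> j < m \<Longrightarrow> (arr s ''md'' (i * n + j) = 1) = M i j"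
  shows "\<forall>i<m. \<forall>j<m. i \<le> j \<longrightarrow>
    (arr (ev strong_prog s) ''str'' (i * n + j) = 1) = (M i j \<and> unoverlapped far near i j)"
proof -
  define I where "I q u \<longleftrightarrow> (\<forall>i<q. \<forall>j<m. i \<le> j \<longrightarrow>
    (arr u ''str'' (i * n + j) = 1) = (M i j \<and> unoverlapped far near i j))" for q and u :: state
  have "I (var s ''m'') (ev strong_prog s)" unfolding strong_prog_def
  proof (rule ev_For_induct, goal_cases)
    case (5 q u)
    define v where "v = setv ''h'' 0 (setv ''ok'' 1 u)"
    have e: "ev strong_step u = ev strong_row v"
      by (simp add: strong_step_def v_def)
    have row: "(\<forall>j<m. q \<le> j \<longrightarrow> (arr (ev strong_row v) ''str'' (q * n + j) = 1) = (M q j \<and> unoverlapped far near q j)) \<and>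
      (\<forall>i' j. i' \<noteq> q \<longrightarrow> j < n \<longrightarrow> arr (ev strong_row v) ''str'' (i' * n + j) = arr v ''str'' (i' * n + j))"
      by (rule strong_row) (use 5 n m far near md in \<open>simp_all add: v_def\<close>)
    show ?case unfolding e using 5(2) row m by (auto simp: I_def less_Suc_eq v_def)
  qed (simp_all add: I_def)
  then show ?thesis by (simp add: I_def m)
qed

section \<open>Construction of the tree in memory\<close>

definition node_row :: prog where
  "node_row = PFor ''j'' ''m'' (PSeq (PAssign ''k'' (Sub (Sub (Var ''m'') C1) Vj))
     (PIf (BAnd (BNot (BLess (Var ''k'') Vi)) (BEq (Get ''str'' (idx Vi (Var ''k''))) C1))
       (PSeq (PPut ''st'' (Var ''size'') Vi) (PSeq (PPut ''en'' (Var ''size'') (Var ''k''))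
          (PAssign ''size'' (Add (Var ''size'') C1)))) PSkip))"

text \<open>Numbering starts at 1, as node \<open>0\<close> is the leaf of \<open>z\<close>; the
  start \<open>0\<close> of that node comes from the initial memory.\<close>

definition node_prog :: prog where
  "node_prog = PSeq (PAssign ''size'' C1) (PSeq (PPut ''en'' (Const 0) (Var ''m''))
     (PFor ''i'' ''m'' node_row))"

lemma node_mods [simp]:
  "wv node_row = {''j'', ''k'', ''size''}" "wa node_row = {''st'', ''en''}"
  "wv node_prog = {''i'', ''j'', ''k'', ''size''}" "wa node_prog = {''st'', ''en''}"
  by (auto simp: node_row_def node_prog_def)

text \<open>For each start the ends are listed downwards, so an interval precedes those it contains
  and the list is a preorder.\<close>

definition node_list :: "(nat \<Rightarrow> nat \<Rightarrow> bool) \<Rightarrow> nat \<Rightarrow> nat \<Rightarrow> (nat \<times> nat) list" where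
  "node_list Q m i = map (Pair i) (filter (\<lambda>j. i \<le> j \<and> Q i j) (map (\<lambda>k. m - 1 - k) [0..<m]))"

definition listed :: "nat \<Rightarrow> state \<Rightarrow> (nat \<times> nat) list \<Rightarrow> bool" where
  "listed m t xs \<longleftrightarrow> var t ''size'' = Suc (length xs) \<and> arr t ''st'' 0 = 0 \<and> arr t ''en'' 0 = m \<and>
     (\<forall>c<length xs. (arr t ''st'' (Suc c), arr t ''en'' (Suc c)) = xs ! c)"

lemma node_row:
  assumes n: "var s ''n'' = n" and m: "var s ''m'' = m" and i: "var s ''i'' = i" "i < m"
    and Q: "\<And>i j. i \<le> j \<Longrightarrow> j < m \<Longrightarrow> (arr s ''str'' (i * n + j) = 1) = Q i j"
    and xs: "listed m s xs"
  shows "listed m (ev node_row s) (xs @ node_list Q m i)"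
proof -
  define ys where "ys q = map (Pair i) (filter (\<lambda>j. i \<le> j \<and> Q i j) (map (\<lambda>k. m - 1 - k) [0..<q]))" for q
  define I where "I q u \<longleftrightarrow> listed m u (xs @ ys q)" for q and u :: state
  have "I (var s ''m'') (ev node_row s)" unfolding node_row_def
  proof (rule ev_For_induct, goal_cases)
    case (5 q u)
    have [simp]: "var u ''n'' = n" "var u ''m'' = m" "var u ''i'' = i" "var u ''j'' = q"
      "arr u ''str'' = arr s ''str''"
      using 5(3-5) i n m by simp_all
    let ?k = "m - 1 - q"
    have k: "?k < m" using 5(1) m by simp
    have ys: "ys (Suc q) = ys q @ (if i \<le> ?k \<and> Q i ?k then [(i, ?k)] else [])"
      by (simp add: ys_def)
    have "i \<le> ?k \<and> arr s ''str'' (i * n + ?k) = 1 \<longleftrightarrow> i \<le> ?k \<and> Q i ?k"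
      using Q k by blast
    then show ?case
      using 5(2) by (auto simp: I_def listed_def ys nth_append less_Suc_eq)
  qed (use xs in \<open>simp_all add: I_def listed_def ys_def\<close>)
  then show ?thesis by (simp add: I_def m ys_def node_list_def)
qed

lemma node_prog:
  assumes n: "var s ''n'' = n" and m: "var s ''m'' = m"
    and Q: "\<And>i j. i \<le> j \<Longrightarrow> j < m \<Longrightarrow> (arr s ''str'' (i * n + j) = 1) = Q i j"
    and st: "arr s ''st'' = (\<lambda>_. 0)"
  shows "listed m (ev node_prog s) (concat (map (node_list Q m) [0..<m]))"
proof -
  let ?s = "seta ''en'' 0 m (setv ''size'' 1 s)"
  define I where "I q u \<longleftrightarrow> listed m u (concat (map (node_list Q m) [0..<q]))" for q and u :: state
  have "I (var ?s ''m'') (ev (PFor ''i'' ''m'' node_row) ?s)"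
  proof (rule ev_For_induct, goal_cases)
    case (5 q u)
    have "listed m (ev node_row u) (concat (map (node_list Q m) [0..<q]) @ node_list Q m q)"
      by (rule node_row) (use 5 n m Q in \<open>simp_all add: I_def\<close>)
    then show ?case by (simp add: I_def listed_def)
  qed (simp_all add: I_def listed_def st)
  moreover have "ev node_prog s = ev (PFor ''i'' ''m'' node_row) ?s"
    by (simp add: node_prog_def m)
  ultimately show ?thesis by (simp add: I_def m del: ev.simps)
qed

text \<open>Later candidates overwrite earlier ones. In preorder an earlier node starts no later, so
  reaching as far already means enclosing, and the last such node is the innermost.\<close>

definition par_row :: prog where
  "par_row = PFor ''j'' ''N'' (PIf (BAnd (BLess Vj Vi) (BNot (BLess (Get ''en'' Vj) (Get ''en'' Vi))))
     (PPut ''par'' Vi Vj) PSkip)"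

definition par_prog :: prog where
  "par_prog = PFor ''i'' ''N'' par_row"

lemma par_mods [simp]:
  "wv par_row = {''j''}" "wa par_row = {''par''}"
  "wv par_prog = {''i'', ''j''}" "wa par_prog = {''par''}"
  by (auto simp: par_row_def par_prog_def)

definition encloser :: "(nat \<Rightarrow> nat) \<Rightarrow> nat \<Rightarrow> nat \<Rightarrow> bool" where
  "encloser en c p \<longleftrightarrow> p < c \<and> en c \<le> en p \<and> (\<forall>d. p < d \<and> d < c \<longrightarrow> en d < en c)"

lemma par_row:
  assumes N: "var s ''N'' = N" and i: "var s ''i'' = i" "i < N"
    and en: "arr s ''en'' = en" and ex: "0 < i" "en i \<le> en 0"
  shows "encloser en i (arr (ev par_row s) ''par'' i) \<and>
    (\<forall>c. c \<noteq> i \<longrightarrow> arr (ev par_row s) ''par'' c = arr s ''par'' c)"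
proof -
  let ?P = "\<lambda>d. d < i \<and> en i \<le> en d"
  \<comment> \<open>From round one on there is an entry, because node \<open>0\<close> always
    qualifies by \<open>en i \<le> en 0\<close>.\<close>
  define I where "I q u \<longleftrightarrow> (0 < q \<longrightarrow> ?P (arr u ''par'' i) \<and> (\<forall>d<q. arr u ''par'' i < d \<longrightarrow> \<not> ?P d)) \<and>
    (\<forall>c. c \<noteq> i \<longrightarrow> arr u ''par'' c = arr s ''par'' c)" for q and u :: state
  have "I (var s ''N'') (ev par_row s)" unfolding par_row_def
  proof (rule ev_For_induct, goal_cases)
    case (5 q u)
    have [simp]: "var u ''i'' = i" "var u ''j'' = q" "arr u ''en'' = en"
      using 5(3-5) i en by simp_all
    show ?case
    proof (cases "?P q")
      case True
      then show ?thesis using 5(2) by (auto simp: I_def less_Suc_eq)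
    next
      case False
      then have "0 < q" using ex by (cases q) auto
      with False 5(2) show ?thesis by (auto simp: I_def less_Suc_eq)
    qed
  qed (simp_all add: I_def)
  then show ?thesis using i by (auto simp: I_def N encloser_def not_le)
qed

lemma par_prog:
  assumes N: "var s ''N'' = N" and en: "arr s ''en'' = en"
    and le: "\<And>c. c < S \<Longrightarrow> en c \<le> en 0" and S: "S \<le> N"
  shows "\<forall>c<S. 0 < c \<longrightarrow> encloser en c (arr (ev par_prog s) ''par'' c)"
proof -
  define I where "I q u \<longleftrightarrow> (\<forall>c<q. c < S \<longrightarrow> 0 < c \<longrightarrow> encloser en c (arr u ''par'' c))" for q and u :: state
  have "I (var s ''N'') (ev par_prog s)" unfolding par_prog_def
  proof (rule ev_For_induct, goal_cases)
    case (5 q u)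
    have vars: "var u ''N'' = N" "var u ''i'' = q" "arr u ''en'' = en" "q < N"
      using 5 N en by simp_all
    \<comment> \<open>\<open>par_row\<close> covers nodes only; for \<open>q\<close> behind the last
      node the frame fact is taken from the loop rule directly.\<close>
    have other: "arr (ev par_row u) ''par'' c = arr u ''par'' c" if "c \<noteq> q" for c
    proof -
      have "J (var u ''N'') (ev par_row u)"
        if J: "J = (\<lambda>k w. arr w ''par'' c = arr u ''par'' c \<and> var w ''i'' = q)" for J :: "nat \<Rightarrow> state \<Rightarrow> bool"
        unfolding par_row_def J
        by (rule ev_For_induct) (use \<open>c \<noteq> q\<close> vars in auto)
      then show ?thesis by blast
    qed
    have "encloser en q (arr (ev par_row u) ''par'' q)" if "0 < q" "q < S"
      using par_row[of u N q en] vars le that by blast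
    with 5(2) other show ?case by (auto simp: I_def less_Suc_eq)
  qed (simp_all add: I_def)
  then show ?thesis using S by (simp add: I_def N)
qed

definition child_row :: prog where
  "child_row = PFor ''j'' ''N'' (PIf (BAnd (BLess Vi Vj) (BAnd (BLess Vj (Var ''size'')) (BEq (Get ''par'' Vj) Vi)))
     (PSeq (PPut ''nbr'' (Var ''q'') Vj) (PAssign ''q'' (Add (Var ''q'') C1))) PSkip)"

text \<open>\<open>size\<close> is assigned by the program and so cannot be a loop bound; the loops
  run up to \<open>N\<close> and compare with \<open>size\<close> instead.\<close>

definition nbr_step :: prog where
  "nbr_step = PIf (BLess Vi (Var ''size'')) (PSeq
     (PIf (BLess (Const 0) Vi)
        (PSeq (PPut ''nbr'' (Var ''q'') (Get ''par'' Vi)) (PAssign ''q'' (Add (Var ''q'') C1))) PSkip)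
     (PSeq child_row (PPut ''first'' (Add Vi C1) (Var ''q'')))) PSkip"

definition nbr_prog :: prog where
  "nbr_prog = PFor ''i'' ''N'' nbr_step"

lemma nbr_mods [simp]:
  "wv child_row = {''j'', ''q''}" "wa child_row = {''nbr''}"
  "wv nbr_step = {''j'', ''q''}" "wa nbr_step = {''nbr'', ''first''}"
  "wv nbr_prog = {''i'', ''j'', ''q''}" "wa nbr_prog = {''nbr'', ''first''}"
  by (auto simp: child_row_def nbr_step_def nbr_prog_def)

text \<open>\<open>a\<close> marks the beginning of the segment being written, which may already
  hold the parent.\<close>

lemma child_row:
  assumes N: "var s ''N'' = N" and i: "var s ''i'' = i" "i < S" and S: "var s ''size'' = S" "S \<le> N"
    and par: "arr s ''par'' = par" and a: "a \<le> var s ''q''"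
  shows "var s ''q'' \<le> var (ev child_row s) ''q'' \<and>
    (\<forall>p<var s ''q''. arr (ev child_row s) ''nbr'' p = arr s ''nbr'' p) \<and>
    map (arr (ev child_row s) ''nbr'') [a..<var (ev child_row s) ''q''] =
      map (arr s ''nbr'') [a..<var s ''q''] @ filter (\<lambda>d. par d = i) [Suc i..<S]"
proof -
  define I where "I k u \<longleftrightarrow> var s ''q'' \<le> var u ''q'' \<and>
    (\<forall>p<var s ''q''. arr u ''nbr'' p = arr s ''nbr'' p) \<and>
    map (arr u ''nbr'') [a..<var u ''q''] =
      map (arr s ''nbr'') [a..<var s ''q''] @ filter (\<lambda>d. par d = i) [Suc i..<min k S]"
    for k and u :: state
  have "I (var s ''N'') (ev child_row s)" unfolding child_row_def
  proof (rule ev_For_induct, goal_cases)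
    case (5 k u)
    have [simp]: "var u ''size'' = S" "var u ''i'' = i" "var u ''j'' = k" "arr u ''par'' = par"
      using 5(3-5) i S par by simp_all
    have q: "a \<le> var u ''q''" using 5(2) a by (auto simp: I_def)
    have ext: "map ((arr u ''nbr'')(var u ''q'' := x)) [a..<Suc (var u ''q'')] =
        map (arr u ''nbr'') [a..<var u ''q''] @ [x]" for x
      using q by (auto intro!: map_cong)
    show ?case
    proof (cases "i < k \<and> k < S \<and> par k = i")
      case True
      then have "[Suc i..<min (Suc k) S] = [Suc i..<min k S] @ [k]" by (simp add: min_def)
      then show ?thesis using 5(2) True ext[of k] by (auto simp: I_def simp del: upt_Suc)
    next
      case False
      have "filter (\<lambda>d. par d = i) [Suc i..<min (Suc k) S] = filter (\<lambda>d. par d = i) [Suc i..<min k S]"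
      proof (cases "i < k \<and> k < S")
        case True
        then have "[Suc i..<min (Suc k) S] = [Suc i..<min k S] @ [k]" by (simp add: min_def)
        then show ?thesis using True False by simp
      next
        case False
        then consider "S \<le> k" | "k \<le> i" by linarith
        then show ?thesis by cases (simp_all add: min_def)
      qed
      with 5(2) False show ?thesis by (auto simp: I_def)
    qed
  qed (use i in \<open>simp_all add: I_def\<close>)
  then show ?thesis using S by (simp add: I_def N min_absorb2)
qed

lemma nbr_prog:
  assumes N: "var s ''N'' = N" and S: "var s ''size'' = S" "S \<le> N"
    and par: "arr s ''par'' = par" and init: "var s ''q'' = 0" "arr s ''first'' = (\<lambda>_. 0)"
  defines "t \<equiv> ev nbr_prog s"
  shows "\<forall>c<S. map (arr t ''nbr'') [arr t ''first'' c..<arr t ''first'' (Suc c)] =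
    (if c = 0 then [] else [par c]) @ filter (\<lambda>d. par d = c) [Suc c..<S]"
proof -
  define nb where "nb c = (if c = 0 then [] else [par c]) @ filter (\<lambda>d. par d = c) [Suc c..<S]" for c
  \<comment> \<open>With \<open>min k S\<close> the invariant stays the same once \<open>k\<close>
    has passed the last node.\<close>
  define I where "I k u \<longleftrightarrow> arr u ''first'' (min k S) = var u ''q'' \<and>
    (\<forall>c<min k S. arr u ''first'' (Suc c) \<le> var u ''q'' \<and>
       map (arr u ''nbr'') [arr u ''first'' c..<arr u ''first'' (Suc c)] = nb c)" for k and u :: state
  have "I (var s ''N'') (ev nbr_prog s)" unfolding nbr_prog_def
  proof (rule ev_For_induct, goal_cases)
    case (5 k u)
    have vars: "var u ''N'' = N" "var u ''size'' = S" "var u ''i'' = k" "arr u ''par'' = par"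
      using 5(3-5) N S par by simp_all
    show ?case
    proof (cases "k < S")
      case False
      then show ?thesis using 5(2) vars by (auto simp: nbr_step_def I_def min_absorb2)
    next
      case True
      let ?q = "var u ''q''"
      have first: "arr u ''first'' k = ?q"
        and seg: "\<And>c. c < k \<Longrightarrow> arr u ''first'' (Suc c) \<le> ?q"
          "\<And>c. c < k \<Longrightarrow> map (arr u ''nbr'') [arr u ''first'' c..<arr u ''first'' (Suc c)] = nb c"
        using 5(2) True by (auto simp: I_def min_absorb1)
      define v where "v = (if 0 < k then setv ''q'' (Suc ?q) (seta ''nbr'' ?q (par k) u) else u)"
      have v: "var v ''N'' = N" "var v ''size'' = S" "var v ''i'' = k" "arr v ''par'' = par"
        "arr v ''first'' = arr u ''first''" "?q \<le> var v ''q''" "\<And>p. p < ?q \<Longrightarrow> arr v ''nbr'' p = arr u ''nbr'' p"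
        "map (arr v ''nbr'') [?q..<var v ''q''] = (if k = 0 then [] else [par k])"
        using vars by (auto simp: v_def)
      define w where "w = ev child_row v"
      have w: "var v ''q'' \<le> var w ''q''" "\<And>p. p < var v ''q'' \<Longrightarrow> arr w ''nbr'' p = arr v ''nbr'' p"
        "map (arr w ''nbr'') [?q..<var w ''q''] = nb k"
        using child_row[of v N k S par ?q] v S True by (auto simp: w_def nb_def)
      have w_first: "arr w ''first'' = arr u ''first''" "var w ''i'' = k"
        using v by (simp_all add: w_def ev_arr ev_var)
      have e: "setv ''i'' (Suc k) (ev nbr_step u) =
          setv ''i'' (Suc k) (seta ''first'' (Suc k) (var w ''q'') w)"
        using True vars by (cases "k = 0") (simp_all add: nbr_step_def w_def v_def ev_var)
      have old: "map (arr w ''nbr'') [arr u ''first'' c..<arr u ''first'' (Suc c)] = nb c" if "c < k" for c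
      proof -
        have "map (arr w ''nbr'') [arr u ''first'' c..<arr u ''first'' (Suc c)] =
          map (arr u ''nbr'') [arr u ''first'' c..<arr u ''first'' (Suc c)]"
          using seg(1)[OF that] w(2) v(6,7) by (intro map_cong) auto
        then show ?thesis using seg(2)[OF that] by simp
      qed
      have le: "arr u ''first'' (Suc c) \<le> var w ''q''" if "c < k" for c
        using seg(1)[OF that] w(1) v(6) by linarith
      have min: "min (Suc k) S = Suc k" using True by simp
      show ?thesis
        unfolding e I_def min using old le w(3) first by (auto simp: less_Suc_eq w_first)
    qed
  qed (use init in \<open>simp_all add: I_def\<close>)
  then show ?thesis using S by (simp add: I_def N min_absorb2 nb_def t_def)
qed

definition cut_test :: bexp where
  "cut_test = BAnd (BAnd (BLess (Get ''st'' Vi) Vj) (BNot (BLess (Get ''en'' Vi) Vj)))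
     (BAnd (BEq (Get ''md'' (idx (Get ''st'' Vi) (Sub Vj C1))) C1)
        (BEq (Get ''md'' (idx Vj (Get ''en'' Vi))) C1))"

definition kind_row :: prog where
  "kind_row = PFor ''j'' ''m'' (PIf cut_test
     (PPut ''kind'' Vi C1) PSkip)"

text \<open>Prime, coded by 2, is the default; a cut changes it to circular, coded by 1.\<close>

definition label_step :: prog where
  "label_step = PSeq
     (PIf (BEq Vi (Const 0)) (PPut ''leaf'' Vi (Var ''m'')) (PPut ''leaf'' Vi (Get ''perm'' (Get ''st'' Vi))))
     (PSeq (PPut ''kind'' Vi (Const 2)) kind_row)"

definition label_prog :: prog where
  "label_prog = PFor ''i'' ''N'' label_step"

lemma label_mods [simp]:
  "wv kind_row = {''j''}" "wa kind_row = {''kind''}"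
  "wv label_step = {''j''}" "wa label_step = {''leaf'', ''kind''}"
  "wv label_prog = {''i'', ''j''}" "wa label_prog = {''leaf'', ''kind''}"
  by (auto simp: kind_row_def label_step_def label_prog_def)

lemma kind_row:
  assumes n: "var s ''n'' = n" and m: "var s ''m'' = m" and i: "var s ''i'' = i"
    and st: "arr s ''st'' i = a" and en: "arr s ''en'' i = c"
  shows "arr (ev kind_row s) ''kind'' i = (if \<exists>p<m. a < p \<and> p \<le> c \<and>
      arr s ''md'' (a * n + (p - 1)) = 1 \<and> arr s ''md'' (p * n + c) = 1 then 1 else arr s ''kind'' i) \<and>
    (\<forall>k. k \<noteq> i \<longrightarrow> arr (ev kind_row s) ''kind'' k = arr s ''kind'' k)"
proof -
  define Q where "Q p \<longleftrightarrow> a < p \<and> p \<le> c \<and>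
      arr s ''md'' (a * n + (p - 1)) = 1 \<and> arr s ''md'' (p * n + c) = 1" for p
  define I where "I k u \<longleftrightarrow> arr u ''kind'' i = (if \<exists>p<k. Q p then 1 else arr s ''kind'' i) \<and>
    (\<forall>k. k \<noteq> i \<longrightarrow> arr u ''kind'' k = arr s ''kind'' k)" for k and u :: state
  have "I (var s ''m'') (ev kind_row s)" unfolding kind_row_def
  proof (rule ev_For_induct, goal_cases)
    case (5 k u)
    have [simp]: "var u ''n'' = n" "var u ''i'' = i" "var u ''j'' = k" "arr u ''md'' = arr s ''md''"
      "arr u ''st'' = arr s ''st''" "arr u ''en'' = arr s ''en''"
      using 5(3-5) n i by simp_all
    have "bval cut_test u \<longleftrightarrow> Q k"
      using st en by (auto simp: cut_test_def Q_def)
    then show ?case using 5(2) unfolding ev.simps by (auto simp: I_def less_Suc_eq)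
  qed (simp_all add: I_def)
  then show ?thesis by (simp add: I_def m Q_def)
qed

lemma label_prog:
  assumes n: "var s ''n'' = n" and m: "var s ''m'' = m" and N: "var s ''N'' = N"
    and st: "arr s ''st'' = st" and en: "arr s ''en'' = en"
  shows "\<forall>c<N. arr (ev label_prog s) ''leaf'' c = (if c = 0 then m else arr s ''perm'' (st c))"
    "\<forall>c<N. arr (ev label_prog s) ''kind'' c = (if \<exists>p<m. st c < p \<and> p \<le> en c \<and>
      arr s ''md'' (st c * n + (p - 1)) = 1 \<and> arr s ''md'' (p * n + en c) = 1 then 1 else 2)"
proof -
  define Q where "Q c \<longleftrightarrow> (\<exists>p<m. st c < p \<and> p \<le> en c \<and>
      arr s ''md'' (st c * n + (p - 1)) = 1 \<and> arr s ''md'' (p * n + en c) = 1)" for c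
  define I where "I k u \<longleftrightarrow> (\<forall>c<k. arr u ''leaf'' c = (if c = 0 then m else arr s ''perm'' (st c)) \<and>
    arr u ''kind'' c = (if Q c then 1 else 2))" for k and u :: state
  have "I (var s ''N'') (ev label_prog s)" unfolding label_prog_def
  proof (rule ev_For_induct, goal_cases)
    case (5 k u)
    have vars: "var u ''n'' = n" "var u ''m'' = m" "var u ''i'' = k" "arr u ''md'' = arr s ''md''"
      "arr u ''st'' = st" "arr u ''en'' = en" "arr u ''perm'' = arr s ''perm''"
      using 5(3-5) n m st en by simp_all
    define v where "v = seta ''kind'' k 2 (seta ''leaf'' k (if k = 0 then m else arr s ''perm'' (st k)) u)"
    have row: "arr (ev kind_row v) ''kind'' k = (if \<exists>p<m. st k < p \<and> p \<le> en k \<and>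
        arr v ''md'' (st k * n + (p - 1)) = 1 \<and> arr v ''md'' (p * n + en k) = 1 then 1 else arr v ''kind'' k) \<and>
      (\<forall>c. c \<noteq> k \<longrightarrow> arr (ev kind_row v) ''kind'' c = arr v ''kind'' c)"
      by (rule kind_row) (use vars in \<open>simp_all add: v_def\<close>)
    have md: "arr v ''md'' = arr s ''md''" and two: "arr v ''kind'' k = 2"
      using vars by (simp_all add: v_def)
    have row': "arr (ev kind_row v) ''kind'' k = (if Q k then 1 else 2)"
      using row unfolding md two Q_def by blast
    have row'': "arr (ev kind_row v) ''kind'' c = arr u ''kind'' c" if "c \<noteq> k" for c
      using row that by (simp add: v_def)
    have leaf: "arr (ev kind_row v) ''leaf'' = (arr u ''leaf'')(k := if k = 0 then m else arr s ''perm'' (st k))"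
      by (simp add: ev_arr v_def)
    have e: "ev label_step u = ev kind_row v"
      using vars by (simp add: label_step_def v_def)
    show ?case unfolding e using 5(2) row' row'' leaf by (simp add: I_def less_Suc_eq)
  qed (simp_all add: I_def)
  then have "I N (ev label_prog s)" by (simp add: N)
  then show "\<forall>c<N. arr (ev label_prog s) ''leaf'' c = (if c = 0 then m else arr s ''perm'' (st c))"
    "\<forall>c<N. arr (ev label_prog s) ''kind'' c = (if \<exists>p<m. st c < p \<and> p \<le> en c \<and>
      arr s ''md'' (st c * n + (p - 1)) = 1 \<and> arr s ''md'' (p * n + en c) = 1 then 1 else 2)"
    by (simp_all add: I_def Q_def)
qed

text \<open>Doubling \<open>n\<close> by single increments keeps the assignments tame. This is a
  program of its own because \<open>N\<close> is assigned here and is a loop bound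
  afterwards.\<close>

definition init_prog :: prog where
  "init_prog = PSeq (PAssign ''m'' (Sub (Var ''n'') C1))
     (PFor ''i'' ''n'' (PSeq (PAssign ''N'' (Add (Var ''N'') C1)) (PAssign ''N'' (Add (Var ''N'') C1))))"

lemma init_prog:
  assumes N: "var s ''N'' = 0"
  shows "var (ev init_prog s) ''N'' = 2 * var s ''n''" "var (ev init_prog s) ''m'' = var s ''n'' - 1"
    "x \<notin> {''m'', ''i'', ''N''} \<Longrightarrow> var (ev init_prog s) x = var s x" "arr (ev init_prog s) = arr s"
proof -
  let ?s = "setv ''m'' (var s ''n'' - 1) s"
  let ?p = "PSeq (PAssign ''N'' (Add (Var ''N'') C1)) (PAssign ''N'' (Add (Var ''N'') C1))"
  have e: "ev init_prog s = ev (PFor ''i'' ''n'' ?p) ?s" by (simp add: init_prog_def)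
  define I where "I k t \<longleftrightarrow> var t ''N'' = 2 * k" for k and t :: state
  have "I (var ?s ''n'') (ev (PFor ''i'' ''n'' ?p) ?s)"
    by (rule ev_For_induct) (simp_all add: I_def N)
  then show "var (ev init_prog s) ''N'' = 2 * var s ''n''" unfolding e I_def by simp
  show "var (ev init_prog s) ''m'' = var s ''n'' - 1" unfolding e by (subst ev_var) simp_all
  show "x \<notin> {''m'', ''i'', ''N''} \<Longrightarrow> var (ev init_prog s) x = var s x"
    unfolding e by (subst ev_var) simp_all
  show "arr (ev init_prog s) = arr s" unfolding e by (intro ext) (subst ev_arr, simp_all)
qed

definition main_prog :: prog where
  "main_prog = PSeq switch_prog (PSeq sort_prog (PSeq perm_prog (PSeq split_prog (PSeq module_prog
     (PSeq strong_prog (PSeq node_prog (PSeq par_prog (PSeq nbr_prog label_prog))))))))"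

lemma all_eq_first:
  fixes h :: "nat \<Rightarrow> 'b"
  assumes "\<And>k. i \<le> k \<Longrightarrow> k < j \<Longrightarrow> h k = h (Suc k)" "i \<le> l" "l \<le> j"
  shows "h l = h i"
  using assms(2,3) by (induction l rule: dec_induct) (use assms(1) in auto)

definition pre_less :: "nat \<times> nat \<Rightarrow> nat \<times> nat \<Rightarrow> bool" where
  "pre_less x y \<longleftrightarrow> fst x < fst y \<or> fst x = fst y \<and> snd y < snd x"

lemma sorted_node_list: "sorted_wrt pre_less (concat (map (node_list Q m) [0..<q]))"
proof (induction q)
  case (Suc q)
  have "sorted_wrt (\<lambda>k l. m - 1 - l < m - 1 - k) [0..<m]"
    by (rule sorted_wrt_mono_rel[of _ "(<)"]) auto
  then have "sorted_wrt pre_less (node_list Q m q)"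
    unfolding node_list_def by (auto simp: sorted_wrt_map pre_less_def intro!: sorted_wrt_filter)
  moreover have "pre_less x y" if "x \<in> set (concat (map (node_list Q m) [0..<q]))" "y \<in> set (node_list Q m q)" for x y
    using that by (auto simp: node_list_def pre_less_def)
  ultimately show ?case using Suc by (auto simp: sorted_wrt_append)
qed simp

lemma set_node_list:
  "set (concat (map (node_list Q m) [0..<m])) = {(i, j). i \<le> j \<and> j < m \<and> Q i j}"
proof (intro set_eqI iffI)
  fix x assume "x \<in> {(i, j). i \<le> j \<and> j < m \<and> Q i j}"
  then obtain i j where x: "x = (i, j)" "i \<le> j" "j < m" "Q i j" by auto
  then have "j = m - 1 - (m - 1 - j)" "m - 1 - j < m" by auto
  then have "j \<in> (\<lambda>k. m - 1 - k) ` {0..<m}" by (metis atLeastLessThan_iff imageI zero_le)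
  then have "x \<in> set (node_list Q m i)" using x by (auto simp: node_list_def)
  then show "x \<in> set (concat (map (node_list Q m) [0..<m]))" using x by force
qed (auto simp: node_list_def)

lemma distinct_sorted_pre_less: "sorted_wrt pre_less xs \<Longrightarrow> distinct xs"
  by (induction xs) (auto simp: pre_less_def)

section \<open>Correctness of the whole program\<close>

context indexed_tournament
begin

lemma main_prog:
  assumes n: "var s ''n'' = Suc m" and m: "var s ''m'' = m" and N: "var s ''N'' = 2 * Suc m"
    and q: "var s ''q'' = 0"
    and arc: "\<And>i j. i < Suc m \<Longrightarrow> j < Suc m \<Longrightarrow> arr s ''arc'' (i * Suc m + j) = of_bool (a i j)"
    and zero: "\<And>x. x \<noteq> ''arc'' \<Longrightarrow> arr s x = (\<lambda>_. 0)"
  shows "umodular_tree X R (decode_tree f (ev main_prog s))"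
proof -
  let ?n = "Suc m"
  define s1 where "s1 = ev switch_prog s"
  define s2 where "s2 = ev sort_prog s1"
  define s3 where "s3 = ev perm_prog s2"
  define s4 where "s4 = ev split_prog s3"
  define s5 where "s5 = ev module_prog s4"
  define s6 where "s6 = ev strong_prog s5"
  define s7 where "s7 = ev node_prog s6"
  define s8 where "s8 = ev par_prog s7"
  define s9 where "s9 = ev nbr_prog s8"
  define t where "t = ev label_prog s9"
  have t: "ev main_prog s = t"
    by (simp add: main_prog_def t_def s1_def s2_def s3_def s4_def s5_def s6_def s7_def s8_def s9_def)
  note fr = ev_var ev_arr
  have v: "var u ''n'' = ?n" "var u ''m'' = m" "var u ''N'' = 2 * ?n" "var u ''q'' = 0"
    if "u \<in> {s1, s2, s3, s4, s5, s6, s7, s8}" for u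
    using that n m N q
    by (auto simp: s1_def s2_def s3_def s4_def s5_def s6_def s7_def s8_def fr)
  have z: "arr s1 ''lab'' = (\<lambda>_. 0)" "arr s4 ''near'' = (\<lambda>_. 0)" "arr s6 ''st'' = (\<lambda>_. 0)"
      "arr s8 ''first'' = (\<lambda>_. 0)"
    by (simp_all add: s1_def s2_def s3_def s4_def s5_def s6_def s7_def s8_def fr zero)

  have b1: "arr s1 ''b'' (i * ?n + j) = of_bool (b i j)" if "i < m" "j < m" for i j
    using switch_prog[of s ?n m a] n m arc that by (simp add: s1_def b_def switched_def)
  have lab2: "arr s2 ''lab'' v = lab v" if "v < m" for v
    using sort_prog[of s1 ?n m b] v[of s1] b1 irr z(1) that by (simp add: s2_def)
  have "inj_on (arr s2 ''lab'') {..<m}"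
    using bij_lab lab2 by (simp add: bij_betw_def inj_on_def)
  then have perm3: "\<forall>v<m. arr s3 ''perm'' (arr s2 ''lab'' v) = v"
    using perm_prog[of s2 m] v[of s2] by (simp add: s3_def)
  define perm where "perm = arr s3 ''perm''"
  have perm_lab: "perm (lab v) = v" if "v < m" for v
    using perm3 lab2 that by (simp add: perm_def)
  interpret ordered_indexed_tournament X R f m perm
    by unfold_locales (rule perm_lab)

  \<comment> \<open>Raw memory, as \<open>split_prog\<close> speaks of all arguments; its meaning is
    established only for positions below \<open>m\<close>.\<close>
  define c where "c x y = arr s3 ''b'' (perm x * var s3 ''n'' + perm y)" for x y
  have c: "c x y = of_bool (b (perm x) (perm y))" if "x < m" "y < m" for x y
    using b1[of "perm x" "perm y"] that perm_less v[of s3] by (simp add: c_def s3_def s2_def fr)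
  define lo where "lo = arr s4 ''lo''"
  define hi where "hi = arr s4 ''hi''"
  have lohi: "lo i < t \<longleftrightarrow> i < t \<or> (\<exists>x<m. splits c x i \<and> x < t)"
    "hi i \<le> t \<longleftrightarrow> Suc i \<le> t \<and> (\<forall>x<m. splits c x i \<longrightarrow> x \<le> t)" if "i < m" for i t
    using split_prog[of s3 m c] v[of s3] that by (simp_all add: s4_def lo_def hi_def c_def perm_def)

  have module: "unsplit lo hi i j \<longleftrightarrow> interval_module i j" if ij: "i \<le> j" "j < m" for i j
  proof -
    have "i \<le> lo k \<and> hi k \<le> j \<longleftrightarrow> (\<forall>x<m. x \<notin> {i..j} \<longrightarrow> c x k = c x (Suc k))" if k: "i \<le> k" "k < j" for k
    proof -
      have "i \<le> lo k \<longleftrightarrow> (\<forall>x<m. splits c x k \<longrightarrow> i \<le> x)"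
        using lohi(1)[of k i] k ij by (auto simp flip: not_less)
      moreover have "hi k \<le> j \<longleftrightarrow> (\<forall>x<m. splits c x k \<longrightarrow> x \<le> j)"
        using lohi(2)[of k j] k ij by auto
      \<comment> \<open>A position outside \<open>{i..j}\<close> differs from \<open>k\<close> and
        \<open>Suc k\<close>, so the exceptions built into \<open>splits\<close> disappear.\<close>
      moreover have "splits c x k \<longleftrightarrow> c x k \<noteq> c x (Suc k)" if "x \<notin> {i..j}" for x
        using that k by (auto simp: splits_def)
      ultimately show ?thesis by auto
    qed
    then have "unsplit lo hi i j \<longleftrightarrow>
        (\<forall>x<m. x \<notin> {i..j} \<longrightarrow> (\<forall>k. i \<le> k \<and> k < j \<longrightarrow> c x k = c x (Suc k)))"
      unfolding unsplit_def by blast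
    also have "\<dots> \<longleftrightarrow> (\<forall>x<m. x \<notin> {i..j} \<longrightarrow> (\<forall>k\<in>{i..j}. \<forall>l\<in>{i..j}. c x k = c x l))"
    proof -
      have "c x k = c x l"
        if "\<forall>k. i \<le> k \<and> k < j \<longrightarrow> c x k = c x (Suc k)" "k \<in> {i..j}" "l \<in> {i..j}" for x k l
        using all_eq_first[of i j "c x" k] all_eq_first[of i j "c x" l] that by simp
      moreover have "c x k = c x (Suc k)"
        if "\<forall>k\<in>{i..j}. \<forall>l\<in>{i..j}. c x k = c x l" "i \<le> k" "k < j" for x k
        using that by (meson Suc_leI atLeastAtMost_iff le_SucI less_imp_le)
      ultimately show ?thesis by blast
    qed
    also have "\<dots> \<longleftrightarrow> (\<forall>x<m. x \<notin> {i..j} \<longrightarrow>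
        (\<forall>k\<in>{i..j}. \<forall>l\<in>{i..j}. b (perm x) (perm k) = b (perm x) (perm l)))"
      using ij by (auto simp: c)
    also have "\<dots> \<longleftrightarrow> nmodule m b (perm ` {i..j})"
    proof -
      have sub: "perm ` {i..j} \<subseteq> {..<m}" using ij by (intro perm_image_subset) auto
      have mem: "perm x \<in> perm ` {i..j} \<longleftrightarrow> x \<in> {i..j}" if "x < m" for x
        by (rule inj_on_image_mem_iff[OF inj_perm]) (use that ij in auto)
      have surj: "\<exists>x<m. y = perm x" if "y < m" for y
        using perm_lab[OF that] bij_lab that by (metis bij_betwE lessThan_iff)
      have "nmodule m b (perm ` {i..j}) \<longleftrightarrow>
          (\<forall>y<m. y \<notin> perm ` {i..j} \<longrightarrow> (\<forall>k\<in>{i..j}. \<forall>l\<in>{i..j}. b y (perm k) = b y (perm l)))"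
        using sub unfolding nmodule_def by simp
      also have "\<dots> \<longleftrightarrow> (\<forall>x<m. perm x \<notin> perm ` {i..j} \<longrightarrow>
          (\<forall>k\<in>{i..j}. \<forall>l\<in>{i..j}. b (perm x) (perm k) = b (perm x) (perm l)))"
        using surj perm_less by metis
      finally show ?thesis using mem by simp
    qed
    finally show ?thesis using ij by (simp add: interval_module_def)
  qed

  define far where "far = arr s5 ''far''"
  define near where "near = arr s5 ''near''"
  have md5: "(arr s5 ''md'' (i * ?n + j) = 1) = interval_module i j" if "i \<le> j" "j < m" for i j
    using module_prog(1)[of s4 ?n m lo hi] v[of s4] z(2) module that by (simp add: s5_def lo_def hi_def)
  have far: "far i \<le> t \<longleftrightarrow> (\<forall>j. interval_module i j \<longrightarrow> j \<le> t)" if "i < m" for i t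
  proof -
    have "far i \<le> t \<longleftrightarrow> (\<forall>j<m. i \<le> j \<and> unsplit lo hi i j \<longrightarrow> j \<le> t)"
      using module_prog(2)[of s4 ?n m lo hi] v[of s4] z(2) that by (simp add: s5_def lo_def hi_def far_def)
    then show ?thesis using module rng by blast
  qed
  have near: "near j \<le> t \<longleftrightarrow> (\<exists>i<t. interval_module i j)" if "j < m" for j t
  proof -
    have "near j \<le> t \<longleftrightarrow> (\<exists>i<t. i \<le> j \<and> unsplit lo hi i j)"
      using module_prog(3)[of s4 ?n m lo hi] v[of s4] z(2) that by (simp add: s5_def lo_def hi_def near_def)
    then show ?thesis using module rng that by blast
  qed
  have strong: "interval_module i j \<and> unoverlapped far near i j \<longleftrightarrow> strong i j" if ij: "i \<le> j" "j < m" for i j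
  proof -
    have "(\<forall>k. i < k \<and> k \<le> j \<longrightarrow> far k \<le> j) \<longleftrightarrow>
        \<not> (\<exists>i' j'. interval_module i' j' \<and> i < i' \<and> i' \<le> j \<and> j < j')"
    proof -
      have "far k \<le> j \<longleftrightarrow> \<not> (\<exists>j'. interval_module k j' \<and> j < j')" if "k \<le> j" for k
        using far[of k j] that ij by (auto simp: not_less)
      then show ?thesis by blast
    qed
    moreover have "(\<forall>k. i \<le> k \<and> k < j \<longrightarrow> i < near k) \<longleftrightarrow>
        \<not> (\<exists>i' j'. interval_module i' j' \<and> i' < i \<and> i \<le> j' \<and> j' < j)"
    proof -
      have "i < near k \<longleftrightarrow> \<not> (\<exists>i'. interval_module i' k \<and> i' < i)" if "k < j" for k
        using near[of k i] that ij by (auto simp: not_less[symmetric] simp del: not_less)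
      then show ?thesis by blast
    qed
    ultimately show ?thesis unfolding strong_def unoverlapped_def by blast
  qed
  have str6: "(arr s6 ''str'' (i * ?n + j) = 1) = strong i j" if "i \<le> j" "j < m" for i j
    using strong_prog[of s5 ?n m far near interval_module] v[of s5] md5 strong that
    by (simp add: s6_def far_def near_def)

  define L where "L = concat (map (node_list strong m) [0..<m])"
  have listed: "listed m s7 L"
    using node_prog[of s6 ?n m strong] v[of s6] str6 z(3) by (simp add: s7_def L_def)
  have sorted_L: "sorted_wrt pre_less L" unfolding L_def by (rule sorted_node_list)
  then have distinct_L: "distinct L" by (rule distinct_sorted_pre_less)
  have set_L: "set L = {(i, j). strong i j}"
    unfolding L_def set_node_list using strong_rng by auto
  define S where "S = Suc (length L)"
  define st where "st = arr s7 ''st''"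
  define en where "en = arr s7 ''en''"
  have size7: "var s7 ''size'' = S" and root: "st 0 = 0" "en 0 = m"
    and nth: "\<And>k. k < length L \<Longrightarrow> (st (Suc k), en (Suc k)) = L ! k"
    using listed by (simp_all add: listed_def S_def st_def en_def)
  \<comment> \<open>The count of strong intervals guarantees that the loops up to
    \<open>N = 2 * n\<close> reach every node.\<close>
  have "length L \<le> 2 * m"
    using card_strong(2) distinct_card[OF distinct_L] set_L by simp
  then have S: "S \<le> 2 * ?n" by (simp add: S_def)
  have bij_nodes: "bij_betw (\<lambda>c. (st c, en c)) {1..<S} {(i, j). strong i j}"
  proof -
    have "bij_betw (\<lambda>k. L ! k) {..<length L} (set L)"
      using bij_betw_nth[OF distinct_L refl refl] .
    moreover have "bij_betw (\<lambda>k. L ! k) {..<length L} (set L) \<longleftrightarrow>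
        bij_betw (\<lambda>k. (st (Suc k), en (Suc k))) {..<length L} (set L)"
      by (rule bij_betw_cong) (simp add: nth)
    ultimately have "bij_betw (\<lambda>k. (st (Suc k), en (Suc k))) {..<length L} (set L)" by simp
    moreover have "bij_betw (\<lambda>c. c - 1) {1..<S} {..<length L}"
      by (rule bij_betw_byWitness[of _ Suc]) (auto simp: S_def)
    ultimately have "bij_betw ((\<lambda>k. (st (Suc k), en (Suc k))) \<circ> (\<lambda>c. c - 1)) {1..<S} (set L)"
      by (metis bij_betw_trans)
    then have "bij_betw (\<lambda>c. (st c, en c)) {1..<S} (set L)"
      by (rule bij_betw_cong[THEN iffD1, rotated]) auto
    then show ?thesis unfolding set_L .
  qed
  have preorder: "st c < st d \<or> st c = st d \<and> en d < en c" if "0 < c" "c < d" "d < S" for c d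
  proof -
    have cd: "c - 1 < d - 1" "d - 1 < length L" "c - 1 < length L" "Suc (c - 1) = c" "Suc (d - 1) = d"
      using that by (auto simp: S_def)
    have "pre_less (L ! (c - 1)) (L ! (d - 1))"
      using sorted_wrt_nth_less[OF sorted_L cd(1,2)] .
    moreover have "L ! (c - 1) = (st c, en c)" "L ! (d - 1) = (st d, en d)"
      using nth[OF cd(3)] nth[OF cd(2)] cd(4,5) by simp_all
    ultimately show ?thesis by (simp add: pre_less_def)
  qed
  have en_le: "en c \<le> en 0" if "c < S" for c
  proof (cases "c = 0")
    case False
    then have "(st c, en c) \<in> {(i, j). strong i j}"
      using bij_nodes that unfolding bij_betw_def by force
    then have "en c < m" using strong_rng by auto
    then show ?thesis using root(2) by simp
  qed simp
  define par where "par = arr s8 ''par''"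
  have enc: "encloser en c (par c)" if "0 < c" "c < S" for c
    using par_prog[of s7 "2 * ?n" en S] v[of s7] en_le S that by (simp add: s8_def par_def en_def)
  have nbrs: "map (arr s9 ''nbr'') [arr s9 ''first'' c..<arr s9 ''first'' (Suc c)] =
    (if c = 0 then [] else [par c]) @ filter (\<lambda>d. par d = c) [Suc c..<S]" if "c < S" for c
    using nbr_prog[of s8 "2 * ?n" S par] v[of s8] S size7 z(4) that
    by (simp add: s9_def s8_def par_def fr)
  have lab_prems: "var s9 ''n'' = ?n" "var s9 ''m'' = m" "var s9 ''N'' = 2 * ?n"
      "arr s9 ''st'' = st" "arr s9 ''en'' = en"
    using v[of s8] by (simp_all add: s9_def s8_def st_def en_def fr)
  have carry: "arr s9 ''perm'' = perm" "arr s9 ''md'' = arr s5 ''md''"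
    by (simp_all add: s9_def s8_def s7_def s6_def s5_def s4_def perm_def fr)
  have leaf: "arr t ''leaf'' c = (if c = 0 then m else perm (st c))" if "c < S" for c
    using label_prog(1)[OF lab_prems] that S by (simp add: t_def carry)
  have kind: "arr t ''kind'' c = (if \<exists>p<m. st c < p \<and> p \<le> en c \<and>
      arr s5 ''md'' (st c * ?n + (p - 1)) = 1 \<and> arr s5 ''md'' (p * ?n + en c) = 1 then 1 else 2)"
    if "c < S" for c
    using label_prog(2)[OF lab_prems] that S by (simp add: t_def carry)

  let ?T = "decode_tree f t"
  have nodes_T: "nodes ?T = {..<S}"
    using size7 by (simp add: decode_tree_def t_def s9_def s8_def fr)
  have nbrs_T: "nbrs ?T c = (if c = 0 then [] else [par c]) @ filter (\<lambda>d. par d = c) [Suc c..<S]"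
    if "c < S" for c
    using nbrs[OF that] by (simp add: decode_tree_def t_def fr)
  have leaf_T: "leaf_label ?T c = (if c = 0 then f m else f (perm (st c)))" if "c < S" for c
    using leaf[OF that] by (simp add: decode_tree_def)
  have kind_T: "kind ?T c = (if \<exists>p. cut (st c) (en c) p then Circular else Prime)"
    if "0 < c" "c < S" for c
  proof -
    have "(st c, en c) \<in> {(i, j). strong i j}"
      using bij_nodes that unfolding bij_betw_def by force
    then have "en c < m" using strong_rng by auto
    then have iff: "p < m \<and> st c < p \<and> p \<le> en c \<and> arr s5 ''md'' (st c * ?n + (p - 1)) = 1 \<and>
        arr s5 ''md'' (p * ?n + en c) = 1 \<longleftrightarrow> cut (st c) (en c) p" for p
    proof (cases "st c < p \<and> p \<le> en c")
      case True
      have "(arr s5 ''md'' (st c * ?n + (p - 1)) = 1) = interval_module (st c) (p - 1)"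
        by (rule md5) (use True \<open>en c < m\<close> in auto)
      moreover have "(arr s5 ''md'' (p * ?n + en c) = 1) = interval_module p (en c)"
        by (rule md5) (use True \<open>en c < m\<close> in auto)
      moreover have "p < m" using True \<open>en c < m\<close> by simp
      ultimately show ?thesis using True unfolding cut_def by blast
    qed (auto simp: cut_def)
    then have "(\<exists>p<m. st c < p \<and> p \<le> en c \<and> arr s5 ''md'' (st c * ?n + (p - 1)) = 1 \<and>
        arr s5 ''md'' (p * ?n + en c) = 1) \<longleftrightarrow> (\<exists>p. cut (st c) (en c) p)"
      using iff by blast
    then show ?thesis using kind[OF that(2)] by (simp add: decode_tree_def)
  qed
  interpret decomposition_tree m interval_module S par ?T st en X "\<lambda>i. f (perm i)" "f m"
  proof unfold_locales
    show "0 < S" by (simp add: S_def)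
    show "0 < c \<Longrightarrow> c < S \<Longrightarrow> par c < c" for c using enc by (simp add: encloser_def)
    show "0 < c \<Longrightarrow> c < S \<Longrightarrow> en c \<le> en (par c)" for c using enc by (simp add: encloser_def)
    show "par c < d \<Longrightarrow> d < c \<Longrightarrow> c < S \<Longrightarrow> en d < en c" for c d
      using enc[of c] by (simp add: encloser_def)
    show "bij_betw (\<lambda>i. f (perm i)) {..<m} (X - {f m})" by (rule bij_f_perm)
    show "f m \<in> X" by (rule f_in) simp
    show "leaf_label ?T 0 = f m" using leaf_T[of 0] by (simp add: S_def)
    show "0 < c \<Longrightarrow> c < S \<Longrightarrow> leaf_label ?T c = f (perm (st c))" for c using leaf_T[of c] by simp
    show "0 < c \<Longrightarrow> c < S \<Longrightarrow> st c < en c \<Longrightarrow>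
        kind ?T c = (if \<exists>p. cut (st c) (en c) p then Circular else Prime)" for c
      by (rule kind_T)
  qed (fact nodes_T nbrs_T root bij_nodes preorder)+
  show ?thesis unfolding t
    by (rule umodular_tree_T) (simp add: umod_bips_interval bip_def image_image)
qed

end

section \<open>Time and word bounds of the whole program\<close>

lemmas main_prog_defs =
  main_prog_def switch_prog_def switch_row_def switch_cell_def arcs3_def
  sort_prog_def sort_step_def count_row_def in_test_def refine_row_def perm_prog_def
  split_prog_def split_step_def split_row_def split_cell_def separated_def
  module_prog_def module_step_def module_row_def module_cell_def
  strong_prog_def strong_step_def strong_row_def strong_cell_def
  node_prog_def node_row_def par_prog_def par_row_def nbr_prog_def nbr_step_def child_row_def
  label_prog_def label_step_def kind_row_def cut_test_def

lemma wf_init_prog: "wf_prog 60 {''n''} init_prog"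
  by (simp add: init_prog_def)

text \<open>The most expensive expression is the parity in \<open>switch_cell\<close>, of cost 45;
  the bound 60 leaves some room.\<close>

lemma wf_main_prog: "wf_prog 60 {''m'', ''N''} main_prog"
  by (simp add: main_prog_defs)

lemma depth_init_prog: "depth init_prog = 1"
  by (simp add: init_prog_def)

lemma depth_main_prog: "depth main_prog = 2"
  by (simp add: main_prog_defs)

definition total_coef :: nat where
  "total_coef = coef init_prog + coef main_prog"

text \<open>The loops of the initialisation are bounded by \<open>n\<close> and those of the main
  program by \<open>2 * n\<close>; both costs are compared with the same square.\<close>

lemma total_cost:
  "cost n init_prog + cost (2 * n) main_prog \<le> total_coef * (2 * n + 1)\<^sup>2"
proof -
  have "(n + 1) ^ 1 \<le> (2 * n + 1) ^ 1" by simp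
  also have "\<dots> \<le> (2 * n + 1)\<^sup>2" by (rule power_increasing) auto
  finally have "coef init_prog * (n + 1) ^ 1 \<le> coef init_prog * (2 * n + 1)\<^sup>2"
    by (rule mult_le_mono2)
  moreover have "cost n init_prog \<le> coef init_prog * (n + 1) ^ 1"
    by (rule cost_le) (simp add: depth_init_prog)
  moreover have "cost (2 * n) main_prog \<le> coef main_prog * (2 * n + 1)\<^sup>2"
    by (rule cost_le) (simp add: depth_main_prog)
  ultimately show ?thesis unfolding total_coef_def add_mult_distrib by linarith
qed

text \<open>A constant factor is absorbed by the base \<open>n + 2\<close>, which is at least 2:
  with \<open>K = 4 * total_coef + 1\<close>, \<open>K \<le> 2 ^ K \<le> (n + 2) ^ K\<close>. The
  square adds 2 to the exponent, the expression cost multiplies it by 60, and the final 1 makes the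
  inequality strict.\<close>

lemma word_bound:
  "(n + 2 + total_coef * (2 * n + 1)\<^sup>2) ^ 60 < (n + 2) ^ (60 * (4 * total_coef + 3) + 1)"
proof -
  let ?K = "4 * total_coef + 1"
  have "(2 * n + 1)\<^sup>2 \<le> (2 * (n + 2))\<^sup>2" by (rule power_mono) auto
  also have "(2 * (n + 2))\<^sup>2 = 4 * (n + 2)\<^sup>2" unfolding power_mult_distrib by simp
  finally have "total_coef * (2 * n + 1)\<^sup>2 \<le> total_coef * (4 * (n + 2)\<^sup>2)"
    by (rule mult_le_mono2)
  moreover have "n + 2 \<le> (n + 2)\<^sup>2" by (simp add: power2_eq_square)
  ultimately have "n + 2 + total_coef * (2 * n + 1)\<^sup>2 \<le> (n + 2)\<^sup>2 + total_coef * (4 * (n + 2)\<^sup>2)"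
    by (intro add_mono)
  also have "\<dots> = ?K * (n + 2)\<^sup>2"
    by (simp only: add_mult_distrib mult_1 mult.assoc mult.left_commute add.commute)
  also have "?K \<le> 2 ^ ?K" by (rule less_imp_le) (rule less_exp)
  then have "?K * (n + 2)\<^sup>2 \<le> 2 ^ ?K * (n + 2)\<^sup>2" by (rule mult_le_mono1)
  also have "(2::nat) ^ ?K \<le> (n + 2) ^ ?K" by (rule power_mono) auto
  then have "2 ^ ?K * (n + 2)\<^sup>2 \<le> (n + 2) ^ ?K * (n + 2)\<^sup>2" by (rule mult_le_mono1)
  also have "\<dots> = (n + 2) ^ (4 * total_coef + 3)"
    unfolding power_add[symmetric] by (rule arg_cong[of _ _ "power (n + 2)"]) simp
  finally have "(n + 2 + total_coef * (2 * n + 1)\<^sup>2) ^ 60 \<le> ((n + 2) ^ (4 * total_coef + 3)) ^ 60"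
    by (rule power_mono) simp
  also have "\<dots> = (n + 2) ^ (60 * (4 * total_coef + 3))" by (simp only: power_mult[symmetric] mult.commute)
  also have "\<dots> < (n + 2) ^ (60 * (4 * total_coef + 3) + 1)" by (rule power_strict_increasing) auto
  finally show ?thesis .
qed

theorem proposition10:
  shows "\<exists>(P :: com) (c :: nat) (time :: nat \<Rightarrow> nat).
    (\<lambda>n. real (time n)) \<in> O(\<lambda>n. real n ^ 2) \<and>
    (\<forall>(X :: 'a set) R f.
       tournament X R \<and> X \<noteq> {} \<and> bij_betw f {..<card X} X \<longrightarrow>
       (\<exists>k t. run ((card X + 2) ^ c) P (encode_tournament (card X) f R) k t \<and>
              k \<le> time (card X) \<and>
              umodular_tree X R (decode_tree f t)))"
proof (intro exI conjI)
  let ?P = "Seq (compile init_prog) (compile main_prog)"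
  let ?c = "60 * (4 * total_coef + 3) + 1"
  let ?time = "\<lambda>n. total_coef * (2 * n + 1)\<^sup>2"
  show "(\<lambda>n. real (?time n)) \<in> O(\<lambda>n. real n ^ 2)"
  proof (rule bigoI)
    show "\<forall>\<^sub>F n in sequentially. norm (real (?time n)) \<le> real (total_coef * 9) * norm (real n ^ 2)"
      using eventually_ge_at_top[of 1]
    proof eventually_elim
      case (elim n)
      \<comment> \<open>For \<open>n \<ge> 1\<close> one has \<open>2 * n + 1 \<le> 3 * n\<close>,
        whence the factor 9.\<close>
      then have "(2 * n + 1)\<^sup>2 \<le> (3 * n)\<^sup>2" by (intro power_mono) auto
      then have "?time n \<le> total_coef * 9 * n\<^sup>2"
        by (simp add: power_mult_distrib)
      then have "real (?time n) \<le> real (total_coef * 9 * n\<^sup>2)" by (rule of_nat_mono)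
      then show ?case by simp
    qed
  qed
  show "\<forall>(X :: 'a set) R f.
       tournament X R \<and> X \<noteq> {} \<and> bij_betw f {..<card X} X \<longrightarrow>
       (\<exists>k t. run ((card X + 2) ^ ?c) ?P (encode_tournament (card X) f R) k t \<and>
              k \<le> ?time (card X) \<and>
              umodular_tree X R (decode_tree f t))"
  proof (intro allI impI, elim conjE)
    fix X :: "'a set" and R f
    assume X: "tournament X R" "X \<noteq> {}" and f: "bij_betw f {..<card X} X"
    have "finite X" using X by (simp add: tournament_def)
    then obtain m where card: "card X = Suc m" using X(2) by (cases "card X") auto
    interpret indexed_tournament X R f m
      using X f card by unfold_locales simp_all
    let ?n = "card X" and ?W = "(card X + 2) ^ ?c"
    define Z where "Z = ?n + 2 + total_coef * (2 * ?n + 1)\<^sup>2"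
    define s where "s = encode_tournament ?n f R"
    define s' where "s' = ev init_prog s"
    have vars: "var s x = (if x = ''n'' then ?n else 0)" for x
      by (simp add: s_def encode_tournament_def)
    have Z: "?n + 2 + cost ?n init_prog + cost (2 * ?n) main_prog \<le> Z"
      using total_cost[of ?n] by (simp add: Z_def)
    have W: "Z ^ 60 < ?W" unfolding Z_def by (rule word_bound)
    \<comment> \<open>\<open>n + 2\<close> dominates the input and is at least 2, as the growth
      estimate requires.\<close>
    have cells: "cells_le (?n + 2) s"
      by (auto simp: cells_le_def s_def encode_tournament_def)
    obtain k where k: "k \<le> cost ?n init_prog" "run ?W (compile init_prog) s k s'"
      using run_compile[OF wf_init_prog cells, of ?n Z ?W] Z W vars by (auto simp: s'_def)
    have s': "var s' ''N'' = 2 * ?n" "var s' ''m'' = ?n - 1" "var s' ''n'' = ?n" "var s' ''q'' = 0"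
        "arr s' = arr s"
      using init_prog[of s] vars by (simp_all add: s'_def)
    have cells': "cells_le (?n + 2 + cost ?n init_prog) s'"
      using ev_cells_le[OF wf_init_prog cells, of ?n] vars by (simp add: s'_def)
    have bounds: "\<forall>y\<in>{''m'', ''N''}. var s' y \<le> 2 * ?n" using s' by simp
    obtain l where l: "l \<le> cost (2 * ?n) main_prog" "run ?W (compile main_prog) s' l (ev main_prog s')"
      using run_compile[OF wf_main_prog cells', of "2 * ?n" Z ?W] Z W bounds by auto
    have "run ?W ?P s (k + l) (ev main_prog s')" using k l by (auto intro: run.Seq)
    moreover have "k + l \<le> ?time ?n" using k l total_cost[of ?n] by linarith
    moreover have "umodular_tree X R (decode_tree f (ev main_prog s'))"
    proof (rule main_prog)
      fix i j assume ij: "i < Suc m" "j < Suc m"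
      have "i * Suc m + j < Suc i * Suc m" using ij by simp
      also have "\<dots> \<le> Suc m * Suc m" using ij by (intro mult_le_mono1) simp
      finally have "i * Suc m + j < Suc m * Suc m" .
      moreover have "(i * Suc m + j) div Suc m = i" "(i * Suc m + j) mod Suc m = j"
        using ij by (simp_all add: div_mult_self3 del: mult_Suc_right)
      ultimately show "arr s' ''arc'' (i * Suc m + j) = of_bool (a i j)"
        using card by (simp add: s' s_def encode_tournament_def a_def del: mult_Suc_right)
    qed (use s' card in \<open>simp_all add: s_def encode_tournament_def\<close>)
    ultimately show "\<exists>k t. run ?W ?P (encode_tournament ?n f R) k t \<and> k \<le> ?time ?n \<and>
        umodular_tree X R (decode_tree f t)"
      unfolding s_def[symmetric] by blast
  qed
qed

end
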